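(* Let $d\ge 3$, and let $\mu:\mathbb{R}^d\to\mathbb{R}$ be a regular and Penrose stable equilibrium (both notions are defined in the context). Let $k>d$ and let $\sigma,p\in(1,+\infty)$ satisfy $p(\sigma-1)>2d$, and let $p'$ be given by $1/p+1/p'=1$. Then there exist $\bar\varepsilon>0$ and $C>0$ such that the following holds for every $\varepsilon_0\in(0,\bar\varepsilon]$. Let $f_0\in W^{1,\infty}(\mathbb{R}^d_x\times\mathbb{R}^d_v)\cap W^{1,1}(\mathbb{R}^d_x\times\mathbb{R}^d_v)$ satisfy $\|\langle v\rangle^{k/p'}f_0\|_{W^{\sigma,p}_{x,v}}<+\infty$ and $$\|\langle v\rangle^k f_0\|_{W^{1,\infty}}+\|f_0\|_{W^{1,1}}+\|f_0\|_{L^1_xL^\infty_v}+\|\nabla_{x,v}f_0\|_{L^1_xL^\infty_v}\le\varepsilon_0 ,$$ and let $f$ be the unique global solution of $$\left\{\begin{aligned}&\partial_t f+v\cdot\nabla_xf+E\cdot\nabla_v\mu=-E\cdot\nabla_vf,\\&E=-\nabla_x(1-\Delta_x)^{-1}\rho,\qquad \rho(t,x)=\int_{\mathbb{R}^d}f(t,x,v)\,dv,\\&f|_{t=0}=f_0,\end{aligned}\right.$$ described in the context. Then there exist functions $Y_\infty,W_\infty:\mathbb{R}^d\times\mathbb{R}^d\to\mathbb{R}^d$ with $$\|Y_\infty\|_{L^\infty_{x,v}}+\|W_\infty\|_{L^\infty_{x,v}}\le C\varepsilon_0$$ such that the function $$f_\infty(x,v)=f_0\big(x+Y_\infty(x,v),\,v+W_\infty(x,v)\big)+\mu\big(v+W_\infty(x,v)\big)-\mu(v)$$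 belongs to $W^{1,\infty}$ and, for all $t\ge0$, $$\|f(t,x+tv,v)-f_\infty(x,v)\|_{L^\infty_{x,v}}\le C\,\varepsilon_0\,\frac{\log(2+t)}{\langle t\rangle^{d-1}} .$$
   Context: Notation: $\langle y\rangle=\sqrt{1+|y|^2}$; $\|g\|_{L^1_xL^\infty_v}=\int_{\mathbb{R}^d}\|g(x,\cdot)\|_{L^\infty_v}\,dx$; $\widehat g(\xi)=\int_{\mathbb{R}^d}e^{-ix\cdot\xi}g(x)\,dx$. $W^{\sigma,p}_{k/p'}$ denotes the space of functions $g(x,v)$ with $\langle v\rangle^{k/p'}g\in W^{\sigma,p}_{x,v}$. An equilibrium $\mu$ (a function of $v\in\mathbb{R}^d$ with $\int_{\mathbb{R}^d}\mu\,dv=1$) is called regular if $\mu\in L^1(\mathbb{R}^d)$ is a smooth decaying function with $\langle v\rangle^{k_0}\nabla_v\mu\in W^{2,\infty}$ for some $k_0>d$ and $\langle v\rangle^{4d+6}\nabla_v\mu\in W^{2d+5,1}$. It is called Penrose stable if there is $\kappa>0$ such that $$\inf_{\gamma\ge0}\ \inf_{\tau\in\mathbb{R},\,\xi\in\mathbb{R}^d}\left|1-\int_0^{+\infty}e^{-(\gamma+i\tau)s}\frac{1}{1+|\xi|^2}\,i\xi\cdot\widehat{\nabla_v\mu}(s\xi)\,ds\right|\ge\kappa .$$ For $\bar\varepsilon$ small enough, under the stated hypotheses on $f_0$ there is a unique global classical solution $f\in\mathscr{C}([0,+\infty),W^{1,1}\cap W^{\sigma,p}_{k/p'})$ satisfying,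 for all $t\ge 0$, $\|\rho(t)\|_{L^1}+\langle t\rangle\|\nabla_x\rho(t)\|_{L^1}+\langle t\rangle^d\|\rho(t)\|_{L^\infty}+\langle t\rangle^{d+1}\|\nabla_x\rho(t)\|_{L^\infty}\lesssim\varepsilon_0\log(2+t)$; this is the solution $f$ referred to in the claim. *)

theory Defs
  imports "HOL-Analysis.Analysis" "HOL-Probability.Essential_Supremum"
begin

definition japanese :: "'a::real_normed_vector \<Rightarrow> real" where
  "japanese y = sqrt (1 + (norm y)\<^sup>2)"


section \<open>Classical derivatives\<close>

definition pderiv_dir :: "'a \<Rightarrow> ('a::euclidean_space \<Rightarrow> real) \<Rightarrow> 'a \<Rightarrow> real" where
  "pderiv_dir b g x = frechet_derivative g (at x) b"

definition gradient :: "('a::euclidean_space \<Rightarrow> real) \<Rightarrow> 'a \<Rightarrow> 'a" where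
  "gradient g x = (\<Sum>b\<in>Basis. pderiv_dir b g x *\<^sub>R b)"

fun C_n :: "nat \<Rightarrow> ('a::euclidean_space \<Rightarrow> real) \<Rightarrow> bool" where
  "C_n 0 g \<longleftrightarrow> continuous_on UNIV g"
| "C_n (Suc n) g \<longleftrightarrow> (\<forall>x. g differentiable (at x)) \<and> (\<forall>b\<in>Basis. C_n n (pderiv_dir b g))"

definition smooth :: "('a::euclidean_space \<Rightarrow> real) \<Rightarrow> bool" where
  "smooth g \<longleftrightarrow> (\<forall>n. C_n n g)"

definition test_function :: "('a::euclidean_space \<Rightarrow> real) \<Rightarrow> bool" where
  "test_function \<psi> \<longleftrightarrow> smooth \<psi> \<and> compact (closure {x. \<psi> x \<noteq> 0})"


section \<open>Lebesgue norms\<close>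

text \<open>All norms take values in \<^typ>\<open>ennreal\<close>: a function lies in a space iff its norm is finite,
  and non-measurable functions have infinite norm.\<close>

definition ennreal_powr :: "ennreal \<Rightarrow> real \<Rightarrow> ennreal" where
  "ennreal_powr a r = (if a = \<infinity> then \<infinity> else ennreal (enn2real a powr r))"

definition Lp_norm :: "ennreal \<Rightarrow> ('a::euclidean_space \<Rightarrow> 'b::euclidean_space) \<Rightarrow> ennreal" where
  "Lp_norm p g =
    (if g \<notin> borel_measurable borel then \<infinity>
     else if p = \<infinity> then esssup lborel (\<lambda>x. ennreal (norm (g x)))
     else ennreal_powr (\<integral>\<^sup>+ x. ennreal (norm (g x) powr enn2real p) \<partial>lborel) (1 / enn2real p))"

definition L1x_Linfv_norm ::
    "('a::euclidean_space \<times> 'a \<Rightarrow> 'b::euclidean_space) \<Rightarrow> ennreal" where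
  "L1x_Linfv_norm g =
    (if g \<notin> borel_measurable borel then \<infinity>
     else \<integral>\<^sup>+ x. esssup lborel (\<lambda>v. ennreal (norm (g (x, v)))) \<partial>lborel)"


section \<open>Weak derivatives and Sobolev norms\<close>

definition locally_integrable :: "('a::euclidean_space \<Rightarrow> real) \<Rightarrow> bool" where
  "locally_integrable g \<longleftrightarrow> (\<forall>K. compact K \<longrightarrow> set_integrable lborel K g)"

text \<open>A list of basis vectors encodes an iterated partial derivative; its length is the order.\<close>

definition weak_derivative ::
    "'a list \<Rightarrow> ('a::euclidean_space \<Rightarrow> real) \<Rightarrow> ('a \<Rightarrow> real) \<Rightarrow> bool" where
  "weak_derivative bs g h \<longleftrightarrow>
     locally_integrable g \<and> locally_integrable h \<and>
     (\<forall>\<psi>. test_function \<psi> \<longrightarrow>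
        (LINT x|lborel. g x * foldr pderiv_dir bs \<psi> x) =
        (-1) ^ length bs * (LINT x|lborel. h x * \<psi> x))"

definition weak_gradient ::
    "('a::euclidean_space \<Rightarrow> real) \<Rightarrow> ('a \<Rightarrow> 'a) \<Rightarrow> bool" where
  "weak_gradient g G \<longleftrightarrow> (\<forall>b\<in>Basis. weak_derivative [b] g (\<lambda>x. G x \<bullet> b))"

text \<open>Weak derivatives are unique up to null sets, so the infima below run over a.e. equal functions
  and pick out the norm of the weak derivative; if there is none, the infimum over the
  empty set is \<^term>\<open>\<infinity> :: ennreal\<close>.\<close>

definition weak_derivative_norm ::
    "(('a \<Rightarrow> real) \<Rightarrow> ennreal) \<Rightarrow> 'a list \<Rightarrow> ('a::euclidean_space \<Rightarrow> real) \<Rightarrow> ennreal" where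
  "weak_derivative_norm N bs g = (INF h\<in>{h. weak_derivative bs g h}. N h)"

definition weak_gradient_norm ::
    "(('a \<Rightarrow> 'a) \<Rightarrow> ennreal) \<Rightarrow> ('a::euclidean_space \<Rightarrow> real) \<Rightarrow> ennreal" where
  "weak_gradient_norm N g = (INF G\<in>{G. weak_gradient g G}. N G)"

text \<open>The \<open>W\<^sup>n\<^sup>,\<^sup>p\<close> norm for integer \<open>n\<close>. Mixed derivatives are counted once per ordering, which
  changes the norm only up to equivalence, and not at all for \<open>n \<le> 1\<close>.\<close>

definition sobolev_norm :: "nat \<Rightarrow> ennreal \<Rightarrow> ('a::euclidean_space \<Rightarrow> real) \<Rightarrow> ennreal" where
  "sobolev_norm n p g =
    (\<Sum>bs\<in>{bs. set bs \<subseteq> Basis \<and> length bs \<le> n}. weak_derivative_norm (Lp_norm p) bs g)"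

definition gagliardo_seminorm :: "real \<Rightarrow> real \<Rightarrow> ('a::euclidean_space \<Rightarrow> real) \<Rightarrow> ennreal" where
  "gagliardo_seminorm s p h =
    ennreal_powr
      (\<integral>\<^sup>+ z. \<integral>\<^sup>+ w. ennreal (\<bar>h z - h w\<bar> powr p / norm (z - w) powr (real DIM('a) + s * p))
         \<partial>lborel \<partial>lborel)
      (1 / p)"

text \<open>The \<open>W\<^sup>\<sigma>\<^sup>,\<^sup>p\<close> norm for real \<open>\<sigma> \<ge> 0\<close> and \<open>1 \<le> p < \<infinity>\<close> (Sobolev--Slobodeckij).\<close>

definition slobodeckij_norm :: "real \<Rightarrow> real \<Rightarrow> ('a::euclidean_space \<Rightarrow> real) \<Rightarrow> ennreal" where
  "slobodeckij_norm \<sigma> p g =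
    sobolev_norm (nat \<lfloor>\<sigma>\<rfloor>) (ennreal p) g +
    (if frac \<sigma> = 0 then 0
     else \<Sum>bs\<in>{bs. set bs \<subseteq> Basis \<and> length bs = nat \<lfloor>\<sigma>\<rfloor>}.
            weak_derivative_norm (gagliardo_seminorm (frac \<sigma>) p) bs g)"

definition v_weight :: "real \<Rightarrow> ('a::euclidean_space \<times> 'a \<Rightarrow> real) \<Rightarrow> 'a \<times> 'a \<Rightarrow> real" where
  "v_weight r g = (\<lambda>(x, v). japanese v powr r * g (x, v))"


section \<open>Fourier transform and equilibria\<close>

definition fourier :: "('a::euclidean_space \<Rightarrow> real) \<Rightarrow> 'a \<Rightarrow> complex" where
  "fourier g \<xi> = (LINT x|lborel. exp (- \<i> * of_real (x \<bullet> \<xi>)) * of_real (g x))"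

definition regular_equilibrium :: "('a::euclidean_space \<Rightarrow> real) \<Rightarrow> bool" where
  "regular_equilibrium \<mu> \<longleftrightarrow>
     integrable lborel \<mu> \<and> (LINT v|lborel. \<mu> v) = 1 \<and>
     smooth \<mu> \<and> (\<mu> \<longlongrightarrow> 0) at_infinity \<and>
     (\<exists>k0 > real DIM('a). \<forall>b\<in>Basis.
        sobolev_norm 2 \<infinity> (\<lambda>v. japanese v powr k0 * pderiv_dir b \<mu> v) < \<infinity>) \<and>
     (\<forall>b\<in>Basis.
        sobolev_norm (2 * DIM('a) + 5) 1
          (\<lambda>v. japanese v ^ (4 * DIM('a) + 6) * pderiv_dir b \<mu> v) < \<infinity>)"

definition penrose_symbol :: "('a::euclidean_space \<Rightarrow> real) \<Rightarrow> real \<Rightarrow> real \<Rightarrow> 'a \<Rightarrow> complex" where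
  "penrose_symbol \<mu> \<gamma> \<tau> \<xi> =
     1 - (LINT s:{0..}|lborel.
            exp (- (of_real \<gamma> + \<i> * of_real \<tau>) * of_real s) * of_real (1 / (1 + (norm \<xi>)\<^sup>2)) *
            (\<Sum>b\<in>Basis. \<i> * of_real (\<xi> \<bullet> b) * fourier (pderiv_dir b \<mu>) (s *\<^sub>R \<xi>)))"

definition penrose_stable :: "('a::euclidean_space \<Rightarrow> real) \<Rightarrow> bool" where
  "penrose_stable \<mu> \<longleftrightarrow>
     (\<exists>\<kappa>>0. (INF \<gamma>\<in>{0..}. INF (\<tau>, \<xi>)\<in>UNIV. cmod (penrose_symbol \<mu> \<gamma> \<tau> \<xi>)) \<ge> \<kappa>)"


section \<open>The screened Vlasov--Poisson system\<close>

definition density :: "('a::euclidean_space \<times> 'a \<Rightarrow> real) \<Rightarrow> 'a \<Rightarrow> real" where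
  "density g x = (LINT v|lborel. g (x, v))"

text \<open>\<open>\<phi> = (1 - \<Delta>)\<^sup>-\<^sup>1 \<rho>\<close> as a Fourier multiplier, for integrable \<open>\<rho>\<close>. This determines
  \<open>\<phi>\<close> almost everywhere, hence everywhere once \<open>\<phi>\<close> is continuous.\<close>

definition screened_potential ::
    "('a::euclidean_space \<Rightarrow> real) \<Rightarrow> ('a \<Rightarrow> real) \<Rightarrow> bool" where
  "screened_potential \<rho> \<phi> \<longleftrightarrow>
     integrable lborel \<rho> \<and> integrable lborel \<phi> \<and>
     (\<forall>\<xi>. fourier \<phi> \<xi> = of_real (1 / (1 + (norm \<xi>)\<^sup>2)) * fourier \<rho> \<xi>)"

definition screened_field :: "('a::euclidean_space \<Rightarrow> real) \<Rightarrow> ('a \<Rightarrow> 'a) \<Rightarrow> bool" where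
  "screened_field \<rho> E \<longleftrightarrow> (\<exists>\<phi>. screened_potential \<rho> \<phi> \<and> (\<forall>x. GDERIV \<phi> x :> - E x))"

text \<open>Classical solutions are \<open>C\<^sup>1\<close> on \<open>[0,\<infinity>) \<times> \<real>\<^sup>d \<times> \<real>\<^sup>d\<close> (one-sided in time at \<open>t = 0\<close>).
  Here \<open>ft\<close>, \<open>fx\<close>, \<open>fv\<close> are the time derivative and the gradients in \<open>x\<close> and \<open>v\<close>.\<close>

definition classical_solution ::
    "('a::euclidean_space \<Rightarrow> real) \<Rightarrow> ('a \<times> 'a \<Rightarrow> real) \<Rightarrow> (real \<Rightarrow> 'a \<times> 'a \<Rightarrow> real) \<Rightarrow> bool" where
  "classical_solution \<mu> f0 f \<longleftrightarrow>
     (\<exists>ft fx fv E.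
        continuous_on ({0..} \<times> UNIV) (\<lambda>(t, z). ft t z :: real) \<and>
        continuous_on ({0..} \<times> UNIV) (\<lambda>(t, z). fx t z :: 'a) \<and>
        continuous_on ({0..} \<times> UNIV) (\<lambda>(t, z). fv t z :: 'a) \<and>
        (\<forall>t\<ge>0. \<forall>x v.
           ((\<lambda>(t, z). f t z) has_derivative
              (\<lambda>(\<tau>, y, w). \<tau> * ft t (x, v) + y \<bullet> fx t (x, v) + w \<bullet> fv t (x, v)))
             (at (t, x, v) within {0..} \<times> UNIV)) \<and>
        (\<forall>t\<ge>0. screened_field (density (f t)) (E t)) \<and>
        (\<forall>t\<ge>0. \<forall>x v.
           ft t (x, v) + v \<bullet> fx t (x, v) + E t x \<bullet> gradient \<mu> v = - (E t x \<bullet> fv t (x, v)))) \<and>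
     (\<forall>z. f 0 z = f0 z)"

text \<open>\<open>f \<in> C([0,\<infinity>), X)\<close> for a space \<open>X\<close> given by an extended norm \<open>N\<close>.\<close>

definition continuous_in_time ::
    "(('a \<Rightarrow> real) \<Rightarrow> ennreal) \<Rightarrow> (real \<Rightarrow> 'a \<Rightarrow> real) \<Rightarrow> bool" where
  "continuous_in_time N f \<longleftrightarrow>
     (\<forall>t\<ge>0. N (f t) < \<infinity> \<and> ((\<lambda>s. N (\<lambda>z. f s z - f t z)) \<longlongrightarrow> 0) (at t within {0..}))"

text \<open>The density estimate, with \<open>M\<close> the constant implicit in the sign \<open>\<lesssim>\<close>.\<close>

definition density_decay ::
    "real \<Rightarrow> real \<Rightarrow> (real \<Rightarrow> 'a::euclidean_space \<times> 'a \<Rightarrow> real) \<Rightarrow> bool" where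
  "density_decay M \<epsilon>0 f \<longleftrightarrow>
     (\<forall>t\<ge>0. let \<rho> = density (f t) in
        Lp_norm 1 \<rho>
        + ennreal (japanese t) * weak_gradient_norm (Lp_norm 1) \<rho>
        + ennreal (japanese t ^ DIM('a)) * Lp_norm \<infinity> \<rho>
        + ennreal (japanese t ^ (DIM('a) + 1)) * weak_gradient_norm (Lp_norm \<infinity>) \<rho>
        \<le> ennreal (M * \<epsilon>0 * ln (2 + t)))"

definition global_solution ::
    "('a::euclidean_space \<Rightarrow> real) \<Rightarrow> real \<Rightarrow> real \<Rightarrow> real \<Rightarrow> real \<Rightarrow> real \<Rightarrow> real \<Rightarrow>
     ('a \<times> 'a \<Rightarrow> real) \<Rightarrow> (real \<Rightarrow> 'a \<times> 'a \<Rightarrow> real) \<Rightarrow> bool" where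
  "global_solution \<mu> k \<sigma> p p' M \<epsilon>0 f0 f \<longleftrightarrow>
     classical_solution \<mu> f0 f \<and>
     continuous_in_time (sobolev_norm 1 1) f \<and>
     continuous_in_time (\<lambda>g. slobodeckij_norm \<sigma> p (v_weight (k / p') g)) f \<and>
     density_decay M \<epsilon>0 f"

end

theory Submission
  imports Defs "HOL-Probability.Probability" "HOL-Real_Asymp.Real_Asymp"
begin

text \<open>
  The density estimate says that \<open>\<nabla>\<rho>\<close> decays like \<open>log (2 + t) / \<langle>t\<rangle>\<^sup>d\<^sup>+\<^sup>1\<close> in \<open>L\<^sup>\<infinity>\<close>. The field is
  \<open>E = - \<nabla>(1 - \<Delta>)\<^sup>-\<^sup>1 \<rho>\<close>, and both \<open>(1 - \<Delta>)\<^sup>-\<^sup>1\<close> and \<open>\<nabla>(1 - \<Delta>)\<^sup>-\<^sup>1\<close> are convolutions with integrable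
  kernels. Applied to \<open>\<nabla>\<rho>\<close> they show that \<open>E\<close> and its Lipschitz constant in \<open>x\<close> are
  \<open>O(\<epsilon>\<^sub>0 log (2 + t) / \<langle>t\<rangle>\<^sup>d\<^sup>+\<^sup>1)\<close>. Since \<open>d \<ge> 3\<close>, this is integrable in time even against the weight \<open>(2 + t)\<^sup>2\<close>, so that the characteristics
  \<open>X' = V, V' = E(t, X)\<close> converge to free motion: for small \<open>\<epsilon>\<^sub>0\<close> the equation
  \<open>y(s) = \<integral>\<^sub>s\<^sup>\<infinity> (\<sigma> - s) E(\<sigma>, x + \<sigma> v + y(\<sigma>)) d\<sigma>\<close>, which says that \<open>X(s) = x + s v + y(s)\<close> is the
  characteristic asymptotic to \<open>x + s v\<close>, is a contraction (\<open>ex_deviation\<close>). Its solution defines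
  \<open>Y\<^sub>\<infinity> = y(0)\<close> and \<open>W\<^sub>\<infinity> = - \<integral>\<^sub>0\<^sup>\<infinity> E(\<sigma>, X(\<sigma>)) d\<sigma>\<close>.

  The same contraction with the force switched off after time \<open>t\<close> yields the characteristic that passes
  through \<open>(x + t v, v)\<close> at time \<open>t\<close>. As \<open>f + \<mu>\<close> is constant along characteristics, this gives
  \<open>f(t, x + t v, v) = f\<^sub>0(x + Y\<^sub>t, v + W\<^sub>t) + \<mu>(v + W\<^sub>t) - \<mu>(v)\<close>
  (\<open>transported_along_characteristics\<close>). The two contractions differ by the force after time \<open>t\<close>, whose
  total effect is \<open>\<epsilon>\<^sub>0\<close> times \<open>\<integral>\<^sub>t\<^sup>\<infinity> \<sigma> log (2 + \<sigma>) / \<langle>\<sigma>\<rangle>\<^sup>d\<^sup>+\<^sup>1 d\<sigma> = O(log (2 + t) / \<langle>t\<rangle>\<^sup>d\<^sup>-\<^sup>1)\<close>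
  (\<open>shift_cutoff_le\<close>), and \<open>f\<^sub>0\<close> and \<open>\<mu>\<close> are Lipschitz; this is the claimed rate.

  Three pieces of analysis support the argument. First, the norms are defined through weak
  derivatives, so pointwise bounds have to be extracted by testing against bump functions
  (\<open>AE_nonneg_if_test\<close>, \<open>weak_derivative_bounded_imp_AE_Lipschitz\<close>). Second, the potential is given by its
  Fourier transform; it is an average over the heat semigroup (\<open>heat_conv_potential\<close>), and the bounds
  for the field follow from bounds for translates of Gaussians (\<open>field_bound\<close>, \<open>field_Lipschitz\<close>,
  \<open>field_small_if_density_L1_small\<close>). Third, \<open>f\<^sub>\<infinity>\<close> is Lipschitz, and such functions have bounded weak
  derivatives, obtained as weak limits of difference quotients (\<open>ex_bounded_weak_derivative\<close>).
\<close>

section \<open>Smooth bump functions\<close>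

text \<open>The derivatives of \<open>exp (- 1 / t)\<close> are this function times polynomials in \<open>1 / t\<close>, so admitting the
  polynomial factor makes the family closed under differentiation.\<close>

definition flat_exp :: "real poly \<Rightarrow> real \<Rightarrow> real" where
  "flat_exp p t = (if t > 0 then poly p (1 / t) * exp (- (1 / t)) else 0)"

lemma poly_times_exp_minus_tendsto_0:
  fixes p :: "real poly"
  shows "((\<lambda>u. poly p u * exp (- u)) \<longlongrightarrow> 0) at_top"
proof -
  have "((\<lambda>u. \<Sum>i\<le>degree p. coeff p i * (u ^ i / exp u)) \<longlongrightarrow> (\<Sum>i\<le>degree p. coeff p i * 0)) at_top"
    by (intro tendsto_intros tendsto_power_div_exp_0)
  then show ?thesis
    by (simp add: poly_altdef sum_distrib_right exp_minus divide_inverse mult.assoc)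
qed

text \<open>At \<open>t = 0\<close> the factor \<open>exp (- 1 / t)\<close> beats every power of \<open>1 / t\<close>.\<close>

lemma flat_exp_has_derivative:
  "(flat_exp p has_real_derivative flat_exp ([:0, 0, 1:] * (p - pderiv p)) t) (at t)"
proof -
  consider "t > 0" | "t < 0" | "t = 0" by linarith
  then show ?thesis
  proof cases
    case 1
    have "((\<lambda>t. poly p (1 / t) * exp (- (1 / t))) has_real_derivative
            flat_exp ([:0, 0, 1:] * (p - pderiv p)) t) (at t)"
      using 1 by (auto intro!: derivative_eq_intros poly_DERIV[THEN DERIV_chain2]
          simp: flat_exp_def field_simps power2_eq_square)
    then show ?thesis
      by (rule has_field_derivative_transform_within_open[of _ _ _ "{0<..}"])
        (use 1 in \<open>auto simp: flat_exp_def\<close>)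
  next
    case 2
    have "((\<lambda>t. 0) has_real_derivative flat_exp ([:0, 0, 1:] * (p - pderiv p)) t) (at t)"
      using 2 by (auto simp: flat_exp_def)
    then show ?thesis
      by (rule has_field_derivative_transform_within_open[of _ _ _ "{..<0}"])
        (use 2 in \<open>auto simp: flat_exp_def\<close>)
  next
    case 3
    have "((\<lambda>h. poly (pCons 0 p) (inverse h) * exp (- inverse h)) \<longlongrightarrow> 0) (at_right 0)"
      using filterlim_compose[OF poly_times_exp_minus_tendsto_0 filterlim_inverse_at_top_right] .
    then have r: "((\<lambda>h. flat_exp p h / h) \<longlongrightarrow> 0) (at_right 0)"
      by (rule Lim_transform_eventually)
        (auto simp: eventually_at_filter flat_exp_def field_simps)
    have l: "((\<lambda>h. flat_exp p h / h) \<longlongrightarrow> 0) (at_left 0)"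
      by (rule Lim_transform_eventually[OF tendsto_const])
        (auto simp: eventually_at_filter flat_exp_def)
    have "((\<lambda>h. flat_exp p h / h) \<longlongrightarrow> 0) (at 0)"
      using l r by (simp add: filterlim_at_split)
    then show ?thesis
      using 3 by (simp add: DERIV_def flat_exp_def)
  qed
qed

text \<open>Smoothness is proved by coinduction: each member of the family below has a derivative that is
  again a member. A product of two factors \<open>flat_exp\<close>, one rising and one falling, has compact
  support.\<close>

inductive_set bump_family :: "(real \<Rightarrow> real) set" where
  prod: "(\<lambda>t. flat_exp p (\<alpha> * t + \<beta>) * flat_exp q (\<gamma> * t + \<delta>)) \<in> bump_family"
| scale: "f \<in> bump_family \<Longrightarrow> (\<lambda>t. c * f t) \<in> bump_family"
| add: "f \<in> bump_family \<Longrightarrow> g \<in> bump_family \<Longrightarrow> (\<lambda>t. f t + g t) \<in> bump_family"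

lemma bump_family_derivative:
  "f \<in> bump_family \<Longrightarrow> \<exists>f'\<in>bump_family. \<forall>t. (f has_real_derivative f' t) (at t)"
proof (induction rule: bump_family.induct)
  case (prod p \<alpha> \<beta> q \<gamma> \<delta>)
  let ?D = "\<lambda>p. [:0, 0, 1:] * (p - pderiv p)"
  let ?f' = "\<lambda>t. \<alpha> * (flat_exp (?D p) (\<alpha> * t + \<beta>) * flat_exp q (\<gamma> * t + \<delta>)) +
    \<gamma> * (flat_exp p (\<alpha> * t + \<beta>) * flat_exp (?D q) (\<gamma> * t + \<delta>))"
  have "?f' \<in> bump_family"
    by (intro bump_family.intros)
  moreover have "((\<lambda>t. flat_exp p (\<alpha> * t + \<beta>) * flat_exp q (\<gamma> * t + \<delta>)) has_real_derivative ?f' t) (at t)" for t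
    by (rule derivative_eq_intros flat_exp_has_derivative[THEN DERIV_chain2] refl)+
      (simp add: algebra_simps)
  ultimately show ?case by (intro bexI[of _ ?f']) auto
next
  case (scale f c)
  then obtain f' where "f' \<in> bump_family" "\<forall>t. (f has_real_derivative f' t) (at t)" by blast
  then show ?case
    by (intro bexI[of _ "\<lambda>t. c * f' t"]) (auto intro: bump_family.intros DERIV_cmult)
next
  case (add f g)
  then obtain f' g' where "f' \<in> bump_family" "\<forall>t. (f has_real_derivative f' t) (at t)"
     "g' \<in> bump_family" "\<forall>t. (g has_real_derivative g' t) (at t)" by blast
  then show ?case
    by (intro bexI[of _ "\<lambda>t. f' t + g' t"]) (auto intro: bump_family.intros DERIV_add)
qed

lemma prod_bump_has_derivative:
  fixes F :: "'a::euclidean_space \<Rightarrow> real \<Rightarrow> real"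
  assumes "\<And>i t. i \<in> Basis \<Longrightarrow> (F i has_real_derivative F' i t) (at t)"
  shows "((\<lambda>x. \<Prod>i\<in>Basis. F i (x \<bullet> i)) has_derivative
     (\<lambda>y. \<Sum>i\<in>Basis. (y \<bullet> i * F' i (x \<bullet> i)) * (\<Prod>j\<in>Basis - {i}. F j (x \<bullet> j)))) (at x)"
proof (rule has_derivative_prod)
  fix i :: 'a assume "i \<in> Basis"
  have "(F i has_derivative (*) (F' i (x \<bullet> i))) (at (x \<bullet> i))"
    using assms[OF \<open>i \<in> Basis\<close>] by (simp add: has_field_derivative_def)
  moreover have "((\<lambda>x. x \<bullet> i) has_derivative (\<lambda>y. y \<bullet> i)) (at x)"
    by (intro derivative_intros)
  ultimately have "((\<lambda>x. F i (x \<bullet> i)) has_derivative (\<lambda>y. F' i (x \<bullet> i) * (y \<bullet> i))) (at x)"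
    by (rule has_derivative_compose[rotated])
  then show "((\<lambda>x. F i (x \<bullet> i)) has_derivative (\<lambda>y. y \<bullet> i * F' i (x \<bullet> i))) (at x)"
    by (simp only: mult.commute)
qed

text \<open>A partial derivative of a product of functions of one coordinate each replaces a single factor by its
  derivative, so the result is again such a product.\<close>

lemma prod_bump_C_n:
  fixes F :: "'a::euclidean_space \<Rightarrow> real \<Rightarrow> real"
  assumes "\<And>i. i \<in> Basis \<Longrightarrow> F i \<in> bump_family"
  shows "C_n n (\<lambda>x. \<Prod>i\<in>Basis. F i (x \<bullet> i))"
  using assms
proof (induction n arbitrary: F)
  case 0
  obtain F' where F': "\<And>i. i \<in> Basis \<Longrightarrow> F' i \<in> bump_family"
    "\<And>i t. i \<in> Basis \<Longrightarrow> (F i has_real_derivative F' i t) (at t)"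
    using bump_family_derivative[OF 0] by metis
  show ?case
    using prod_bump_has_derivative[OF F'(2)]
    by (auto intro!: continuous_at_imp_continuous_on has_derivative_continuous)
next
  case (Suc n)
  obtain F' where F': "\<And>i. i \<in> Basis \<Longrightarrow> F' i \<in> bump_family"
    "\<And>i t. i \<in> Basis \<Longrightarrow> (F i has_real_derivative F' i t) (at t)"
    using bump_family_derivative[OF Suc.prems] by metis
  have D: "((\<lambda>x. \<Prod>i\<in>Basis. F i (x \<bullet> i)) has_derivative
     (\<lambda>y. \<Sum>i\<in>Basis. (y \<bullet> i * F' i (x \<bullet> i)) * (\<Prod>j\<in>Basis - {i}. F j (x \<bullet> j)))) (at x)" for x
    by (rule prod_bump_has_derivative) (rule F'(2))
  have "pderiv_dir b (\<lambda>x. \<Prod>i\<in>Basis. F i (x \<bullet> i)) = (\<lambda>x. \<Prod>i\<in>Basis. (F(b := F' b)) i (x \<bullet> i))"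
    if b: "b \<in> Basis" for b :: 'a
  proof
    fix x :: 'a
    have "pderiv_dir b (\<lambda>x. \<Prod>i\<in>Basis. F i (x \<bullet> i)) x =
      (\<Sum>i\<in>Basis. (b \<bullet> i * F' i (x \<bullet> i)) * (\<Prod>j\<in>Basis - {i}. F j (x \<bullet> j)))"
      unfolding pderiv_dir_def using fun_cong[OF frechet_derivative_at[OF D[of x]], of b] by simp
    also have "\<dots> = (\<Sum>i\<in>Basis. if i = b then F' b (x \<bullet> b) * (\<Prod>j\<in>Basis - {b}. F j (x \<bullet> j)) else 0)"
      by (intro sum.cong) (auto simp: inner_Basis b)
    also have "\<dots> = F' b (x \<bullet> b) * (\<Prod>j\<in>Basis - {b}. F j (x \<bullet> j))"
      using b by (simp add: sum.delta)
    also have "\<dots> = (\<Prod>i\<in>Basis. (F(b := F' b)) i (x \<bullet> i))"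
      by (subst prod.remove[OF finite_Basis b]) (auto intro!: prod.cong)
    finally show "pderiv_dir b (\<lambda>x. \<Prod>i\<in>Basis. F i (x \<bullet> i)) x = (\<Prod>i\<in>Basis. (F(b := F' b)) i (x \<bullet> i))" .
  qed
  moreover have "C_n n (\<lambda>x. \<Prod>i\<in>Basis. (F(b := F' b)) i (x \<bullet> i))" if "b \<in> Basis" for b :: 'a
    using Suc.prems F'(1) that by (intro Suc.IH) auto
  ultimately show ?case
    using D by (auto simp: differentiable_def)
qed

text \<open>As \<open>n \<rightarrow> \<infinity>\<close> these functions increase to the indicator function of the box, because
  \<open>exp (- 1 / (n t)) \<rightarrow> 1\<close> for every \<open>t > 0\<close>.\<close>

definition box_bump :: "'a::euclidean_space \<Rightarrow> 'a \<Rightarrow> nat \<Rightarrow> 'a \<Rightarrow> real" where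
  "box_bump a b n x = (\<Prod>i\<in>Basis. flat_exp 1 (real (Suc n) * (x \<bullet> i - a \<bullet> i)) *
     flat_exp 1 (real (Suc n) * (b \<bullet> i - x \<bullet> i)))"

lemma flat_exp_1_bounds: "0 \<le> flat_exp 1 t" "flat_exp 1 t \<le> 1"
  by (auto simp: flat_exp_def)

lemma box_bump_nonneg: "0 \<le> box_bump a b n x"
  unfolding box_bump_def by (intro prod_nonneg ballI mult_nonneg_nonneg flat_exp_1_bounds)

lemma box_bump_le_1: "box_bump a b n x \<le> 1"
  unfolding box_bump_def
  by (intro prod_le_1 conjI mult_nonneg_nonneg mult_le_one flat_exp_1_bounds)

lemma box_bump_eq_0: "x \<notin> box a b \<Longrightarrow> box_bump a b n x = 0"
  unfolding box_bump_def mem_box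
  by (auto simp: flat_exp_def mult_le_0_iff zero_less_mult_iff intro!: bexI)

lemma box_bump_tendsto_indicator: "(\<lambda>n. box_bump a b n x) \<longlonglongrightarrow> indicator (box a b) x"
proof (cases "x \<in> box a b")
  case True
  have *: "(\<lambda>n. flat_exp 1 (real (Suc n) * t)) \<longlonglongrightarrow> 1" if "t > 0" for t
  proof -
    have "(\<lambda>n. exp (- (inverse (real (Suc n)) * (1 / t)))) \<longlonglongrightarrow> exp (- (0 * (1 / t)))"
      by (intro tendsto_intros LIMSEQ_inverse_real_of_nat)
    moreover have "0 < real (Suc n) * t" for n using that by (intro mult_pos_pos) auto
    ultimately show ?thesis by (simp add: flat_exp_def divide_inverse)
  qed
  have "(\<lambda>n. box_bump a b n x) \<longlonglongrightarrow> (\<Prod>i\<in>(Basis::'a set). 1 * 1)"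
    unfolding box_bump_def using True by (intro tendsto_intros * ) (auto simp: mem_box)
  then show ?thesis using True by simp
next
  case False
  then show ?thesis by (simp add: box_bump_eq_0)
qed

lemma test_function_box_bump: "test_function (box_bump a b n)"
proof -
  have "C_n m (box_bump a b n)" for m
  proof -
    have "(\<lambda>t. flat_exp 1 (real (Suc n) * (t - a \<bullet> i)) * flat_exp 1 (real (Suc n) * (b \<bullet> i - t)))
       \<in> bump_family" for i :: 'a
      using bump_family.prod[of 1 "real (Suc n)" "- real (Suc n) * (a \<bullet> i)" 1
          "- real (Suc n)" "real (Suc n) * (b \<bullet> i)"]
      by (simp add: algebra_simps)
    from prod_bump_C_n[OF this, of m] show ?thesis
      by (simp add: box_bump_def[abs_def])
  qed
  moreover have "compact (closure {x. box_bump a b n x \<noteq> 0})"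
    unfolding compact_closure
    by (rule bounded_subset[OF bounded_box[of a b]]) (use box_bump_eq_0 in blast)
  ultimately show ?thesis by (simp add: test_function_def smooth_def)
qed

lemma C_n_imp_continuous: "C_n n g \<Longrightarrow> continuous_on UNIV g"
  by (cases n) (auto intro!: continuous_at_imp_continuous_on differentiable_imp_continuous_within)

lemma has_derivative_translate:
  fixes g :: "'a::real_normed_vector \<Rightarrow> 'b::real_normed_vector"
  assumes "(g has_derivative D) (at (x + a))"
  shows "((\<lambda>x. g (x + a)) has_derivative D) (at x)"
proof (rule has_derivative_compose[of "\<lambda>x. x + a" "\<lambda>x. x" x UNIV g])
  show "((\<lambda>x. x + a) has_derivative (\<lambda>x. x)) (at x)"
    by (auto intro!: derivative_eq_intros)
qed (fact assms)

lemma pderiv_dir_translate: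
  assumes "\<And>x. g differentiable (at x)"
  shows "pderiv_dir b (\<lambda>x. g (x + a)) = (\<lambda>x. pderiv_dir b g (x + a))"
proof
  fix x
  have "(g has_derivative frechet_derivative g (at (x + a))) (at (x + a))"
    using assms by (simp add: frechet_derivative_works)
  from frechet_derivative_at[OF has_derivative_translate[OF this]]
  show "pderiv_dir b (\<lambda>x. g (x + a)) x = pderiv_dir b g (x + a)"
    by (simp add: pderiv_dir_def)
qed

lemma C_n_translate: "C_n n g \<Longrightarrow> C_n n (\<lambda>x. g (x + a))"
proof (induction n arbitrary: g)
  case 0
  then show ?case by (auto intro!: continuous_intros elim!: continuous_on_compose2)
next
  case (Suc n)
  then have "\<exists>D. ((\<lambda>x. g (x + a)) has_derivative D) (at x)" for x
    using has_derivative_translate by (force simp: differentiable_def)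
  then show ?case using Suc by (auto simp: differentiable_def pderiv_dir_translate)
qed

lemma test_function_translate:
  assumes "test_function \<psi>"
  shows "test_function (\<lambda>x. \<psi> (x + a))"
proof -
  have "bounded {x. \<psi> x \<noteq> 0}"
    using assms unfolding test_function_def compact_closure by auto
  then have "bounded ((\<lambda>x. - a + x) ` {x. \<psi> x \<noteq> 0})"
    by (rule bounded_translation)
  then have "bounded {x. \<psi> (x + a) \<noteq> 0}"
    by (rule bounded_subset) (auto intro!: image_eqI[of _ _ "_ + a"])
  then show ?thesis
    using assms by (auto simp: test_function_def smooth_def compact_closure intro: C_n_translate)
qed

lemma test_function_has_derivative:
  assumes "test_function \<psi>"
  shows "(\<psi> has_derivative frechet_derivative \<psi> (at x)) (at x)"
  using assms C_n.simps(2)[of 0 \<psi>] unfolding test_function_def smooth_def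
  by (metis frechet_derivative_works)

lemma test_function_continuous: "test_function \<psi> \<Longrightarrow> continuous_on UNIV \<psi>"
  by (auto simp: test_function_def smooth_def intro: C_n_imp_continuous)

lemma test_function_measurable: "test_function \<psi> \<Longrightarrow> \<psi> \<in> borel_measurable borel"
  by (intro borel_measurable_continuous_onI test_function_continuous)

text \<open>Outside its closed support a function vanishes in a neighbourhood, and so do its derivatives.\<close>

lemma test_function_pderiv_dir:
  assumes "test_function \<psi>" "b \<in> Basis"
  shows "test_function (pderiv_dir b \<psi>)"
proof -
  have "bounded {x. pderiv_dir b \<psi> x \<noteq> 0}"
  proof (rule bounded_subset[of "closure {x. \<psi> x \<noteq> 0}"])
    show "bounded (closure {x. \<psi> x \<noteq> 0})"
      using assms by (simp add: test_function_def compact_imp_bounded)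
    show "{x. pderiv_dir b \<psi> x \<noteq> 0} \<subseteq> closure {x. \<psi> x \<noteq> 0}"
    proof (rule subsetI, rule ccontr)
      fix x assume x: "x \<in> {x. pderiv_dir b \<psi> x \<noteq> 0}" "x \<notin> closure {x. \<psi> x \<noteq> 0}"
      have "(\<psi> has_derivative (\<lambda>_. 0 :: real)) (at x)"
        by (rule has_derivative_transform_within_open[of "\<lambda>_. 0" _ _ _ "- closure {x. \<psi> x \<noteq> 0}"])
          (use x closure_subset[of "{x. \<psi> x \<noteq> 0}"] in auto)
      then have "frechet_derivative \<psi> (at x) = (\<lambda>_. 0)"
        using frechet_derivative_at by metis
      then show False using x by (simp add: pderiv_dir_def)
    qed
  qed
  then show ?thesis
    using assms unfolding test_function_def smooth_def compact_closure
    by (metis C_n.simps(2))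
qed

lemma test_function_bounded_support:
  assumes "test_function \<psi>"
  obtains K B where "compact K" "B > 0" "\<And>x. x \<notin> K \<Longrightarrow> \<psi> x = 0" "\<And>x. \<bar>\<psi> x\<bar> \<le> B"
proof -
  let ?K = "closure {x. \<psi> x \<noteq> 0}"
  have K: "compact ?K" using assms by (simp add: test_function_def)
  have "compact (\<psi> ` ?K)"
    using K test_function_continuous[OF assms]
    by (intro compact_continuous_image) (auto intro: continuous_on_subset)
  then obtain B where B: "B > 0" "\<And>x. x \<in> ?K \<Longrightarrow> \<bar>\<psi> x\<bar> \<le> B"
    using compact_imp_bounded[of "\<psi> ` ?K"] unfolding bounded_pos by auto
  have 0: "\<psi> x = 0" if "x \<notin> ?K" for x
    using that closure_subset[of "{x. \<psi> x \<noteq> 0}"] by auto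
  have "\<bar>\<psi> x\<bar> \<le> B" for x
    using B 0[of x] by (cases "x \<in> ?K") (auto simp: less_imp_le)
  then show ?thesis using that[OF K B(1) 0] by blast
qed


section \<open>Translations and locally integrable functions\<close>

lemma norm_integral_le_AE:
  fixes f :: "'a \<Rightarrow> 'b::{banach, second_countable_topology}" and g :: "'a \<Rightarrow> real"
  assumes g: "integrable M g" and le: "AE x in M. norm (f x) \<le> g x"
  shows "norm (integral\<^sup>L M f) \<le> integral\<^sup>L M g"
proof (cases "integrable M f")
  case True
  have "norm (integral\<^sup>L M f) \<le> (LINT x|M. norm (f x))" by (rule integral_norm_bound)
  also have "\<dots> \<le> integral\<^sup>L M g" using True g le by (intro integral_mono_AE) auto
  finally show ?thesis .
next
  \<comment> \<open>the integral of \<open>f\<close> has the default value 0\<close>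
  case False
  have "AE x in M. 0 \<le> g x" using le by eventually_elim (rule order_trans[OF norm_ge_zero])
  then show ?thesis using False by (simp add: not_integrable_integral_eq integral_nonneg_AE)
qed

lemma abs_integral_le:
  fixes f g :: "'a \<Rightarrow> real"
  assumes "integrable M g" "\<And>x. \<bar>f x\<bar> \<le> g x"
  shows "\<bar>integral\<^sup>L M f\<bar> \<le> integral\<^sup>L M g"
  using norm_integral_le_AE[OF assms(1), of f] assms(2) by simp

lemma integral_lborel_translate:
  fixes f :: "'a::euclidean_space \<Rightarrow> 'b::{banach, second_countable_topology}"
  assumes [measurable]: "f \<in> borel_measurable borel"
  shows "(LBINT x. f (x + a)) = (LBINT x. f x)"
proof -
  have "(LBINT x. f x) = (LINT x|distr lborel borel ((+) a). f x)"
    by (simp add: lborel_distr_plus)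
  also have "\<dots> = (LBINT x. f (a + x))"
    by (rule integral_distr) simp_all
  finally show ?thesis by (simp add: add.commute)
qed

lemma integrable_lborel_translate:
  fixes f :: "'a::euclidean_space \<Rightarrow> 'b::{banach, second_countable_topology}"
  assumes "integrable lborel f"
  shows "integrable lborel (\<lambda>x. f (x + a))"
proof -
  have "integrable (distr lborel borel ((+) a)) f"
    using assms by (simp add: lborel_distr_plus)
  then have "integrable lborel (\<lambda>x. f (a + x))"
    by (subst (asm) integrable_distr_eq) (use assms in simp_all)
  then show ?thesis by (simp add: add.commute)
qed

lemma lborel_distr_reflect: "distr lborel borel (\<lambda>y. a - y) = (lborel :: 'a::euclidean_space measure)"
  using lborel_affine[of "-1" a] by (simp add: density_1 one_ennreal_def[symmetric])

lemma integral_lborel_reflect: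
  fixes f :: "'a::euclidean_space \<Rightarrow> 'b::{banach, second_countable_topology}"
  assumes [measurable]: "f \<in> borel_measurable borel"
  shows "(LBINT y. f (a - y)) = (LBINT x. f x)"
proof -
  have "(LBINT x. f x) = (LINT x|distr lborel borel (\<lambda>y. a - y). f x)"
    by (simp add: lborel_distr_reflect)
  also have "\<dots> = (LBINT y. f (a - y))"
    by (rule integral_distr) simp_all
  finally show ?thesis ..
qed

lemma integrable_lborel_reflect:
  fixes f :: "'a::euclidean_space \<Rightarrow> 'b::{banach, second_countable_topology}"
  assumes "integrable lborel f"
  shows "integrable lborel (\<lambda>y. f (a - y))"
proof -
  have "integrable (distr lborel borel (\<lambda>y. a - y)) f"
    using assms by (simp add: lborel_distr_reflect)
  then show ?thesis
    by (subst (asm) integrable_distr_eq) (use assms in simp_all)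
qed

lemma locally_integrable_measurable:
  fixes g :: "'a::euclidean_space \<Rightarrow> real"
  assumes "locally_integrable g"
  shows "g \<in> borel_measurable borel"
proof (rule borel_measurable_LIMSEQ_real)
  fix x :: 'a
  obtain N where N: "norm x \<le> real N" using real_arch_simple by blast
  have "eventually (\<lambda>n. indicator (cball 0 (real n)) x *\<^sub>R g x = g x) sequentially"
    using eventually_ge_at_top[of N] by eventually_elim (use N in \<open>auto simp: indicator_def\<close>)
  then show "(\<lambda>n. indicator (cball 0 (real n)) x *\<^sub>R g x) \<longlonglongrightarrow> g x"
    by (rule tendsto_eventually)
next
  fix n
  have "set_integrable lborel (cball 0 (real n)) g"
    using assms by (simp add: locally_integrable_def)
  then show "(\<lambda>x. indicator (cball 0 (real n)) x *\<^sub>R g x) \<in> borel_measurable borel"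
    unfolding set_integrable_def by auto
qed

lemma locally_integrable_mult_bounded:
  fixes g :: "'a::euclidean_space \<Rightarrow> real"
  assumes "locally_integrable g" "compact K" and [measurable]: "\<psi> \<in> borel_measurable borel"
    and "\<And>x. x \<notin> K \<Longrightarrow> \<psi> x = 0" "\<And>x. \<bar>\<psi> x\<bar> \<le> B"
  shows "integrable lborel (\<lambda>x. g x * \<psi> x)"
proof (rule Bochner_Integration.integrable_bound)
  have [measurable]: "g \<in> borel_measurable borel"
    by (rule locally_integrable_measurable) fact
  show "integrable lborel (\<lambda>x. B * (indicator K x *\<^sub>R g x))"
    using assms by (intro integrable_mult_right) (auto simp: locally_integrable_def set_integrable_def)
  show "(\<lambda>x. g x * \<psi> x) \<in> borel_measurable lborel" by simp
  have "0 \<le> B" using assms(5)[of undefined] by linarith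
  have "\<bar>g x\<bar> * \<bar>\<psi> x\<bar> \<le> B * \<bar>indicator K x * g x\<bar>" for x
    using assms(4)[of x] assms(5)[of x] \<open>0 \<le> B\<close>
    by (cases "x \<in> K") (auto simp: mult.commute[of "\<bar>g x\<bar>"] mult_right_mono)
  then show "AE x in lborel. norm (g x * \<psi> x) \<le> norm (B * (indicator K x *\<^sub>R g x))"
    using \<open>0 \<le> B\<close> by (simp add: abs_mult)
qed

lemma locally_integrable_mult_test:
  assumes "locally_integrable g" "test_function \<psi>"
  shows "integrable lborel (\<lambda>x. g x * \<psi> x)"
proof -
  obtain K B where "compact K" "\<And>x. x \<notin> K \<Longrightarrow> \<psi> x = 0" "\<And>x. \<bar>\<psi> x\<bar> \<le> B"
    using test_function_bounded_support[OF assms(2)] by metis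
  then show ?thesis
    using assms(1) by (intro locally_integrable_mult_bounded[of g K \<psi> B])
      (auto intro: test_function_measurable assms(2))
qed

lemma test_function_integrable:
  assumes "test_function \<psi>"
  shows "integrable lborel \<psi>"
proof -
  have "locally_integrable (\<lambda>_::'a. 1)"
    unfolding locally_integrable_def set_integrable_def
    by (intro allI impI borel_integrable_compact continuous_on_const)
  from locally_integrable_mult_test[OF this assms] show ?thesis by simp
qed

lemma locally_integrable_translate:
  assumes "locally_integrable g"
  shows "locally_integrable (\<lambda>x. g (x + a))"
  unfolding locally_integrable_def set_integrable_def
proof (intro allI impI)
  fix K :: "'a set" assume "compact K"
  then have "compact ((+) a ` K)" by (rule compact_translation)
  then have "integrable lborel (\<lambda>x. indicator ((+) a ` K) x *\<^sub>R g x)"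
    using assms by (auto simp: locally_integrable_def set_integrable_def)
  from integrable_lborel_translate[OF this, of a]
  show "integrable lborel (\<lambda>x. indicator K x *\<^sub>R g (x + a))"
    by (rule back_subst[of "integrable lborel"]) (auto simp: indicator_def image_iff add.commute)
qed

lemma locally_integrable_add:
  "locally_integrable f \<Longrightarrow> locally_integrable g \<Longrightarrow> locally_integrable (\<lambda>x. f x + g x)"
  by (auto simp: locally_integrable_def)

lemma locally_integrable_diff:
  "locally_integrable f \<Longrightarrow> locally_integrable g \<Longrightarrow> locally_integrable (\<lambda>x. f x - g x)"
  by (auto simp: locally_integrable_def)

lemma locally_integrable_cmult:
  "locally_integrable f \<Longrightarrow> locally_integrable (\<lambda>x. c * f x)"
  by (auto simp: locally_integrable_def)

lemma locally_integrable_continuous: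
  "continuous_on UNIV g \<Longrightarrow> locally_integrable g"
  unfolding locally_integrable_def set_integrable_def
  by (intro allI impI borel_integrable_compact) (auto intro: continuous_on_subset)

section \<open>The fundamental lemma of the calculus of variations\<close>

text \<open>The bump functions of a box converge to its indicator function and are dominated by it.\<close>

lemma set_integral_box_nonneg_if_test:
  fixes u :: "'a::euclidean_space \<Rightarrow> real"
  assumes u: "locally_integrable u"
    and nn: "\<And>\<psi>. test_function \<psi> \<Longrightarrow> (\<And>x. 0 \<le> \<psi> x) \<Longrightarrow> 0 \<le> (LBINT x. u x * \<psi> x)"
  shows "0 \<le> (LBINT x. u x * indicator (box a b) x)"
proof (rule LIMSEQ_le_const)
  have [measurable]: "u \<in> borel_measurable borel"
    by (rule locally_integrable_measurable) fact
  have [measurable]: "box_bump a b n \<in> borel_measurable borel" for n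
    by (intro test_function_measurable test_function_box_bump)
  show "(\<lambda>n. LBINT x. u x * box_bump a b n x) \<longlonglongrightarrow> (LBINT x. u x * indicator (box a b) x)"
  proof (rule integral_dominated_convergence)
    show "integrable lborel (\<lambda>x. \<bar>u x * indicator (cbox a b) x\<bar>)"
      using u by (intro integrable_abs)
        (auto simp: locally_integrable_def set_integrable_def mult.commute)
    show "AE x in lborel. (\<lambda>n. u x * box_bump a b n x) \<longlonglongrightarrow> u x * indicator (box a b) x"
      by (intro AE_I2 tendsto_intros box_bump_tendsto_indicator)
    show "AE x in lborel. norm (u x * box_bump a b n x) \<le> \<bar>u x * indicator (cbox a b) x\<bar>" for n
    proof (rule AE_I2)
      fix x
      show "norm (u x * box_bump a b n x) \<le> \<bar>u x * indicator (cbox a b) x\<bar>"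
        using box_bump_nonneg[of a b n x] box_bump_le_1[of a b n x] box_bump_eq_0[of x a b n]
          box_subset_cbox[of a b]
        by (cases "x \<in> box a b") (auto simp: abs_mult mult_left_le)
    qed
  qed auto
  show "\<exists>N. \<forall>n\<ge>N. 0 \<le> (LBINT x. u x * box_bump a b n x)"
    using nn[OF test_function_box_bump box_bump_nonneg] by blast
qed

text \<open>Dyadic subdivision covers the open set by closed boxes without common interior points; passing to
  interiors loses only their boundaries, which form a null set.\<close>

lemma bounded_open_AE_disjoint_boxes:
  fixes U :: "'a::euclidean_space set"
  assumes "open U" "bounded U"
  obtains \<D> where "countable \<D>" "\<And>B. B \<in> \<D> \<Longrightarrow> \<exists>c d. B = box c d" "disjoint \<D>" "\<Union>\<D> \<subseteq> U"
    "U - \<Union>\<D> \<in> null_sets lborel"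
proof -
  obtain r where r: "U \<subseteq> box (- r) r"
    using bounded_subset_box_symmetric[OF assms(2)] by blast
  let ?a = "- r - One" and ?b = "r + One :: 'a"
  show ?thesis
  proof (cases "U = {}")
    case True
    then show ?thesis using that[of "{}"] by auto
  next
    case False
    have "\<forall>x. \<exists>e>0. x \<in> U \<longrightarrow> ball x e \<subseteq> U"
      using assms(1) open_contains_ball by (metis zero_less_one)
    then obtain e where e: "\<And>x. e x > 0" "\<And>x. x \<in> U \<Longrightarrow> ball x (e x) \<subseteq> U" by metis
    have g: "gauge (\<lambda>x. ball x (e x))" using e(1) by (auto simp: gauge_def)
    have sub: "U \<subseteq> cbox (- r) r" using r box_subset_cbox by blast
    have ne: "box (- r) r \<noteq> {}" using r False by blast
    obtain \<D> where D: "countable \<D>"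
        "\<And>K. K \<in> \<D> \<Longrightarrow> interior K \<noteq> {} \<and> (\<exists>c d. K = cbox c d)"
        "pairwise (\<lambda>A B. interior A \<inter> interior B = {}) \<D>"
        "\<And>K. K \<in> \<D> \<Longrightarrow> \<exists>x \<in> U \<inter> K. K \<subseteq> ball x (e x)" "U \<subseteq> \<Union>\<D>"
      by (rule covering_lemma[OF sub ne g]) (rule that; assumption)
    have D2: "\<exists>x. x \<in> U \<and> K \<subseteq> U" if "K \<in> \<D>" for K
      using D(4)[OF that] e(2) by blast
    show ?thesis
    proof (rule that[of "interior ` \<D>"])
      show "countable (interior ` \<D>)" using D(1) by simp
      show "\<exists>c d. B = box c d" if "B \<in> interior ` \<D>" for B
        using that D(2) by (metis image_iff interior_cbox)
      show "disjoint (interior ` \<D>)"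
        using D(3) unfolding pairwise_def disjnt_def by (metis (no_types, lifting) image_iff)
      show "\<Union> (interior ` \<D>) \<subseteq> U"
        using D2 interior_subset by blast
      have "U - \<Union>(interior ` \<D>) \<subseteq> (\<Union>K\<in>\<D>. K - interior K)"
        using D(5) by blast
      moreover have "(\<Union>K\<in>\<D>. K - interior K) \<in> null_sets lborel"
      proof (rule null_sets_UN')
        fix K assume "K \<in> \<D>"
        then obtain c d where K: "K = cbox c d" using D(2) by blast
        have "negligible (cbox c d - box c d)" by (rule negligible_frontier_interval)
        then have "cbox c d - box c d \<in> null_sets lebesgue" by (simp add: negligible_iff_null_sets)
        then show "K - interior K \<in> null_sets lborel"
          by (subst (asm) null_sets_completion_iff) (auto simp: K)
      qed (fact D(1))
      moreover have "open (\<Union>(interior ` \<D>))" by auto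
      then have "U - \<Union>(interior ` \<D>) \<in> sets lborel"
        using assms(1) by (simp add: sets.Diff)
      ultimately show "U - \<Union>(interior ` \<D>) \<in> null_sets lborel"
        by (metis null_sets_subset)
    qed
  qed
qed

text \<open>Nonnegative integrals over boxes say that the measure with density \<open>u\<^sup>-\<close> is below the one with
  density \<open>u\<^sup>+\<close> on boxes. A bounded open set is, up to a null set, a countable disjoint union of
  boxes, so the same comparison holds there, and outer regularity transfers it to the set where
  \<open>u < 0\<close>, on which \<open>u\<^sup>+\<close> vanishes.\<close>

lemma AE_nonneg_if_test:
  fixes u :: "'a::euclidean_space \<Rightarrow> real"
  assumes u: "locally_integrable u"
    and nn: "\<And>\<psi>. test_function \<psi> \<Longrightarrow> (\<And>x. 0 \<le> \<psi> x) \<Longrightarrow> 0 \<le> (LBINT x. u x * \<psi> x)"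
  shows "AE x in lborel. 0 \<le> u x"
proof -
  have [measurable]: "u \<in> borel_measurable borel"
    by (rule locally_integrable_measurable) fact
  define pos where "pos = Nonnegative_Lebesgue_Integration.density lborel (\<lambda>x. ennreal (u x))"
  define neg where "neg = Nonnegative_Lebesgue_Integration.density lborel (\<lambda>x. ennreal (- u x))"
  have sets[measurable_cong, simp]: "sets pos = sets borel" "sets neg = sets borel"
    by (auto simp: pos_def neg_def)
  have int_box: "integrable lborel (\<lambda>x. u x * indicator (box a b) x)" for a b
    using u by (intro locally_integrable_mult_bounded[of u "cbox a b" _ 1])
      (use box_subset_cbox[of a b] in \<open>auto simp: indicator_def\<close>)
  have box: "emeasure neg (box a b) \<le> emeasure pos (box a b)" for a b
  proof -
    let ?f = "\<lambda>x. u x * indicator (box a b) x"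
    have "emeasure pos (box a b) = (\<integral>\<^sup>+x. ennreal (?f x) \<partial>lborel)"
      unfolding pos_def by (subst emeasure_density)
        (auto intro!: nn_integral_cong simp: indicator_def)
    moreover have "emeasure neg (box a b) = (\<integral>\<^sup>+x. ennreal (- ?f x) \<partial>lborel)"
      unfolding neg_def by (subst emeasure_density)
        (auto intro!: nn_integral_cong simp: indicator_def)
    moreover have "0 \<le> (LBINT x. ?f x)"
      by (rule set_integral_box_nonneg_if_test[OF u]) (rule nn)
    then have "0 \<le> enn2real (\<integral>\<^sup>+x. ennreal (?f x) \<partial>lborel) - enn2real (\<integral>\<^sup>+x. ennreal (- ?f x) \<partial>lborel)"
      by (subst (asm) real_lebesgue_integral_def[OF int_box])
    moreover have "(\<integral>\<^sup>+x. ennreal (?f x) \<partial>lborel) \<noteq> \<infinity>" "(\<integral>\<^sup>+x. ennreal (- ?f x) \<partial>lborel) \<noteq> \<infinity>"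
      using int_box[of a b] unfolding real_integrable_def by blast+
    ultimately show ?thesis
      by (metis (no_types, lifting) diff_ge_0_iff_ge enn2real_le_iff ennreal_enn2real infinity_ennreal_def
          ennreal_leI less_top)
  qed
  have opn: "emeasure neg U \<le> emeasure pos U" if U: "open U" "bounded U" for U
  proof -
    obtain \<D> where D: "countable \<D>" "\<And>B. B \<in> \<D> \<Longrightarrow> \<exists>c d. B = box c d" "disjoint \<D>" "\<Union>\<D> \<subseteq> U"
      "U - \<Union>\<D> \<in> null_sets lborel"
      using bounded_open_AE_disjoint_boxes[OF U] by metis
    have B: "B \<in> sets borel" if "B \<in> \<D>" for B using D(2)[OF that] by auto
    have [measurable]: "\<Union>\<D> \<in> sets borel" using B D(1) by (intro sets.countable_Union) auto
    have sum: "emeasure M (\<Union>\<D>) = (\<integral>\<^sup>+B. emeasure M B \<partial>count_space \<D>)" if "sets M = sets borel" for M :: "'a measure"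
      using emeasure_UN_countable[of \<D> "\<lambda>B. B" M] D(1,3) B that
      by (auto simp: disjoint_family_on_def pairwise_def disjnt_def)
    have "U - \<Union>\<D> \<in> null_sets neg"
      using D(5) unfolding neg_def
      by (subst null_sets_density_iff) (auto simp: AE_not_in intro: AE_mp[OF AE_not_in[OF D(5)]])
    then have "emeasure neg U = emeasure neg (\<Union>\<D>)"
      using emeasure_Un_null_set[of "\<Union>\<D>" neg "U - \<Union>\<D>"] D(4) by (simp add: Un_absorb1)
    also have "\<dots> \<le> emeasure pos (\<Union>\<D>)"
      unfolding sum[OF sets(1)] sum[OF sets(2)]
      using D(2) box by (intro nn_integral_mono) auto
    also have "\<dots> \<le> emeasure pos U"
      using D(4) U(1) by (intro emeasure_mono) auto
    finally show ?thesis .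
  qed
  have zero: "emeasure neg ({x. u x < 0} \<inter> box a b) = 0" for a b
  proof -
    define M where "M = Nonnegative_Lebesgue_Integration.density lborel (\<lambda>x. ennreal \<bar>u x * indicator (box a b) x\<bar>)"
    have [measurable_cong, simp]: "sets M = sets borel" by (simp add: M_def)
    have "emeasure M (space M) \<noteq> \<infinity>"
      using int_box[of a b] unfolding M_def integrable_iff_bounded
      by (subst emeasure_density) auto
    let ?N = "{x. u x < 0} \<inter> box a b"
    have N[measurable]: "?N \<in> sets borel" by measurable
    have le_M: "emeasure pos A \<le> emeasure M A" "emeasure neg A \<le> emeasure M A"
      if "A \<in> sets borel" "A \<subseteq> box a b" for A
      unfolding pos_def neg_def M_def using that
      by (auto simp: emeasure_density intro!: nn_integral_mono ennreal_leI split: split_indicator)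
    have "emeasure neg ?N \<le> ennreal e" if "e > 0" for e
    proof -
      have eq: "emeasure M ?N = (INF U \<in> {U. ?N \<subseteq> U \<and> open U}. emeasure M U)"
        by (rule outer_regular) (use \<open>emeasure M (space M) \<noteq> \<infinity>\<close> N in auto)
      have fin: "emeasure M A < top" if "A \<in> sets borel" for A
        using \<open>emeasure M (space M) \<noteq> \<infinity>\<close> emeasure_space[of M A]
        by (metis infinity_ennreal_def le_less_trans less_top)
      have "emeasure M ?N < emeasure M ?N + ennreal e"
        using that fin[OF N] by (cases "emeasure M ?N") (auto simp flip: ennreal_plus simp: ennreal_less_iff)
      then have "(INF U \<in> {U. ?N \<subseteq> U \<and> open U}. emeasure M U) < emeasure M ?N + ennreal e"
        by (subst eq[symmetric])
      then obtain U where U: "?N \<subseteq> U" "open U" "emeasure M U < emeasure M ?N + ennreal e"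
        by (auto simp: INF_less_iff)
      let ?V = "U \<inter> box a b"
      have V[measurable]: "?V \<in> sets borel" using U(2) by auto
      have "emeasure neg ?N \<le> emeasure neg ?V"
        using U(1) V by (intro emeasure_mono) auto
      also have "\<dots> \<le> emeasure pos ?V"
        using U(2) by (intro opn) (auto intro: bounded_subset[OF bounded_box[of a b]])
      also have "\<dots> = emeasure pos (?V - ?N)"
        unfolding pos_def using V N
        by (subst (1 2) emeasure_density)
          (auto intro!: nn_integral_cong simp: indicator_def ennreal_neg)
      also have "\<dots> \<le> emeasure M (?V - ?N)"
        using N V by (intro le_M) auto
      also have "\<dots> = emeasure M ?V - emeasure M ?N"
        using U(1) fin[OF N] N V by (intro emeasure_Diff) auto
      also have "\<dots> \<le> emeasure M U - emeasure M ?N"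
        using U(2) by (intro ennreal_minus_mono emeasure_mono) auto
      also have "\<dots> \<le> ennreal e"
        using U(3) fin[OF N] by (intro ennreal_minus_le_iff[THEN iffD2]) (auto simp: add.commute less_imp_le)
      finally show ?thesis .
    qed
    then show ?thesis
      by (metis ennreal_le_epsilon add_0 le_zero_eq)
  qed
  have null: "{x. u x < 0} \<inter> box (- (real n *\<^sub>R One)) (real n *\<^sub>R One) \<in> null_sets lborel" for n
  proof -
    let ?N = "{x. u x < 0} \<inter> box (- (real n *\<^sub>R One)) (real n *\<^sub>R One)"
    have N: "?N \<in> sets borel" by measurable
    have "?N \<in> null_sets neg" using zero N by auto
    then have "AE x in lborel. x \<in> ?N \<longrightarrow> ennreal (- u x) = 0"
      unfolding neg_def by (subst (asm) null_sets_density_iff) auto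
    then have "AE x in lborel. x \<notin> ?N" by eventually_elim (auto simp: ennreal_eq_0_iff)
    then show ?thesis using N by (subst AE_iff_null_sets) auto
  qed
  have "AE x in lborel. \<forall>n. x \<notin> {x. u x < 0} \<inter> box (- (real n *\<^sub>R One)) (real n *\<^sub>R One)"
    by (intro AE_all_countable[THEN iffD2] allI AE_not_in null)
  then show ?thesis
  proof eventually_elim
    case (elim x)
    obtain n where n: "norm x < real n" using reals_Archimedean2 by blast
    have "\<bar>x \<bullet> i\<bar> < real n" if "i \<in> Basis" for i
      using Basis_le_norm[OF that, of x] n by linarith
    then have "x \<in> box (- (real n *\<^sub>R One)) (real n *\<^sub>R One)"
      by (auto simp: mem_box abs_less_iff minus_less_iff)
    with elim show ?case by auto
  qed
qed

corollary AE_eq_if_test: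
  fixes f g :: "'a::euclidean_space \<Rightarrow> real"
  assumes "locally_integrable f" "locally_integrable g"
    and "\<And>\<psi>. test_function \<psi> \<Longrightarrow> (LBINT x. f x * \<psi> x) = (LBINT x. g x * \<psi> x)"
  shows "AE x in lborel. f x = g x"
proof -
  have *: "AE x in lborel. 0 \<le> f x - g x" if "locally_integrable f" "locally_integrable g"
    "\<And>\<psi>. test_function \<psi> \<Longrightarrow> (LBINT x. f x * \<psi> x) = (LBINT x. g x * \<psi> x)"
    for f g :: "'a \<Rightarrow> real"
    using that by (intro AE_nonneg_if_test locally_integrable_diff)
      (simp_all add: left_diff_distrib locally_integrable_mult_test)
  show ?thesis
    using *[of f g] *[of g f] assms by auto
qed


section \<open>Weak derivatives and difference quotients\<close>

lemma weak_derivative_Nil_AE_eq: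
  assumes "weak_derivative [] g h"
  shows "AE x in lborel. g x = h x"
  using assms by (intro AE_eq_if_test) (auto simp: weak_derivative_def)

lemma has_derivative_along_line:
  assumes "(g has_derivative D) (at (x + \<theta> *\<^sub>R b))"
  shows "((\<lambda>\<theta>. g (x + \<theta> *\<^sub>R b)) has_real_derivative D b) (at \<theta>)"
proof -
  have "((\<lambda>\<theta>. x + \<theta> *\<^sub>R b) has_derivative (\<lambda>\<eta>. \<eta> *\<^sub>R b)) (at \<theta>)"
    by (auto intro!: derivative_eq_intros)
  from has_derivative_compose[OF this assms]
  have "((\<lambda>\<theta>. g (x + \<theta> *\<^sub>R b)) has_derivative (\<lambda>\<eta>. D (\<eta> *\<^sub>R b))) (at \<theta>)" .
  moreover have "D (\<eta> *\<^sub>R b) = D b * \<eta>" for \<eta>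
    using has_derivative_linear[OF assms] by (simp add: linear_cmul)
  ultimately show ?thesis by (simp add: has_field_derivative_def)
qed

lemma test_function_along_line:
  assumes "test_function \<psi>"
  shows "((\<lambda>\<theta>. \<psi> (x + \<theta> *\<^sub>R b)) has_real_derivative pderiv_dir b \<psi> (x + \<theta> *\<^sub>R b)) (at \<theta>)"
  unfolding pderiv_dir_def by (rule has_derivative_along_line[OF test_function_has_derivative[OF assms]])

text \<open>Differentiation under the integral sign: for steps of length at most 1 the difference quotients of
  \<open>\<psi>\<close> are bounded by a constant and vanish outside a fixed ball.\<close>

lemma DERIV_integral_translated_test:
  fixes g :: "'a::euclidean_space \<Rightarrow> real"
  assumes g: "locally_integrable g" and \<psi>: "test_function \<psi>" and b: "b \<in> Basis"
  shows "((\<lambda>\<theta>. LBINT y. g y * \<psi> (y + \<theta> *\<^sub>R b)) has_real_derivative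
      (LBINT y. g y * pderiv_dir b \<psi> (y + \<theta> *\<^sub>R b))) (at \<theta>)"
proof -
  have tr: "test_function (\<lambda>y. \<psi> (y + \<theta> *\<^sub>R b))" for \<theta>
    by (rule test_function_translate[OF \<psi>])
  have [measurable]: "g \<in> borel_measurable borel"
    by (rule locally_integrable_measurable) fact
  have \<psi>'t: "test_function (pderiv_dir b \<psi>)" by (rule test_function_pderiv_dir[OF \<psi> b])
  have [measurable]: "\<psi> \<in> borel_measurable borel" "pderiv_dir b \<psi> \<in> borel_measurable borel"
    by (intro test_function_measurable \<psi> \<psi>'t)+
  obtain K where K: "compact K" "\<And>x. x \<notin> K \<Longrightarrow> \<psi> x = 0"
    using test_function_bounded_support[OF \<psi>] by metis
  obtain B where B: "B > 0" "\<And>x. \<bar>pderiv_dir b \<psi> x\<bar> \<le> B"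
    using test_function_bounded_support[OF \<psi>'t] by metis
  obtain R where R: "\<And>x. x \<in> K \<Longrightarrow> norm x \<le> R"
    using compact_imp_bounded[OF K(1)] unfolding bounded_iff by blast
  have lip: "\<bar>\<psi> (y + s *\<^sub>R b) - \<psi> (y + t *\<^sub>R b)\<bar> \<le> B * \<bar>s - t\<bar>" for y s t
  proof -
    have "norm (\<psi> (y + s *\<^sub>R b) - \<psi> (y + t *\<^sub>R b)) \<le> B * norm (s - t)"
      by (rule field_differentiable_bound[of UNIV "\<lambda>\<theta>. \<psi> (y + \<theta> *\<^sub>R b)"
            "\<lambda>\<theta>. pderiv_dir b \<psi> (y + \<theta> *\<^sub>R b)"]) (use test_function_along_line[OF \<psi>] B in auto)
    then show ?thesis by simp
  qed
  let ?C = "cball (0::'a) (R + \<bar>\<theta>\<bar> + 1)"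
  have lim: "(\<lambda>n. LBINT y. g y * ((\<psi> (y + (\<theta> + X n) *\<^sub>R b) - \<psi> (y + \<theta> *\<^sub>R b)) / X n)) \<longlonglongrightarrow>
      (LBINT y. g y * pderiv_dir b \<psi> (y + \<theta> *\<^sub>R b))"
    if X: "\<And>n. X n \<in> {- 1..1} - {0}" "X \<longlonglongrightarrow> 0" for X :: "nat \<Rightarrow> real"
  proof (rule integral_dominated_convergence)
    show "integrable lborel (\<lambda>y. \<bar>g y * (B * indicator ?C y)\<bar>)"
      using g B by (intro integrable_abs locally_integrable_mult_bounded[of g ?C _ B]) (auto simp: indicator_def)
    show "AE y in lborel. (\<lambda>n. g y * ((\<psi> (y + (\<theta> + X n) *\<^sub>R b) - \<psi> (y + \<theta> *\<^sub>R b)) / X n))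
        \<longlonglongrightarrow> g y * pderiv_dir b \<psi> (y + \<theta> *\<^sub>R b)"
    proof (intro AE_I2 tendsto_intros)
      fix y
      have "((\<lambda>h. (\<psi> (y + (\<theta> + h) *\<^sub>R b) - \<psi> (y + \<theta> *\<^sub>R b)) / h) \<longlongrightarrow> pderiv_dir b \<psi> (y + \<theta> *\<^sub>R b)) (at 0)"
        using test_function_along_line[OF \<psi>] unfolding DERIV_def .
      then show "(\<lambda>n. (\<psi> (y + (\<theta> + X n) *\<^sub>R b) - \<psi> (y + \<theta> *\<^sub>R b)) / X n) \<longlonglongrightarrow> pderiv_dir b \<psi> (y + \<theta> *\<^sub>R b)"
        using X unfolding tendsto_at_iff_sequentially by (auto simp: o_def)
    qed
    show "AE y in lborel. norm (g y * ((\<psi> (y + (\<theta> + X n) *\<^sub>R b) - \<psi> (y + \<theta> *\<^sub>R b)) / X n))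
        \<le> \<bar>g y * (B * indicator ?C y)\<bar>" for n
    proof (rule AE_I2)
      fix y
      let ?q = "(\<psi> (y + (\<theta> + X n) *\<^sub>R b) - \<psi> (y + \<theta> *\<^sub>R b)) / X n"
      have "\<bar>?q\<bar> \<le> B * indicator ?C y"
      proof (cases "y \<in> ?C")
        case True
        have "\<bar>\<psi> (y + (\<theta> + X n) *\<^sub>R b) - \<psi> (y + \<theta> *\<^sub>R b)\<bar> \<le> B * \<bar>X n\<bar>"
          using lip[of y "\<theta> + X n" \<theta>] by simp
        then show ?thesis using True X(1)[of n] by (simp add: abs_divide pos_divide_le_eq)
      next
        case False
        have "y + t *\<^sub>R b \<notin> K" if "\<bar>t\<bar> \<le> \<bar>\<theta>\<bar> + 1" for t
        proof
          assume "y + t *\<^sub>R b \<in> K"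
          from R[OF this] have "norm y \<le> R + \<bar>t\<bar>"
            using norm_triangle_ineq4[of "y + t *\<^sub>R b" "t *\<^sub>R b"] b by simp
          then show False using that False by simp
        qed
        moreover have "\<bar>\<theta> + X n\<bar> \<le> \<bar>\<theta>\<bar> + 1" "\<bar>\<theta>\<bar> \<le> \<bar>\<theta>\<bar> + 1" using X(1)[of n] by auto
        ultimately have "y + (\<theta> + X n) *\<^sub>R b \<notin> K" "y + \<theta> *\<^sub>R b \<notin> K" by blast+
        then show ?thesis using K(2) False by simp
      qed
      then show "norm (g y * ?q) \<le> \<bar>g y * (B * indicator ?C y)\<bar>"
        using B(1) unfolding real_norm_def abs_mult[of "g y"]
        by (intro mult_left_mono) (auto simp: abs_mult)
    qed
  qed auto
  have q: "((LBINT y. g y * \<psi> (y + (\<theta> + h) *\<^sub>R b)) - (LBINT y. g y * \<psi> (y + \<theta> *\<^sub>R b))) / h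
      = (LBINT y. g y * ((\<psi> (y + (\<theta> + h) *\<^sub>R b) - \<psi> (y + \<theta> *\<^sub>R b)) / h))" for h
  proof -
    have "(LBINT y. g y * ((\<psi> (y + (\<theta> + h) *\<^sub>R b) - \<psi> (y + \<theta> *\<^sub>R b)) / h)) =
      (LBINT y. (g y * \<psi> (y + (\<theta> + h) *\<^sub>R b) - g y * \<psi> (y + \<theta> *\<^sub>R b)) / h)"
      by (intro Bochner_Integration.integral_cong) (simp_all add: right_diff_distrib)
    also have "\<dots> = ((LBINT y. g y * \<psi> (y + (\<theta> + h) *\<^sub>R b)) - (LBINT y. g y * \<psi> (y + \<theta> *\<^sub>R b))) / h"
      by (subst integral_divide_zero, subst Bochner_Integration.integral_diff)
        (auto intro: locally_integrable_mult_test[OF g tr])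
    finally show ?thesis ..
  qed
  \<comment> \<open>the restriction to \<open>[-1, 1]\<close> makes the dominating function valid for every term of the sequence\<close>
  have "((\<lambda>h. ((LBINT y. g y * \<psi> (y + (\<theta> + h) *\<^sub>R b)) - (LBINT y. g y * \<psi> (y + \<theta> *\<^sub>R b))) / h)
     \<longlongrightarrow> (LBINT y. g y * pderiv_dir b \<psi> (y + \<theta> *\<^sub>R b))) (at 0 within {- 1..1})"
    unfolding q tendsto_at_iff_sequentially using lim by (auto simp: o_def)
  moreover have "at 0 within {- 1..1::real} = at 0"
    by (rule at_within_interior) simp
  ultimately show ?thesis by (simp add: DERIV_def)
qed

text \<open>Testing the difference quotient against \<open>\<psi> \<ge> 0\<close> moves the translation onto \<open>\<psi>\<close>, where it can
  be differentiated; the weak derivative then brings the derivative back as \<open>h\<close>.\<close>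

lemma weak_derivative_bounded_imp_AE_Lipschitz:
  fixes g :: "'a::euclidean_space \<Rightarrow> real"
  assumes w: "weak_derivative [b] g h" and b: "b \<in> Basis" and h: "AE x in lborel. \<bar>h x\<bar> \<le> A"
  shows "AE y in lborel. \<bar>g (y + \<tau> *\<^sub>R b) - g y\<bar> \<le> A * \<bar>\<tau>\<bar>"
proof -
  have g: "locally_integrable g" "locally_integrable h" using w by (auto simp: weak_derivative_def)
  have [measurable]: "g \<in> borel_measurable borel" "h \<in> borel_measurable borel"
    by (intro locally_integrable_measurable g)+
  have ibp: "(LBINT x. g x * pderiv_dir b \<psi> x) = - (LBINT x. h x * \<psi> x)"
    if "test_function \<psi>" for \<psi>
    using w that by (auto simp: weak_derivative_def)
  have main: "\<bar>(LBINT y. g (y + \<tau> *\<^sub>R b) * \<psi> y) - (LBINT y. g y * \<psi> y)\<bar>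
      \<le> A * \<bar>\<tau>\<bar> * (LBINT y. \<psi> y)" if \<psi>: "test_function \<psi>" "\<And>x. 0 \<le> \<psi> x" for \<psi>
  proof -
    have [measurable]: "\<psi> \<in> borel_measurable borel"
      by (intro test_function_measurable \<psi>)
    have int_\<psi>: "integrable lborel \<psi>" by (rule test_function_integrable[OF \<psi>(1)])
    let ?F = "\<lambda>\<theta>. LBINT y. g y * \<psi> (y + \<theta> *\<^sub>R b)"
    let ?F' = "\<lambda>\<theta>. LBINT y. g y * pderiv_dir b \<psi> (y + \<theta> *\<^sub>R b)"
    have bd: "\<bar>?F' \<theta>\<bar> \<le> A * (LBINT y. \<psi> y)" for \<theta>
    proof -
      have t: "test_function (\<lambda>y. \<psi> (y + \<theta> *\<^sub>R b))" by (rule test_function_translate[OF \<psi>(1)])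
      have d: "\<psi> differentiable (at x)" for x
        using test_function_has_derivative[OF \<psi>(1)] by (auto simp: differentiable_def)
      have "\<bar>?F' \<theta>\<bar> = \<bar>LBINT y. h y * \<psi> (y + \<theta> *\<^sub>R b)\<bar>"
        using ibp[OF t] by (simp add: pderiv_dir_translate[OF d])
      also have "\<dots> \<le> (LBINT y. A * \<psi> (y + \<theta> *\<^sub>R b))"
        unfolding real_norm_def[symmetric]
      proof (rule norm_integral_le_AE)
        show "integrable lborel (\<lambda>y. A * \<psi> (y + \<theta> *\<^sub>R b))"
          by (intro integrable_mult_right integrable_lborel_translate int_\<psi>)
        show "AE y in lborel. norm (h y * \<psi> (y + \<theta> *\<^sub>R b)) \<le> A * \<psi> (y + \<theta> *\<^sub>R b)"
          using h by eventually_elim (auto simp: abs_mult \<psi>(2) intro: mult_right_mono)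
      qed
      also have "\<dots> = A * (LBINT y. \<psi> y)"
        by (simp add: integral_lborel_translate)
      finally show ?thesis .
    qed
    have "norm (?F (- \<tau>) - ?F 0) \<le> (A * (LBINT y. \<psi> y)) * norm (- \<tau> - 0)"
      by (rule field_differentiable_bound[of UNIV ?F ?F'])
        (use bd DERIV_integral_translated_test[OF g(1) \<psi>(1) b] in auto)
    moreover have "?F (- \<tau>) = (LBINT y. g (y + \<tau> *\<^sub>R b) * \<psi> y)"
      using integral_lborel_translate[of "\<lambda>y. g y * \<psi> (y + (- \<tau>) *\<^sub>R b)" "\<tau> *\<^sub>R b"] by simp
    ultimately show ?thesis by (simp add: mult_ac)
  qed
  have "AE y in lborel. 0 \<le> A * \<bar>\<tau>\<bar> + \<epsilon> * (g (y + \<tau> *\<^sub>R b) - g y)" if \<epsilon>: "\<bar>\<epsilon>\<bar> = 1" for \<epsilon>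
  proof (rule AE_nonneg_if_test)
    have gt: "locally_integrable (\<lambda>y. g (y + \<tau> *\<^sub>R b))"
      by (rule locally_integrable_translate) (rule g)
    show "locally_integrable (\<lambda>y. A * \<bar>\<tau>\<bar> + \<epsilon> * (g (y + \<tau> *\<^sub>R b) - g y))"
      by (intro locally_integrable_add locally_integrable_cmult locally_integrable_diff g gt
          locally_integrable_continuous continuous_on_const)
    fix \<psi> :: "'a \<Rightarrow> real" assume \<psi>: "test_function \<psi>" "\<And>x. 0 \<le> \<psi> x"
    have int_\<psi>: "integrable lborel \<psi>" by (rule test_function_integrable[OF \<psi>(1)])
    have "(LBINT x. (A * \<bar>\<tau>\<bar> + \<epsilon> * (g (x + \<tau> *\<^sub>R b) - g x)) * \<psi> x) =
       (LBINT x. A * \<bar>\<tau>\<bar> * \<psi> x + (\<epsilon> * (g (x + \<tau> *\<^sub>R b) * \<psi> x) - \<epsilon> * (g x * \<psi> x)))"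
      by (intro Bochner_Integration.integral_cong) (simp_all add: algebra_simps)
    also have "\<dots> = A * \<bar>\<tau>\<bar> * (LBINT x. \<psi> x) +
        (\<epsilon> * (LBINT x. g (x + \<tau> *\<^sub>R b) * \<psi> x) - \<epsilon> * (LBINT x. g x * \<psi> x))"
      using locally_integrable_mult_test[OF g(1) \<psi>(1)] locally_integrable_mult_test[OF gt \<psi>(1)] int_\<psi>
      by simp
    also have "\<dots> \<ge> 0"
    proof -
      have "\<bar>\<epsilon> * ((LBINT x. g (x + \<tau> *\<^sub>R b) * \<psi> x) - (LBINT x. g x * \<psi> x))\<bar>
         \<le> A * \<bar>\<tau>\<bar> * (LBINT x. \<psi> x)"
        using main[OF \<psi>] \<epsilon> by (simp add: abs_mult)
      then show ?thesis by (simp add: right_diff_distrib)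
    qed
    finally show "0 \<le> (LBINT x. (A * \<bar>\<tau>\<bar> + \<epsilon> * (g (x + \<tau> *\<^sub>R b) - g x)) * \<psi> x)" .
  qed
  from this[of 1] this[of "-1"] show ?thesis by auto
qed

text \<open>A nonempty open set is not negligible.\<close>

lemma continuous_AE_le_imp_le:
  fixes f :: "'a::euclidean_space \<Rightarrow> real"
  assumes "continuous_on UNIV f" "AE x in lborel. f x \<le> c"
  shows "f x \<le> c"
proof (rule ccontr)
  assume "\<not> f x \<le> c"
  then have "{y. c < f y} \<noteq> {}" using not_le by blast
  moreover have "open {y. c < f y}"
    using assms(1) by (intro open_Collect_less continuous_on_const)
  ultimately have "\<not> negligible {y. c < f y}" by (intro open_not_negligible)
  moreover have "{y. c < f y} \<in> null_sets lborel"
    using assms(2) \<open>open _\<close> by (subst AE_iff_null_sets) (auto simp: not_less)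
  ultimately show False
    by (metis negligible_iff_null_sets null_sets_completionI)
qed

text \<open>Go from \<open>y\<close> to \<open>x\<close> by changing one coordinate after the other.\<close>

lemma Lipschitz_if_directional:
  fixes g :: "'a::euclidean_space \<Rightarrow> real"
  assumes A: "0 \<le> A" and dir: "\<And>b y \<tau>. b \<in> Basis \<Longrightarrow> \<bar>g (y + \<tau> *\<^sub>R b) - g y\<bar> \<le> A * \<bar>\<tau>\<bar>"
  shows "\<bar>g x - g y\<bar> \<le> real DIM('a) * A * norm (x - y)"
proof -
  have "\<bar>g (y + (\<Sum>b\<in>S. c b *\<^sub>R b)) - g y\<bar> \<le> (\<Sum>b\<in>S. A * \<bar>c b\<bar>)" if "finite S" "S \<subseteq> Basis" for S c
    using that
  proof (induction S)
    case (insert b S)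
    have "\<bar>g (y + (\<Sum>b\<in>S. c b *\<^sub>R b) + c b *\<^sub>R b) - g (y + (\<Sum>b\<in>S. c b *\<^sub>R b))\<bar> \<le> A * \<bar>c b\<bar>"
      using insert by (intro dir) auto
    then show ?case using insert by (simp add: algebra_simps)
  qed simp
  from this[of Basis "\<lambda>b. (x - y) \<bullet> b"]
  have "\<bar>g x - g y\<bar> \<le> (\<Sum>b\<in>Basis. A * \<bar>(x - y) \<bullet> b\<bar>)"
    by (simp add: euclidean_representation)
  also have "\<dots> \<le> (\<Sum>b\<in>(Basis::'a set). A * norm (x - y))"
    by (intro sum_mono mult_left_mono A Basis_le_norm)
  finally show ?thesis by (simp add: mult_ac)
qed

lemma weak_derivative_bounded_imp_directional_Lipschitz:
  fixes g :: "'a::euclidean_space \<Rightarrow> real"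
  assumes g: "continuous_on UNIV g" and w: "weak_derivative [b] g h" and b: "b \<in> Basis"
    and h: "AE x in lborel. \<bar>h x\<bar> \<le> A"
  shows "\<bar>g (y + \<tau> *\<^sub>R b) - g y\<bar> \<le> A * \<bar>\<tau>\<bar>"
proof (rule continuous_AE_le_imp_le[of "\<lambda>y. \<bar>g (y + \<tau> *\<^sub>R b) - g y\<bar>"])
  show "continuous_on UNIV (\<lambda>y. \<bar>g (y + \<tau> *\<^sub>R b) - g y\<bar>)"
    by (intro continuous_intros continuous_on_compose2[OF g] g) auto
qed (rule weak_derivative_bounded_imp_AE_Lipschitz[OF w b h])


section \<open>The heat kernel\<close>

lemma integral_lborel_prod:
  fixes f :: "'a::euclidean_space \<Rightarrow> real \<Rightarrow> 'b::{real_normed_field,banach,second_countable_topology}"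
  assumes f: "\<And>b. b \<in> Basis \<Longrightarrow> integrable lborel (f b)"
  shows "(LBINT x. (\<Prod>b\<in>Basis. f b (x \<bullet> b))) = (\<Prod>b\<in>Basis. LBINT t. f b t)"
proof -
  interpret product_sigma_finite "\<lambda>_::'a. lborel :: real measure" ..
  have [measurable]: "f b \<in> borel_measurable borel" if "b \<in> Basis" for b
    using f[OF that] by auto
  have "(LBINT x. (\<Prod>b\<in>Basis. f b (x \<bullet> b))) =
      (LINT g|(\<Pi>\<^sub>M b\<in>Basis. lborel). (\<Prod>b\<in>Basis. f b ((\<Sum>b\<in>Basis. g b *\<^sub>R b) \<bullet> b)))"
    by (subst lborel_eq) (rule integral_distr; measurable)
  also have "\<dots> = (LINT g|(\<Pi>\<^sub>M b\<in>Basis. lborel). (\<Prod>b\<in>Basis. f b (g b)))"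
    by (intro Bochner_Integration.integral_cong prod.cong refl) simp
  also have "\<dots> = (\<Prod>b\<in>Basis. LBINT t. f b t)"
    by (rule product_integral_prod) (auto intro: f)
  finally show ?thesis .
qed

text \<open>The fundamental solution of the heat equation \<open>\<partial>\<^sub>s u = \<Delta>u\<close>. This normalisation of time makes the
  Fourier transform of \<open>heat s\<close> equal to \<open>exp (- s \<bar>\<xi>\<bar>\<^sup>2)\<close>.\<close>

definition heat :: "real \<Rightarrow> 'a::euclidean_space \<Rightarrow> real" where
  "heat s x = exp (- ((norm x)\<^sup>2 / (4 * s))) / sqrt (4 * pi * s) ^ DIM('a)"

lemma heat_pos: "s > 0 \<Longrightarrow> 0 < heat s x"
  by (simp add: heat_def)

lemma continuous_on_heat: "continuous_on UNIV (heat s)"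
proof (cases "s = 0")
  case False
  then show ?thesis unfolding heat_def
    by (cases "s < 0"; intro continuous_intros) (auto simp: )
qed (simp add: heat_def)

lemma heat_measurable[measurable]: "heat s \<in> borel_measurable borel"
  by (rule borel_measurable_continuous_onI[OF continuous_on_heat])

lemma heat_measurable2[measurable]:
  "(\<lambda>(s, x). heat s x) \<in> borel_measurable (borel \<Otimes>\<^sub>M borel)"
  unfolding heat_def case_prod_beta by measurable

lemma norm_power2_eq_sum_Basis: "(norm (x::'a::euclidean_space))\<^sup>2 = (\<Sum>b\<in>Basis. (x \<bullet> b)\<^sup>2)"
  by (subst power2_norm_eq_inner, subst euclidean_inner) (simp add: power2_eq_square)

lemma heat_eq_prod:
  assumes "s > 0"
  shows "heat s (x::'a::euclidean_space) = (\<Prod>b\<in>Basis. normal_density 0 (sqrt (2 * s)) (x \<bullet> b))"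
proof -
  have "(\<Prod>b\<in>Basis. normal_density 0 (sqrt (2 * s)) (x \<bullet> b)) =
     (\<Prod>b\<in>(Basis::'a set). 1 / sqrt (4 * pi * s)) * (\<Prod>b\<in>Basis. exp (- ((x \<bullet> b)\<^sup>2 / (4 * s))))"
    using assms by (subst prod.distrib[symmetric]) (simp add: normal_density_def mult.assoc)
  also have "(\<Prod>b\<in>(Basis::'a set). exp (- ((x \<bullet> b)\<^sup>2 / (4 * s)))) = exp (- ((norm x)\<^sup>2 / (4 * s)))"
    by (simp add: exp_sum[symmetric] sum_negf sum_divide_distrib[symmetric] norm_power2_eq_sum_Basis)
  finally show ?thesis by (simp add: heat_def power_divide)
qed

lemma nn_integral_heat:
  assumes "s > 0"
  shows "(\<integral>\<^sup>+x. ennreal (heat s (x::'a::euclidean_space)) \<partial>lborel) = 1"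
proof -
  have "(\<integral>\<^sup>+x. ennreal (heat s (x::'a)) \<partial>lborel) =
      (\<integral>\<^sup>+x. (\<Prod>b\<in>(Basis::'a set). ennreal (normal_density 0 (sqrt (2 * s)) (x \<bullet> b))) \<partial>lborel)"
    by (intro nn_integral_cong) (simp add: heat_eq_prod assms prod_ennreal)
  also have "\<dots> = (\<Prod>b\<in>(Basis::'a set). \<integral>\<^sup>+t. ennreal (normal_density 0 (sqrt (2 * s)) t) \<partial>lborel)"
    by (rule nn_integral_lborel_prod) auto
  also have "\<dots> = 1"
    using assms by (simp add: nn_integral_eq_integral integral_normal_density)
  finally show ?thesis .
qed

lemma integrable_heat:
  assumes s: "s > 0"
  shows "integrable lborel (heat s :: 'a::euclidean_space \<Rightarrow> real)"
proof (rule integrableI_nonneg)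
  show "(\<integral>\<^sup>+x. ennreal (heat s (x::'a)) \<partial>lborel) < \<infinity>"
    by (simp add: nn_integral_heat s)
qed (auto intro: AE_I2 less_imp_le heat_pos s)

lemma integral_heat:
  assumes s: "s > 0"
  shows "(LBINT x. heat s (x::'a::euclidean_space)) = 1"
proof -
  have "(LBINT x. heat s (x::'a)) = enn2real (\<integral>\<^sup>+x. ennreal (heat s (x::'a)) \<partial>lborel)"
    by (rule integral_eq_nn_integral) (auto intro: AE_I2 less_imp_le heat_pos s)
  then show ?thesis by (simp add: nn_integral_heat s)
qed

lemma integrable_heat_diff: "s > 0 \<Longrightarrow> integrable lborel (\<lambda>y. heat s (x - y))"
  by (rule integrable_lborel_reflect[OF integrable_heat])

lemma integral_heat_diff: "s > 0 \<Longrightarrow> (LBINT y. heat s (x - y)) = 1"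
  by (subst integral_lborel_reflect) (auto simp: integral_heat)

lemma heat_le:
  assumes "s > 0"
  shows "heat s (x::'a::euclidean_space) \<le> 1 / sqrt s ^ DIM('a)"
proof -
  have "sqrt s \<le> sqrt (4 * pi * s)"
    using assms pi_gt3 by (simp add: mult_le_cancel_right)
  then have "sqrt s ^ DIM('a) \<le> sqrt (4 * pi * s) ^ DIM('a)"
    using assms by (intro power_mono) auto
  moreover have "exp (- ((norm x)\<^sup>2 / (4 * s))) \<le> 1"
    using assms by simp
  ultimately show ?thesis
    unfolding heat_def using assms by (intro frac_le) auto
qed

text \<open>Half of the exponent absorbs the factor \<open>\<bar>x\<bar>\<close>; the other half is the Gaussian at time \<open>2 s\<close>.\<close>

lemma heat_first_moment_le:
  assumes "s > 0"
  shows "norm (x::'a::euclidean_space) * heat s x \<le> 2 * sqrt s * sqrt 2 ^ DIM('a) * heat (2 * s) x"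
proof -
  let ?e = "exp (- ((norm x)\<^sup>2 / (8 * s)))"
  define u where "u = norm x / sqrt s"
  have u: "u\<^sup>2 = (norm x)\<^sup>2 / s" "norm x = u * sqrt s"
    using assms by (auto simp: u_def power_divide)
  have "u / 2 \<le> 1 + u\<^sup>2 / 8"
    using zero_le_power2[of "u - 2"] by (simp add: power2_eq_square algebra_simps)
  also have "\<dots> \<le> exp (u\<^sup>2 / 8)" by (rule exp_ge_add_one_self)
  finally have "u * exp (- (u\<^sup>2 / 8)) \<le> 2"
    by (simp add: exp_minus field_simps)
  then have "(u * exp (- (u\<^sup>2 / 8))) * sqrt s \<le> 2 * sqrt s"
    using assms by (intro mult_right_mono) auto
  moreover have "u\<^sup>2 / 8 = (norm x)\<^sup>2 / (8 * s)" by (simp add: u(1))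
  ultimately have *: "norm x * ?e \<le> 2 * sqrt s"
    by (simp add: u(2) mult_ac)
  have "sqrt (4 * pi * (2 * s)) = sqrt 2 * sqrt (4 * pi * s)"
    by (simp flip: real_sqrt_mult)
  then have "heat s x = sqrt 2 ^ DIM('a) * heat (2 * s) x * ?e"
    by (simp add: heat_def power_mult_distrib exp_add[symmetric] field_simps)
  then have "norm x * heat s x = (norm x * ?e) * (sqrt 2 ^ DIM('a) * heat (2 * s) x)"
    by simp
  also have "\<dots> \<le> (2 * sqrt s) * (sqrt 2 ^ DIM('a) * heat (2 * s) x)"
    using * assms heat_pos[of "2 * s" x] by (intro mult_right_mono) auto
  finally show ?thesis by (simp add: mult.assoc)
qed

text \<open>The bound has the right order \<open>\<bar>c\<bar> / \<surd>s\<close> without differentiating the kernel: the geometric mean of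
  two translates of a Gaussian is again a Gaussian, with mass \<open>exp (- \<bar>c\<bar>\<^sup>2 / (16 s))\<close> by the
  parallelogram law, so the two translates are close in Hellinger distance.\<close>

lemma heat_shift_L1:
  assumes s: "s > 0"
  shows "(LBINT x. \<bar>heat s (x + c) - heat s (x::'a::euclidean_space)\<bar>) \<le> 3 * norm c / sqrt s"
proof (cases "c = 0")
  case False
  define e where "e = exp (- ((norm c)\<^sup>2 / (16 * s)))"
  \<comment> \<open>the parameter of the inequality \<open>2 p q \<le> p\<^sup>2 / l + l q\<^sup>2\<close>, which balances its two terms here\<close>
  define l where "l = norm c / sqrt s"
  have l: "l > 0" using False s by (simp add: l_def)
  have int: "integrable lborel (\<lambda>x. heat s (x + a))" for a :: 'a
    by (rule integrable_lborel_translate[OF integrable_heat[OF s]])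
  have int0: "integrable lborel (heat s :: 'a \<Rightarrow> real)" by (rule integrable_heat[OF s])
  have one: "(LBINT x. heat s (x + a)) = 1" for a :: 'a
    by (simp add: integral_lborel_translate integral_heat s)
  have gm: "sqrt (heat s (x + c)) * sqrt (heat s x) = e * heat s (x + (1 / 2) *\<^sub>R c)" for x :: 'a
  proof -
    have par: "(norm c)\<^sup>2 = 2 * (norm (x + c))\<^sup>2 + 2 * (norm x)\<^sup>2 - 4 * (norm (x + (1 / 2) *\<^sub>R c))\<^sup>2"
      by (simp add: power2_norm_eq_inner inner_add_left inner_add_right inner_commute field_simps)
    have "exp (- ((norm (x + c))\<^sup>2 / (4 * s))) * exp (- ((norm x)\<^sup>2 / (4 * s))) =
        (e * exp (- ((norm (x + (1 / 2) *\<^sub>R c))\<^sup>2 / (4 * s))))\<^sup>2"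
      unfolding e_def exp_add[symmetric] exp_double[symmetric]
      by (intro arg_cong[of _ _ exp]) (use s in \<open>simp add: par field_simps\<close>)
    then have "heat s (x + c) * heat s x = (e * heat s (x + (1 / 2) *\<^sub>R c))\<^sup>2"
      by (simp add: heat_def power2_eq_square)
    then show ?thesis
      using heat_pos[OF s, of "x + (1 / 2) *\<^sub>R c"] by (simp add: real_sqrt_mult[symmetric] e_def less_imp_le)
  qed
  have pt: "\<bar>heat s (x + c) - heat s x\<bar> \<le>
      1 / (2 * l) * (heat s (x + c) + heat s x - 2 * (e * heat s (x + (1 / 2) *\<^sub>R c))) +
      l / 2 * (heat s (x + c) + heat s x + 2 * (e * heat s (x + (1 / 2) *\<^sub>R c)))" for x :: 'a
  proof -
    define a b where "a = sqrt (heat s (x + c))" and "b = sqrt (heat s x)"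
    have ab: "0 \<le> a" "0 \<le> b" "heat s (x + c) = a\<^sup>2" "heat s x = b\<^sup>2"
      using heat_pos[OF s, of x] heat_pos[OF s, of "x + c"] by (auto simp: a_def b_def less_imp_le)
    have "2 * (\<bar>a - b\<bar> * (a + b)) \<le> 1 / l * \<bar>a - b\<bar>\<^sup>2 + l * (a + b)\<^sup>2"
      using zero_le_power2[of "\<bar>a - b\<bar> - l * (a + b)"] l
      by (simp add: field_simps power2_eq_square)
    moreover have "\<bar>a\<^sup>2 - b\<^sup>2\<bar> = \<bar>a - b\<bar> * (a + b)"
      using ab by (simp add: power2_eq_square abs_mult[symmetric] square_diff_square_factored mult.commute)
        (simp add: abs_mult)
    ultimately have "\<bar>a\<^sup>2 - b\<^sup>2\<bar> \<le> 1 / (2 * l) * (a\<^sup>2 + b\<^sup>2 - 2 * (a * b)) + l / 2 * (a\<^sup>2 + b\<^sup>2 + 2 * (a * b))"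
    proof -
      assume le: "2 * (\<bar>a - b\<bar> * (a + b)) \<le> 1 / l * \<bar>a - b\<bar>\<^sup>2 + l * (a + b)\<^sup>2"
        and eq: "\<bar>a\<^sup>2 - b\<^sup>2\<bar> = \<bar>a - b\<bar> * (a + b)"
      have "a\<^sup>2 + b\<^sup>2 - 2 * (a * b) = \<bar>a - b\<bar>\<^sup>2" "a\<^sup>2 + b\<^sup>2 + 2 * (a * b) = (a + b)\<^sup>2"
        by (simp_all add: power2_diff power2_sum)
      moreover have "1 / (2 * l) * \<bar>a - b\<bar>\<^sup>2 = (1 / l * \<bar>a - b\<bar>\<^sup>2) / 2" by simp
      ultimately show ?thesis using le eq by simp
    qed
    then show ?thesis unfolding gm[symmetric] ab(3,4) using ab(1,2) by simp
  qed
  have "(LBINT x. \<bar>heat s (x + c) - heat s (x::'a)\<bar>) \<le>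
      (LBINT x. 1 / (2 * l) * (heat s (x + c) + heat s x - 2 * (e * heat s (x + (1 / 2) *\<^sub>R c))) +
      l / 2 * (heat s (x + c) + heat s x + 2 * (e * heat s (x + (1 / 2) *\<^sub>R c))))"
    by (intro integral_mono pt) (use int int0 in auto)
  also have "\<dots> = 1 / (2 * l) * (2 - 2 * e) + l / 2 * (2 + 2 * e)"
    using int int0 one one[of 0] by simp
  also have "\<dots> \<le> 1 / (2 * l) * (2 * ((norm c)\<^sup>2 / (16 * s))) + l / 2 * 4"
  proof -
    have "1 - (norm c)\<^sup>2 / (16 * s) \<le> e"
      unfolding e_def using exp_ge_add_one_self[of "- ((norm c)\<^sup>2 / (16 * s))"] by simp
    moreover have "e \<le> 1" using s by (simp add: e_def)
    ultimately show ?thesis using l by (intro add_mono mult_left_mono) auto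
  qed
  also have "\<dots> = l / 16 + 2 * l"
  proof -
    have "(norm c)\<^sup>2 / s = l\<^sup>2" using s by (simp add: l_def power_divide)
    then have eq: "(norm c)\<^sup>2 / (16 * s) = l\<^sup>2 / 16" by (metis divide_divide_eq_left mult.commute)
    show ?thesis unfolding eq using l by (simp add: power2_eq_square)
  qed
  also have "\<dots> \<le> 3 * l" using l by simp
  finally show ?thesis by (simp add: l_def)
qed simp


subsection \<open>Fourier transform of Gaussians\<close>

lemma integral_iexp_gaussian_real:
  fixes x s :: real
  assumes s: "s > 0"
  shows "(LBINT t. iexp (t * x) * of_real (exp (- (s * t\<^sup>2)))) =
     of_real (sqrt (pi / s) * exp (- (x\<^sup>2 / (4 * s))))"
proof -
  define a where "a = 1 / sqrt (2 * s)"
  have a: "a > 0" "s * a\<^sup>2 = 1 / 2" using s by (auto simp: a_def power_divide)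
  have "(LBINT t. iexp (t * x) * of_real (exp (- (s * t\<^sup>2)))) =
      a *\<^sub>R (LBINT u. iexp ((a * u) * x) * of_real (exp (- (s * (a * u)\<^sup>2))))"
    using lborel_integral_real_affine[of a "\<lambda>t. iexp (t * x) * of_real (exp (- (s * t\<^sup>2)))" 0] a(1) by simp
  also have "(\<lambda>u. iexp ((a * u) * x) * of_real (exp (- (s * (a * u)\<^sup>2)))) =
      (\<lambda>u. of_real (sqrt (2 * pi)) * (std_normal_density u *\<^sub>R iexp ((a * x) * u)))"
  proof
    fix u
    have "s * (a * u)\<^sup>2 = u\<^sup>2 / 2" using a(2) by (simp add: power_mult_distrib mult.assoc[symmetric])
    then show "iexp ((a * u) * x) * of_real (exp (- (s * (a * u)\<^sup>2))) =
       of_real (sqrt (2 * pi)) * (std_normal_density u *\<^sub>R iexp ((a * x) * u))"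
      by (simp add: std_normal_density_def scaleR_conv_of_real mult_ac)
  qed
  also have "(LBINT u. of_real (sqrt (2 * pi)) * (std_normal_density u *\<^sub>R iexp ((a * x) * u))) =
     of_real (sqrt (2 * pi)) * char std_normal_distribution (a * x)"
    unfolding char_def
    by (subst integral_density) (simp_all add: normal_density_nonneg del: mult_scaleR_right)
  also have "char std_normal_distribution (a * x) = of_real (exp (- (x\<^sup>2 / (4 * s))))"
    using s by (simp add: char_std_normal_distribution a_def power_mult_distrib power_divide)
  also have "a *\<^sub>R (of_real (sqrt (2 * pi)) * of_real (exp (- (x\<^sup>2 / (4 * s))))) =
      complex_of_real (a * sqrt (2 * pi) * exp (- (x\<^sup>2 / (4 * s))))"
    by (simp add: scaleR_conv_of_real)
  also have "a * sqrt (2 * pi) = sqrt (pi / s)"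
    using s by (simp add: a_def real_sqrt_mult real_sqrt_divide)
  finally show ?thesis .
qed

text \<open>Both the Gaussian and the character factor over the coordinates.\<close>

lemma integral_iexp_gaussian:
  fixes x :: "'a::euclidean_space"
  assumes s: "s > 0"
  shows "(LBINT \<xi>. iexp (x \<bullet> \<xi>) * of_real (exp (- (s * (norm \<xi>)\<^sup>2)))) =
     of_real ((2 * pi) ^ DIM('a) * heat s x)"
proof -
  let ?f = "\<lambda>b t. iexp (t * (x \<bullet> b)) * of_real (exp (- (s * t\<^sup>2)))"
  have int: "integrable lborel (?f b)" for b
  proof (rule Bochner_Integration.integrable_bound)
    have "normal_density 0 (sqrt (1 / (2 * s))) t = 1 / sqrt (pi / s) * exp (- (s * t\<^sup>2))" for t
      using s by (simp add: normal_density_def)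
    then have "exp (- (s * t\<^sup>2)) = sqrt (pi / s) * normal_density 0 (sqrt (1 / (2 * s))) t" for t
      using s by simp
    then show "integrable lborel (\<lambda>t. exp (- (s * t\<^sup>2)))"
      using s by simp
  qed (auto simp: norm_mult)
  have "(LBINT \<xi>. iexp (x \<bullet> \<xi>) * of_real (exp (- (s * (norm \<xi>)\<^sup>2)))) =
      (LBINT \<xi>. (\<Prod>b\<in>Basis. ?f b (\<xi> \<bullet> b)))"
  proof (intro Bochner_Integration.integral_cong refl)
    fix \<xi> :: 'a
    have "(\<Prod>b\<in>Basis. iexp (\<xi> \<bullet> b * (x \<bullet> b))) = iexp (x \<bullet> \<xi>)"
      by (subst euclidean_inner[of x \<xi>]) (simp add: exp_sum[symmetric] sum_distrib_left mult.commute)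
    moreover have "(\<Prod>b\<in>Basis. complex_of_real (exp (- (s * (\<xi> \<bullet> b)\<^sup>2)))) = of_real (exp (- (s * (norm \<xi>)\<^sup>2)))"
      by (subst of_real_prod[symmetric]) (simp add: exp_sum[symmetric] norm_power2_eq_sum_Basis sum_distrib_left sum_negf)
    ultimately show "iexp (x \<bullet> \<xi>) * of_real (exp (- (s * (norm \<xi>)\<^sup>2))) = (\<Prod>b\<in>Basis. ?f b (\<xi> \<bullet> b))"
      by (simp add: prod.distrib)
  qed
  also have "\<dots> = (\<Prod>b\<in>(Basis::'a set). of_real (sqrt (pi / s) * exp (- ((x \<bullet> b)\<^sup>2 / (4 * s)))))"
    by (subst integral_lborel_prod[OF int]) (simp only: integral_iexp_gaussian_real[OF s])
  also have "\<dots> = of_real (sqrt (pi / s) ^ DIM('a) * exp (- ((norm x)\<^sup>2 / (4 * s))))"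
    by (subst of_real_prod[symmetric]) (simp add: prod.distrib exp_sum[symmetric] sum_negf
        sum_divide_distrib[symmetric] norm_power2_eq_sum_Basis)
  also have "sqrt (pi / s) ^ DIM('a) = (2 * pi) ^ DIM('a) / sqrt (4 * pi * s) ^ DIM('a)"
  proof -
    have "sqrt (pi / s) = 2 * pi / sqrt (4 * pi * s)"
      using s by (simp add: real_sqrt_mult real_sqrt_divide field_simps flip: power2_eq_square)
    then show ?thesis by (simp add: power_divide)
  qed
  finally show ?thesis by (simp add: heat_def)
qed

lemma integrable_gaussian:
  assumes "s > 0"
  shows "integrable lborel (\<lambda>\<xi>::'a::euclidean_space. exp (- (s * (norm \<xi>)\<^sup>2)))"
proof -
  have "heat (1 / (4 * s)) \<xi> * sqrt (pi / s) ^ DIM('a) = exp (- (s * (norm \<xi>)\<^sup>2))" for \<xi> :: 'a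
    using assms by (simp add: heat_def mult.commute)
  moreover have "integrable lborel (\<lambda>\<xi>::'a. heat (1 / (4 * s)) \<xi> * sqrt (pi / s) ^ DIM('a))"
    using assms by (intro integrable_mult_left integrable_heat) simp
  ultimately show ?thesis by simp
qed


section \<open>The screened potential as an average over the heat semigroup\<close>

definition heat_conv :: "real \<Rightarrow> ('a::euclidean_space \<Rightarrow> real) \<Rightarrow> 'a \<Rightarrow> real" where
  "heat_conv s r x = (LBINT y. heat s (x - y) * r y)"

lemma abs_heat: "s > 0 \<Longrightarrow> \<bar>heat s x\<bar> = heat s x"
  by (simp add: heat_pos less_imp_le)

lemma integrable_heat_mult:
  fixes r :: "'a::euclidean_space \<Rightarrow> real"
  assumes s: "s > 0" and r: "integrable lborel r"
  shows "integrable lborel (\<lambda>y. heat s (x - y) * r y)"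
proof (rule Bochner_Integration.integrable_bound)
  have [measurable]: "r \<in> borel_measurable borel" using r by auto
  show "integrable lborel (\<lambda>y. 1 / sqrt s ^ DIM('a) * r y)" using r by simp
  show "(\<lambda>y. heat s (x - y) * r y) \<in> borel_measurable lborel" by measurable
  have "\<bar>heat s (x - y)\<bar> * \<bar>r y\<bar> \<le> 1 / sqrt s ^ DIM('a) * \<bar>r y\<bar>" for y
    using heat_pos[OF s, of "x - y"] heat_le[OF s, of "x - y"] by (intro mult_right_mono) auto
  then show "AE y in lborel. norm (heat s (x - y) * r y) \<le> norm (1 / sqrt s ^ DIM('a) * r y)"
    using s by (simp add: abs_mult)
qed

lemma heat_conv_measurable[measurable]:
  fixes r :: "'a::euclidean_space \<Rightarrow> real"
  assumes [measurable]: "r \<in> borel_measurable borel"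
  shows "(\<lambda>s. heat_conv (\<epsilon> + s) r x) \<in> borel_measurable borel"
  unfolding heat_conv_def by measurable

lemma heat_conv_abs_le_L1:
  fixes r :: "'a::euclidean_space \<Rightarrow> real"
  assumes s: "s > 0" and r: "integrable lborel r"
  shows "\<bar>heat_conv s r x\<bar> \<le> 1 / sqrt s ^ DIM('a) * (LBINT y. \<bar>r y\<bar>)"
proof -
  have "\<bar>heat_conv s r x\<bar> \<le> (LBINT y. 1 / sqrt s ^ DIM('a) * \<bar>r y\<bar>)"
    unfolding heat_conv_def
  proof (rule abs_integral_le)
    show "\<bar>heat s (x - y) * r y\<bar> \<le> 1 / sqrt s ^ DIM('a) * \<bar>r y\<bar>" for y
      unfolding abs_mult abs_heat[OF s] by (intro mult_right_mono heat_le s) auto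
  qed (use r in auto)
  then show ?thesis by simp
qed

lemma heat_conv_abs_le:
  assumes s: "s > 0" and r: "integrable lborel r" and K: "AE y in lborel. \<bar>r y\<bar> \<le> K"
  shows "\<bar>heat_conv s r x\<bar> \<le> K"
proof -
  have "norm (heat_conv s r x) \<le> (LBINT y. K * heat s (x - y))"
    unfolding heat_conv_def
  proof (rule norm_integral_le_AE)
    show "AE y in lborel. norm (heat s (x - y) * r y) \<le> K * heat s (x - y)"
      using K by eventually_elim
        (auto simp: abs_mult abs_heat s less_imp_le heat_pos mult.commute[of K] intro!: mult_left_mono)
  qed (use integrable_heat_diff[OF s] in auto)
  then show ?thesis by (simp add: integral_heat_diff s)
qed

lemma heat_conv_shift_le:
  fixes r :: "'a::euclidean_space \<Rightarrow> real"
  assumes s: "s > 0" and r: "integrable lborel r" and K: "AE y in lborel. \<bar>r y\<bar> \<le> K"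
  shows "\<bar>heat_conv s r (x + c) - heat_conv s r x\<bar> \<le> K * (3 * norm c / sqrt s)"
proof -
  have "0 \<le> K"
  proof (rule ccontr)
    assume "\<not> 0 \<le> K"
    with K have "AE y::'a in lborel. False" by (auto elim: eventually_mono)
    then show False by (simp add: eventually_False ae_filter_eq_bot_iff)
  qed
  have int: "integrable lborel (\<lambda>y. \<bar>heat s (x + c - y) - heat s (x - y)\<bar>)"
    by (intro integrable_abs Bochner_Integration.integrable_diff integrable_heat_diff s)
  have "heat_conv s r (x + c) - heat_conv s r x = (LBINT y. (heat s (x + c - y) - heat s (x - y)) * r y)"
    unfolding heat_conv_def
    by (subst Bochner_Integration.integral_diff[symmetric])
      (auto simp: left_diff_distrib integrable_heat_mult s r)
  also have "\<bar>\<dots>\<bar> \<le> (LBINT y. K * \<bar>heat s (x + c - y) - heat s (x - y)\<bar>)"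
    unfolding real_norm_def[symmetric, of "integral\<^sup>L _ _"]
  proof (rule norm_integral_le_AE)
    show "AE y in lborel. norm ((heat s (x + c - y) - heat s (x - y)) * r y) \<le> K * \<bar>heat s (x + c - y) - heat s (x - y)\<bar>"
      using K by eventually_elim (auto simp: abs_mult mult.commute[of K] intro!: mult_left_mono)
  qed (use int in auto)
  also have "\<dots> = K * (LBINT y. \<bar>heat s ((x - y) + c) - heat s (x - y)\<bar>)"
    by (simp add: algebra_simps)
  also have "(LBINT y. \<bar>heat s ((x - y) + c) - heat s (x - y)\<bar>) = (LBINT y. \<bar>heat s (y + c) - heat s y\<bar>)"
    by (rule integral_lborel_reflect) measurable
  also have "K * \<dots> \<le> K * (3 * norm c / sqrt s)"
    using heat_shift_L1[OF s, of c] \<open>0 \<le> K\<close> by (intro mult_left_mono)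
  finally show ?thesis .
qed

text \<open>Translations commute with convolution, so differences of \<open>heat_conv s r\<close> can be put on \<open>r\<close>.\<close>

lemma heat_conv_translate:
  assumes s: "s > 0" and r: "integrable lborel r"
  shows "heat_conv s r (x + a) - heat_conv s r x = heat_conv s (\<lambda>y. r (y + a) - r y) x"
proof -
  have [measurable]: "r \<in> borel_measurable borel" using r by auto
  have ra: "integrable lborel (\<lambda>y. r (y + a))" by (rule integrable_lborel_translate[OF r])
  have "heat_conv s r (x + a) = (LBINT y. heat s (x + a - (y + a)) * r (y + a))"
    unfolding heat_conv_def
    using integral_lborel_translate[of "\<lambda>y. heat s (x + a - y) * r y" a] by simp
  then have "heat_conv s r (x + a) = (LBINT y. heat s (x - y) * r (y + a))"
    by simp
  then show ?thesis
    unfolding heat_conv_def right_diff_distrib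
    by (simp add: Bochner_Integration.integral_diff integrable_heat_mult[OF s r] integrable_heat_mult[OF s ra])
qed

lemma heat_first_moment:
  assumes s: "s > 0"
  shows "integrable lborel (\<lambda>y. norm (x - y) * heat s (x - y::'a::euclidean_space))"
    and "(LBINT y. norm (x - y) * heat s (x - y::'a)) \<le> 2 * sqrt s * sqrt 2 ^ DIM('a)"
proof -
  have i2: "integrable lborel (\<lambda>y. 2 * sqrt s * sqrt 2 ^ DIM('a) * heat (2 * s) (x - y))"
    using s by (intro integrable_mult_right integrable_heat_diff) auto
  have pt: "norm (x - y) * heat s (x - y) \<le> 2 * sqrt s * sqrt 2 ^ DIM('a) * heat (2 * s) (x - y)" for y
    by (rule heat_first_moment_le[OF s])
  show i1: "integrable lborel (\<lambda>y. norm (x - y) * heat s (x - y))"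
    by (rule Bochner_Integration.integrable_bound[OF i2])
      (use pt s in \<open>auto simp: abs_mult abs_heat\<close>)
  have "(LBINT y. norm (x - y) * heat s (x - y)) \<le>
      (LBINT y. 2 * sqrt s * sqrt 2 ^ DIM('a) * heat (2 * s) (x - y))"
    by (intro integral_mono i1 i2 pt)
  then show "(LBINT y. norm (x - y) * heat s (x - y)) \<le> 2 * sqrt s * sqrt 2 ^ DIM('a)"
    using s by (simp add: integral_heat_diff)
qed

lemma heat_conv_minus_eq:
  assumes s: "s > 0" and \<phi>: "integrable lborel \<phi>"
  shows "heat_conv s \<phi> x - \<phi> x = (LBINT y. heat s (x - y) * (\<phi> y - \<phi> x))"
  unfolding heat_conv_def right_diff_distrib
  by (subst Bochner_Integration.integral_diff)
    (auto simp: integrable_heat_mult[OF s \<phi>] integrable_heat_diff[OF s] integral_heat_diff[OF s])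

lemma heat_conv_approx_Lipschitz:
  fixes \<phi> :: "'a::euclidean_space \<Rightarrow> real"
  assumes s: "s > 0" and \<phi>: "integrable lborel \<phi>" and L: "\<And>y. \<bar>\<phi> y - \<phi> x\<bar> \<le> L * norm (x - y)"
  shows "\<bar>heat_conv s \<phi> x - \<phi> x\<bar> \<le> L * (2 * sqrt s * sqrt 2 ^ DIM('a))"
proof -
  have "0 \<le> L * norm (x - y)" for y using L[of y] by linarith
  from this[of "x - (SOME b. b \<in> Basis)"] have "0 \<le> L"
    by (simp add: SOME_Basis zero_le_mult_iff)
  have "\<bar>heat_conv s \<phi> x - \<phi> x\<bar> \<le> (LBINT y. L * (norm (x - y) * heat s (x - y)))"
    unfolding heat_conv_minus_eq[OF s \<phi>]
  proof (rule abs_integral_le)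
    show "integrable lborel (\<lambda>y. L * (norm (x - y) * heat s (x - y)))"
      by (intro integrable_mult_right heat_first_moment s)
    show "\<bar>heat s (x - y) * (\<phi> y - \<phi> x)\<bar> \<le> L * (norm (x - y) * heat s (x - y))" for y
      using mult_left_mono[OF L[of y], of "heat s (x - y)"] heat_pos[OF s, of "x - y"]
      by (simp add: abs_mult mult_ac)
  qed
  also have "\<dots> \<le> L * (2 * sqrt s * sqrt 2 ^ DIM('a))"
    using heat_first_moment(2)[OF s, of x] \<open>0 \<le> L\<close> by (simp add: mult_left_mono)
  finally show ?thesis .
qed

text \<open>Near \<open>x\<close> the integrand is small by continuity. Away from \<open>x\<close> the kernel is uniformly small, which
  controls the integrable function \<open>\<phi>\<close> without any bound on its values, and the constant \<open>\<phi> x\<close> is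
  controlled by the first moment of the kernel.\<close>

lemma heat_conv_tendsto:
  fixes \<phi> :: "'a::euclidean_space \<Rightarrow> real"
  assumes cont: "continuous_on UNIV \<phi>" and \<phi>: "integrable lborel \<phi>"
  shows "((\<lambda>s. heat_conv s \<phi> x) \<longlongrightarrow> \<phi> x) (at_right 0)"
proof (rule tendstoI)
  fix \<eta> :: real assume \<eta>: "0 < \<eta>"
  obtain \<delta> where \<delta>: "\<delta> > 0" "\<And>y. norm (y - x) < \<delta> \<Longrightarrow> \<bar>\<phi> y - \<phi> x\<bar> < \<eta> / 2"
    using cont \<eta> unfolding continuous_on_iff dist_norm real_norm_def
    by (metis UNIV_I half_gt_zero)
  define N where "N = (LBINT y. \<bar>\<phi> y\<bar>)"
  define h where "h s = exp (- (\<delta>\<^sup>2 / (4 * s))) / sqrt (4 * pi * s) ^ DIM('a)" for s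
  define B where "B s = h s * N + \<bar>\<phi> x\<bar> / \<delta> * (2 * sqrt s * sqrt 2 ^ DIM('a))" for s
  have bound: "\<bar>heat_conv s \<phi> x - \<phi> x\<bar> \<le> \<eta> / 2 + B s" if s: "s > 0" for s
  proof -
    have h0: "h s \<ge> 0" using s by (simp add: h_def)
    have "\<bar>heat_conv s \<phi> x - \<phi> x\<bar> \<le> (LBINT y. \<eta> / 2 * heat s (x - y) +
        (h s * \<bar>\<phi> y\<bar> + \<bar>\<phi> x\<bar> / \<delta> * (norm (x - y) * heat s (x - y))))"
      unfolding heat_conv_minus_eq[OF s \<phi>]
    proof (rule abs_integral_le)
      show "integrable lborel (\<lambda>y. \<eta> / 2 * heat s (x - y) +
          (h s * \<bar>\<phi> y\<bar> + \<bar>\<phi> x\<bar> / \<delta> * (norm (x - y) * heat s (x - y))))"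
        by (intro Bochner_Integration.integrable_add integrable_mult_right integrable_heat_diff s
            integrable_abs \<phi> heat_first_moment)
      fix y
      show "\<bar>heat s (x - y) * (\<phi> y - \<phi> x)\<bar> \<le> \<eta> / 2 * heat s (x - y) +
          (h s * \<bar>\<phi> y\<bar> + \<bar>\<phi> x\<bar> / \<delta> * (norm (x - y) * heat s (x - y)))"
      proof (cases "norm (y - x) < \<delta>")
        case True
        have "\<bar>heat s (x - y) * (\<phi> y - \<phi> x)\<bar> \<le> \<eta> / 2 * heat s (x - y)"
          using \<delta>(2)[OF True] by (simp add: abs_mult abs_heat s mult.commute[of _ "\<eta>/2"] mult_right_mono less_imp_le heat_pos)
        moreover have "0 \<le> h s * \<bar>\<phi> y\<bar> + \<bar>\<phi> x\<bar> / \<delta> * (norm (x - y) * heat s (x - y))"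
          using h0 \<delta>(1) heat_pos[OF s, of "x - y"] by (intro add_nonneg_nonneg mult_nonneg_nonneg) auto
        ultimately show ?thesis by linarith
      next
        case False
        then have far: "\<delta> \<le> norm (x - y)" by (simp add: norm_minus_commute)
        have "\<delta>\<^sup>2 \<le> (norm (x - y))\<^sup>2" using far \<delta>(1) by (intro power_mono) auto
        then have "heat s (x - y) \<le> h s"
          unfolding heat_def h_def using s by (intro divide_right_mono) (auto simp: divide_right_mono)
        then have 1: "heat s (x - y) * \<bar>\<phi> y\<bar> \<le> h s * \<bar>\<phi> y\<bar>" by (intro mult_right_mono) auto
        have "1 \<le> norm (x - y) / \<delta>" using far \<delta>(1) by simp
        then have "\<bar>\<phi> x\<bar> * heat s (x - y) * 1 \<le> \<bar>\<phi> x\<bar> * heat s (x - y) * (norm (x - y) / \<delta>)"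
          using heat_pos[OF s, of "x - y"] by (intro mult_left_mono) auto
        then have 2: "heat s (x - y) * \<bar>\<phi> x\<bar> \<le> \<bar>\<phi> x\<bar> / \<delta> * (norm (x - y) * heat s (x - y))"
          by (simp add: mult_ac)
        have "\<bar>heat s (x - y) * (\<phi> y - \<phi> x)\<bar> \<le> heat s (x - y) * (\<bar>\<phi> y\<bar> + \<bar>\<phi> x\<bar>)"
          using heat_pos[OF s, of "x - y"] unfolding abs_mult abs_heat[OF s]
          by (intro mult_left_mono) auto
        moreover have "0 \<le> \<eta> / 2 * heat s (x - y)" using \<eta> heat_pos[OF s, of "x - y"] by simp
        ultimately show ?thesis using 1 2 by (simp add: distrib_left)
      qed
    qed
    also have "\<dots> = \<eta> / 2 + (h s * N + \<bar>\<phi> x\<bar> / \<delta> * (LBINT y. norm (x - y) * heat s (x - y)))"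
      using integrable_heat_diff[OF s, of x] heat_first_moment(1)[OF s, of x] \<phi>
      by (simp add: integral_heat_diff[OF s] N_def)
    also have "\<dots> \<le> \<eta> / 2 + B s"
      unfolding B_def using heat_first_moment(2)[OF s, of x] \<delta>(1)
      by (intro add_left_mono mult_left_mono) auto
    finally show ?thesis .
  qed
  have "(h \<longlongrightarrow> 0) (at_right 0)"
  proof (rule tendsto_sandwich[OF _ _ tendsto_const])
    show "eventually (\<lambda>s. 0 \<le> h s) (at_right 0)"
      by (auto simp: eventually_at_filter h_def)
    have "((\<lambda>s. inverse s ^ DIM('a) * exp (- (\<delta>\<^sup>2 / 4) * inverse s)) \<longlongrightarrow> 0) (at_right 0)"
      using \<delta>(1) by real_asymp
    then show "((\<lambda>s. inverse s ^ DIM('a) * exp (- (\<delta>\<^sup>2 / 4) * inverse s)) \<longlongrightarrow> 0) (at_right (0::real))" .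
    have "eventually (\<lambda>s::real. 0 < s \<and> s < 1) (at_right 0)"
      using eventually_at_right_real[of 0 1] by simp
    then show "eventually (\<lambda>s. h s \<le> inverse s ^ DIM('a) * exp (- (\<delta>\<^sup>2 / 4) * inverse s)) (at_right 0)"
    proof eventually_elim
      case (elim s)
      have "s * s \<le> 1 * s" using elim by (intro mult_right_mono) auto
      also have "\<dots> \<le> (4 * pi) * s" using elim pi_gt3 by (intro mult_right_mono) auto
      finally have "s \<le> sqrt (4 * pi * s)" using elim by (intro real_le_rsqrt) (simp add: power2_eq_square)
      then have "s ^ DIM('a) \<le> sqrt (4 * pi * s) ^ DIM('a)" using elim by (intro power_mono) auto
      then have "h s \<le> exp (- (\<delta>\<^sup>2 / (4 * s))) / s ^ DIM('a)"
        unfolding h_def using elim by (intro divide_left_mono) auto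
      moreover have "exp (- (\<delta>\<^sup>2 / (4 * s))) / s ^ DIM('a) = inverse s ^ DIM('a) * exp (- (\<delta>\<^sup>2 / 4) * inverse s)"
      proof -
        have "\<delta>\<^sup>2 / (4 * s) = \<delta>\<^sup>2 / 4 * inverse s" using elim by (simp add: field_simps)
        then show ?thesis by (subst mult.commute) (simp add: power_inverse field_simps)
      qed
      ultimately show ?case by simp
    qed
  qed
  then have "(B \<longlongrightarrow> 0 * N + \<bar>\<phi> x\<bar> / \<delta> * (2 * sqrt 0 * sqrt 2 ^ DIM('a))) (at_right 0)"
    unfolding B_def by (intro tendsto_intros)
  then have "eventually (\<lambda>s. B s < \<eta> / 2) (at_right 0)"
    using \<eta> by (intro order_tendstoD(2)) auto
  moreover have "eventually (\<lambda>s. s > 0) (at_right (0::real))" by (simp add: eventually_at_right_less)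
  ultimately show "eventually (\<lambda>s. dist (heat_conv s \<phi> x) (\<phi> x) < \<eta>) (at_right 0)"
    by eventually_elim (use bound in \<open>force simp: dist_real_def\<close>)
qed


lemma integrable_pair_bound:
  fixes f :: "'a::euclidean_space \<Rightarrow> 'b::euclidean_space \<Rightarrow> 'c::{banach, second_countable_topology}"
  assumes f[measurable]: "case_prod f \<in> borel_measurable (lborel \<Otimes>\<^sub>M lborel)"
    and u: "integrable lborel u" and w: "integrable lborel w"
    and bd: "\<And>x y. norm (f x y) \<le> u x * w y"
  shows "integrable (lborel \<Otimes>\<^sub>M lborel) (case_prod f)"
proof (rule Bochner_Integration.integrable_bound)
  have [measurable]: "u \<in> borel_measurable borel" "w \<in> borel_measurable borel" using u w by auto
  show "integrable (lborel \<Otimes>\<^sub>M lborel) (\<lambda>(x, y). u x * w y)"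
  proof (rule lborel_pair.Fubini_integrable)
    show "(\<lambda>(x, y). u x * w y) \<in> borel_measurable (lborel \<Otimes>\<^sub>M lborel)" by measurable
    show "integrable lborel (\<lambda>x. LBINT y. norm (case (x, y) of (x, y) \<Rightarrow> u x * w y))"
      using u by (simp add: abs_mult)
    show "AE x in lborel. integrable lborel (\<lambda>y. case (x, y) of (x, y) \<Rightarrow> u x * w y)"
      using w by simp
  qed
  show "AE z in lborel \<Otimes>\<^sub>M lborel. norm (case_prod f z) \<le> norm (case z of (x, y) \<Rightarrow> u x * w y)"
    using order_trans[OF bd abs_ge_self] by (intro AE_I2) (auto split: prod.split)
qed (fact f)

lemma norm_iexp: "norm (exp (\<i> * complex_of_real t)) = 1" "norm (exp (- (\<i> * complex_of_real t))) = 1"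
  using norm_exp_i_times[of t] norm_exp_i_times[of "- t"] by simp_all

lemma fourier_measurable[measurable]:
  assumes [measurable]: "g \<in> borel_measurable borel"
  shows "fourier g \<in> borel_measurable borel"
  unfolding fourier_def[abs_def] by measurable

lemma norm_fourier_le: "norm (fourier g \<xi>) \<le> (LBINT x. \<bar>g x\<bar>)"
proof -
  have "norm (fourier g \<xi>) \<le> (LBINT x. norm (exp (- \<i> * of_real (x \<bullet> \<xi>)) * complex_of_real (g x)))"
    unfolding fourier_def by (rule integral_norm_bound)
  then show ?thesis by (simp add: norm_mult norm_iexp)
qed

text \<open>Fourier inversion, regularised by a Gaussian so that every integral converges absolutely.\<close>

lemma heat_conv_fourier:
  fixes g :: "'a::euclidean_space \<Rightarrow> real"
  assumes s: "s > 0" and g: "integrable lborel g"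
  shows "(LBINT \<xi>. iexp (x \<bullet> \<xi>) * of_real (exp (- (s * (norm \<xi>)\<^sup>2))) * fourier g \<xi>) =
     of_real ((2 * pi) ^ DIM('a) * heat_conv s g x)"
proof -
  have [measurable]: "g \<in> borel_measurable borel" using g by auto
  let ?f = "\<lambda>\<xi> y. iexp (x \<bullet> \<xi>) * of_real (exp (- (s * (norm \<xi>)\<^sup>2))) *
     (exp (- \<i> * of_real (y \<bullet> \<xi>)) * complex_of_real (g y))"
  have int: "integrable (lborel \<Otimes>\<^sub>M lborel) (\<lambda>(\<xi>, y). ?f \<xi> y)"
  proof (rule integrable_pair_bound)
    show "integrable lborel (\<lambda>\<xi>::'a. exp (- (s * (norm \<xi>)\<^sup>2)))" by (rule integrable_gaussian[OF s])
    show "integrable lborel (\<lambda>y. \<bar>g y\<bar>)" using g by simp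
    show "(\<lambda>(\<xi>, y). ?f \<xi> y) \<in> borel_measurable (lborel \<Otimes>\<^sub>M lborel)" by measurable
  qed (simp add: norm_mult norm_iexp)
  have "(LBINT \<xi>. iexp (x \<bullet> \<xi>) * of_real (exp (- (s * (norm \<xi>)\<^sup>2))) * fourier g \<xi>) =
      (LBINT \<xi>. LBINT y. ?f \<xi> y)"
    unfolding fourier_def by simp
  also have "\<dots> = (LBINT y. LBINT \<xi>. ?f \<xi> y)"
    by (rule lborel_pair.Fubini_integral[OF int, symmetric])
  also have "(\<lambda>y. LBINT \<xi>. ?f \<xi> y) =
      (\<lambda>y. complex_of_real ((2 * pi) ^ DIM('a) * (heat s (x - y) * g y)))"
  proof
    fix y
    have "?f \<xi> y = of_real (g y) * (iexp ((x - y) \<bullet> \<xi>) * of_real (exp (- (s * (norm \<xi>)\<^sup>2))))" for \<xi>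
    proof -
      have "iexp ((x - y) \<bullet> \<xi>) = iexp (x \<bullet> \<xi>) * exp (- \<i> * of_real (y \<bullet> \<xi>))"
        unfolding exp_add[symmetric] by (simp add: inner_diff_left right_diff_distrib)
      then show ?thesis by (simp only: mult_ac)
    qed
    then have "(LBINT \<xi>. ?f \<xi> y) =
      of_real (g y) * (LBINT \<xi>. iexp ((x - y) \<bullet> \<xi>) * of_real (exp (- (s * (norm \<xi>)\<^sup>2))))"
      by (simp only: integral_mult_right_zero)
    then show "(LBINT \<xi>. ?f \<xi> y) = complex_of_real ((2 * pi) ^ DIM('a) * (heat s (x - y) * g y))"
      by (simp only: integral_iexp_gaussian[OF s]) simp
  qed
  also have "(LBINT y. complex_of_real ((2 * pi) ^ DIM('a) * (heat s (x - y) * g y))) =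
      of_real ((2 * pi) ^ DIM('a) * heat_conv s g x)"
    by (simp only: integral_complex_of_real integral_mult_right_zero heat_conv_def)
  finally show ?thesis .
qed

lemma integral_exp_ray:
  assumes "a > 0"
  shows "(LBINT s. indicator {0<..} s * exp (- (s * a))) = 1 / (a::real)"
    and "integrable lborel (\<lambda>s. indicator {0<..} s * exp (- (s * a)))"
  using LBINT_I0i_exp_mscale[OF assms] integrable_I0i_exp_mscale[OF assms]
  by (simp_all add: interval_lebesgue_integral_0_infty set_lebesgue_integral_def set_integrable_def)

text \<open>On the Fourier side this is the identity
  \<open>1 / (1 + \<bar>\<xi>\<bar>\<^sup>2) = \<integral> exp (- s) exp (- s \<bar>\<xi>\<bar>\<^sup>2) ds\<close> over \<open>s > 0\<close>. The Gaussian of width \<open>\<epsilon>\<close> on both sides makes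
  Fubini's theorem applicable.\<close>

lemma heat_conv_potential:
  fixes \<rho> \<phi> :: "'a::euclidean_space \<Rightarrow> real"
  assumes pot: "screened_potential \<rho> \<phi>" and \<epsilon>: "\<epsilon> > 0"
  shows "heat_conv \<epsilon> \<phi> x = (LBINT s. indicator {0<..} s * exp (- s) * heat_conv (\<epsilon> + s) \<rho> x)"
proof -
  have \<rho>: "integrable lborel \<rho>" and \<phi>: "integrable lborel \<phi>"
    and F: "\<And>\<xi>. fourier \<phi> \<xi> = of_real (1 / (1 + (norm \<xi>)\<^sup>2)) * fourier \<rho> \<xi>"
    using pot by (auto simp: screened_potential_def)
  have [measurable]: "\<rho> \<in> borel_measurable borel" using \<rho> by auto
  let ?g = "\<lambda>\<xi>. iexp (x \<bullet> \<xi>) * of_real (exp (- (\<epsilon> * (norm \<xi>)\<^sup>2))) * fourier \<rho> \<xi>"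
  let ?e = "\<lambda>(\<xi>::'a) s. complex_of_real (indicator {0<..} s * exp (- (s * (1 + (norm \<xi>)\<^sup>2))))"
  have pos: "1 + (norm \<xi>)\<^sup>2 > 0" for \<xi> :: 'a
    by (simp add: add_pos_nonneg)
  have int: "integrable (lborel \<Otimes>\<^sub>M lborel) (\<lambda>(\<xi>, s). ?g \<xi> * ?e \<xi> s)"
  proof (rule integrable_pair_bound)
    show "integrable lborel (\<lambda>\<xi>::'a. exp (- (\<epsilon> * (norm \<xi>)\<^sup>2)) * (LBINT x. \<bar>\<rho> x\<bar>))"
      by (intro integrable_mult_left integrable_gaussian \<epsilon>)
    show "integrable lborel (\<lambda>s::real. indicator {0<..} s * exp (- (s * 1)))"
      by (rule integral_exp_ray) simp
    show "(\<lambda>(\<xi>, s). ?g \<xi> * ?e \<xi> s) \<in> borel_measurable (lborel \<Otimes>\<^sub>M lborel)" by measurable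
    fix \<xi> :: 'a and s :: real
    have "norm (?g \<xi>) \<le> exp (- (\<epsilon> * (norm \<xi>)\<^sup>2)) * (LBINT x. \<bar>\<rho> x\<bar>)"
      by (simp add: norm_mult norm_iexp norm_fourier_le mult_left_mono)
    moreover have "norm (?e \<xi> s) \<le> indicator {0<..} s * exp (- (s * 1))"
      by (auto simp: norm_mult indicator_def)
    ultimately show "norm (?g \<xi> * ?e \<xi> s) \<le>
        exp (- (\<epsilon> * (norm \<xi>)\<^sup>2)) * (LBINT x. \<bar>\<rho> x\<bar>) * (indicator {0<..} s * exp (- (s * 1)))"
      unfolding norm_mult[of "?g \<xi>"] by (intro mult_mono mult_nonneg_nonneg Bochner_Integration.integral_nonneg) auto
  qed
  have "of_real ((2 * pi) ^ DIM('a) * heat_conv \<epsilon> \<phi> x) = (LBINT \<xi>. ?g \<xi> * of_real (1 / (1 + (norm \<xi>)\<^sup>2)))"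
    unfolding heat_conv_fourier[OF \<epsilon> \<phi>, symmetric] F by (simp only: mult_ac)
  also have "\<dots> = (LBINT \<xi>. LBINT s. ?g \<xi> * ?e \<xi> s)"
    by (simp only: integral_mult_right_zero integral_complex_of_real integral_exp_ray[OF pos])
  also have "\<dots> = (LBINT s. LBINT \<xi>. ?g \<xi> * ?e \<xi> s)"
    by (rule lborel_pair.Fubini_integral[OF int, symmetric])
  also have "\<dots> = (LBINT s. complex_of_real ((2 * pi) ^ DIM('a) *
      (indicator {0<..} s * exp (- s) * heat_conv (\<epsilon> + s) \<rho> x)))"
  proof (intro Bochner_Integration.integral_cong refl)
    fix s :: real
    show "(LBINT \<xi>. ?g \<xi> * ?e \<xi> s) = complex_of_real ((2 * pi) ^ DIM('a) *
        (indicator {0<..} s * exp (- s) * heat_conv (\<epsilon> + s) \<rho> x))"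
    proof (cases "s > 0")
      case True
      have "?g \<xi> * ?e \<xi> s = of_real (exp (- s)) *
          (iexp (x \<bullet> \<xi>) * of_real (exp (- ((\<epsilon> + s) * (norm \<xi>)\<^sup>2))) * fourier \<rho> \<xi>)" for \<xi>
      proof -
        have "exp (- (\<epsilon> * (norm \<xi>)\<^sup>2)) * (indicator {0<..} s * exp (- (s * (1 + (norm \<xi>)\<^sup>2)))) =
            exp (- s) * exp (- ((\<epsilon> + s) * (norm \<xi>)\<^sup>2))"
          using True unfolding exp_add[symmetric] by (simp add: exp_add[symmetric] algebra_simps)
        from arg_cong[OF this, of complex_of_real]
        have "complex_of_real (exp (- (\<epsilon> * (norm \<xi>)\<^sup>2))) * ?e \<xi> s =
            of_real (exp (- s)) * of_real (exp (- ((\<epsilon> + s) * (norm \<xi>)\<^sup>2)))"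
          by (simp only: of_real_mult)
        then have "iexp (x \<bullet> \<xi>) * fourier \<rho> \<xi> * (complex_of_real (exp (- (\<epsilon> * (norm \<xi>)\<^sup>2))) * ?e \<xi> s) =
            iexp (x \<bullet> \<xi>) * fourier \<rho> \<xi> * (of_real (exp (- s)) * of_real (exp (- ((\<epsilon> + s) * (norm \<xi>)\<^sup>2))))"
          by (rule arg_cong)
        then show ?thesis by (simp only: mult_ac)
      qed
      then have "(LBINT \<xi>. ?g \<xi> * ?e \<xi> s) = of_real (exp (- s)) *
          of_real ((2 * pi) ^ DIM('a) * heat_conv (\<epsilon> + s) \<rho> x)"
        using \<epsilon> True by (simp only: integral_mult_right_zero) (subst heat_conv_fourier[OF _ \<rho>]; simp)
      then show ?thesis using True by (simp add: mult_ac)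
    qed simp
  qed
  also have "\<dots> = of_real ((2 * pi) ^ DIM('a) *
      (LBINT s. indicator {0<..} s * exp (- s) * heat_conv (\<epsilon> + s) \<rho> x))"
    by (simp only: integral_complex_of_real integral_mult_right_zero)
  finally show ?thesis unfolding of_real_eq_iff by simp
qed

text \<open>The integral is \<open>\<Gamma>(1/2) = \<surd>\<pi>\<close>.\<close>

lemma integral_exp_over_sqrt:
  "integrable lborel (\<lambda>s. indicator {0<..} s * exp (- s) / sqrt s)"
  "(LBINT s. indicator {0<..} s * exp (- s) / sqrt s) \<le> 2"
proof -
  have "(\<integral>\<^sup>+s. ennreal (indicator {0<..} s * exp (- s) / sqrt s) \<partial>lborel) =
      (\<integral>\<^sup>+t. ennreal (indicator {0..} t * t powr (1 / 2 - 1) / exp t) \<partial>lborel)"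
  proof (rule nn_integral_cong)
    fix s :: real
    show "ennreal (indicator {0<..} s * exp (- s) / sqrt s) = ennreal (indicator {0..} s * s powr (1 / 2 - 1) / exp s)"
    proof (cases "s > 0")
      case True
      then have "s powr (1 / 2 - 1) = 1 / sqrt s"
        using powr_minus_divide[of s "1 / 2"] by (simp add: powr_half_sqrt)
      then show ?thesis using True by (simp add: exp_minus field_simps)
    qed (simp add: indicator_def)
  qed
  also have "\<dots> = ennreal (sqrt pi)"
    using Gamma_conv_nn_integral_real[of "1 / 2"] by (simp add: Gamma_one_half_real)
  finally have eq: "(\<integral>\<^sup>+s. ennreal (indicator {0<..} s * exp (- s) / sqrt s) \<partial>lborel) = ennreal (sqrt pi)" .
  have nn: "0 \<le> indicator {0<..} s * exp (- s) / sqrt s" for s :: real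
    by (auto simp: indicator_def)
  show "integrable lborel (\<lambda>s. indicator {0<..} s * exp (- s) / sqrt s)"
    by (rule integrableI_nonneg) (use eq nn in auto)
  have "(LBINT s. indicator {0<..} s * exp (- s) / sqrt s) = sqrt pi"
    by (subst integral_eq_nn_integral) (use eq nn in auto)
  also have "\<dots> \<le> sqrt 4" using pi_less_4 by (intro real_sqrt_le_mono) simp
  finally show "(LBINT s. indicator {0<..} s * exp (- s) / sqrt s) \<le> 2" by simp
qed

lemma integrable_exp_heat_conv:
  fixes \<rho> :: "'a::euclidean_space \<Rightarrow> real"
  assumes \<epsilon>: "\<epsilon> > 0" and \<rho>: "integrable lborel \<rho>"
  shows "integrable lborel (\<lambda>s. indicator {0<..} s * exp (- s) * heat_conv (\<epsilon> + s) \<rho> x)"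
proof (rule Bochner_Integration.integrable_bound)
  have [measurable]: "\<rho> \<in> borel_measurable borel" using \<rho> by auto
  let ?N = "1 / sqrt \<epsilon> ^ DIM('a) * (LBINT y. \<bar>\<rho> y\<bar>)"
  show "integrable lborel (\<lambda>s. (indicator {0<..} s * exp (- (s * 1))) * ?N)"
    by (intro integrable_mult_left integral_exp_ray) simp
  show "(\<lambda>s. indicator {0<..} s * exp (- s) * heat_conv (\<epsilon> + s) \<rho> x) \<in> borel_measurable lborel"
    by measurable
  have "\<bar>heat_conv (\<epsilon> + s) \<rho> x\<bar> \<le> ?N" if "s > 0" for s
  proof -
    have "\<bar>heat_conv (\<epsilon> + s) \<rho> x\<bar> \<le> 1 / sqrt (\<epsilon> + s) ^ DIM('a) * (LBINT y. \<bar>\<rho> y\<bar>)"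
      using \<epsilon> that by (intro heat_conv_abs_le_L1 \<rho>) auto
    also have "\<dots> \<le> ?N"
      using \<epsilon> that by (intro mult_right_mono divide_left_mono power_mono Bochner_Integration.integral_nonneg) auto
    finally show ?thesis .
  qed
  then have "norm (indicator {0<..} s * exp (- s) * heat_conv (\<epsilon> + s) \<rho> x) \<le>
      norm ((indicator {0<..} s * exp (- (s * 1))) * ?N)" for s :: real
  proof (cases "s > 0")
    case True
    then have "exp (- s) * \<bar>heat_conv (\<epsilon> + s) \<rho> x\<bar> \<le> exp (- s) * \<bar>?N\<bar>"
      using \<open>\<And>s. s > 0 \<Longrightarrow> \<bar>heat_conv (\<epsilon> + s) \<rho> x\<bar> \<le> ?N\<close>[OF True] by (intro mult_left_mono order_trans[OF _ abs_ge_self]) auto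
    then show ?thesis using True unfolding real_norm_def abs_mult[of "indicator {0<..} s * exp (- (s * 1))"]
        abs_mult[of "indicator {0<..} s * exp (- s)"] by simp
  qed simp
  then show "AE s in lborel. norm (indicator {0<..} s * exp (- s) * heat_conv (\<epsilon> + s) \<rho> x) \<le>
      norm ((indicator {0<..} s * exp (- (s * 1))) * ?N)" by simp
qed

text \<open>Every estimate below is a bound for finitely many values of the potential, and it suffices to
  prove it along the heat flow.\<close>

lemma potential_combination_le:
  fixes \<rho> \<phi> :: "'a::euclidean_space \<Rightarrow> real"
  assumes pot: "screened_potential \<rho> \<phi>" and cont: "continuous_on UNIV \<phi>" and I: "finite I"
    and B1: "B1 \<ge> 0"
    and bd: "\<And>s. s > 0 \<Longrightarrow> \<bar>\<Sum>j\<in>I. w j * heat_conv s \<rho> (z j)\<bar> \<le> B0 + B1 / sqrt s"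
  shows "\<bar>\<Sum>j\<in>I. w j * \<phi> (z j)\<bar> \<le> B0 + 2 * B1"
proof (rule tendsto_upperbound)
  have \<rho>: "integrable lborel \<rho>" and \<phi>: "integrable lborel \<phi>"
    using pot by (auto simp: screened_potential_def)
  show "((\<lambda>\<epsilon>. \<bar>\<Sum>j\<in>I. w j * heat_conv \<epsilon> \<phi> (z j)\<bar>) \<longlongrightarrow> \<bar>\<Sum>j\<in>I. w j * \<phi> (z j)\<bar>) (at_right 0)"
    by (intro tendsto_intros heat_conv_tendsto cont \<phi>)
  have "\<bar>\<Sum>j\<in>I. w j * heat_conv \<epsilon> \<phi> (z j)\<bar> \<le> B0 + 2 * B1" if \<epsilon>: "\<epsilon> > 0" for \<epsilon>
  proof -
    let ?F = "\<lambda>j s. indicator {0<..} s * exp (- s) * heat_conv (\<epsilon> + s) \<rho> (z j)"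
    have i1: "integrable lborel (\<lambda>s. B0 * (indicator {0<..} s * exp (- (s * 1))) +
        B1 * (indicator {0<..} s * exp (- s) / sqrt s))"
      by (intro Bochner_Integration.integrable_add integrable_mult_right integral_exp_ray integral_exp_over_sqrt) simp
    have eq: "(\<Sum>j\<in>I. w j * heat_conv \<epsilon> \<phi> (z j)) = (LBINT s. (\<Sum>j\<in>I. w j * ?F j s))"
      by (subst Bochner_Integration.integral_sum)
        (auto intro!: integrable_exp_heat_conv \<epsilon> \<rho> simp: heat_conv_potential[OF pot \<epsilon>])
    have "\<bar>\<Sum>j\<in>I. w j * heat_conv \<epsilon> \<phi> (z j)\<bar> \<le> (LBINT s. B0 * (indicator {0<..} s * exp (- (s * 1))) +
        B1 * (indicator {0<..} s * exp (- s) / sqrt s))"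
      unfolding eq
    proof (rule abs_integral_le[OF i1])
      fix s :: real
      show "\<bar>\<Sum>j\<in>I. w j * ?F j s\<bar> \<le> B0 * (indicator {0<..} s * exp (- (s * 1))) +
        B1 * (indicator {0<..} s * exp (- s) / sqrt s)"
      proof (cases "s > 0")
        case True
        have "(\<Sum>j\<in>I. w j * ?F j s) = exp (- s) * (\<Sum>j\<in>I. w j * heat_conv (\<epsilon> + s) \<rho> (z j))"
          using True by (simp add: sum_distrib_left mult_ac)
        also have "\<bar>\<dots>\<bar> \<le> exp (- s) * (B0 + B1 / sqrt (\<epsilon> + s))"
          using bd[of "\<epsilon> + s"] \<epsilon> True by (simp add: abs_mult)
        also have "\<dots> \<le> exp (- s) * (B0 + B1 / sqrt s)"
          using \<epsilon> True B1 by (intro mult_left_mono add_left_mono divide_left_mono) auto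
        finally show ?thesis using True by (simp add: field_simps)
      qed simp
    qed
    also have "\<dots> = B0 + B1 * (LBINT s. indicator {0<..} s * exp (- s) / sqrt s)"
      using integral_exp_ray[of 1] integral_exp_over_sqrt(1)
      by (subst Bochner_Integration.integral_add) (simp_all del: times_divide_eq_right)
    also have "\<dots> \<le> B0 + B1 * 2"
      by (intro add_left_mono mult_left_mono B1 integral_exp_over_sqrt)
    finally show ?thesis by simp
  qed
  then show "eventually (\<lambda>\<epsilon>. \<bar>\<Sum>j\<in>I. w j * heat_conv \<epsilon> \<phi> (z j)\<bar> \<le> B0 + 2 * B1) (at_right 0)"
    by (auto simp: eventually_at_filter)
qed simp


section \<open>Estimates of the field by the density gradient\<close>

lemma GDERIV_along_line:
  assumes "GDERIV \<phi> (x + \<theta> *\<^sub>R b) :> D"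
  shows "((\<lambda>\<theta>. \<phi> (x + \<theta> *\<^sub>R b)) has_real_derivative b \<bullet> D) (at \<theta>)"
  by (rule has_derivative_along_line) (use assms in \<open>simp add: gderiv_def\<close>)

lemma DERIV_abs_le:
  fixes f :: "real \<Rightarrow> real"
  assumes f: "(f has_real_derivative D) (at 0)" and le: "\<And>\<tau>. \<bar>f \<tau> - f 0\<bar> \<le> A * \<bar>\<tau>\<bar>"
  shows "\<bar>D\<bar> \<le> A"
proof (rule tendsto_upperbound)
  show "((\<lambda>h. \<bar>(f (0 + h) - f 0) / h\<bar>) \<longlongrightarrow> \<bar>D\<bar>) (at 0)"
    using f unfolding DERIV_def by (rule tendsto_rabs)
  show "eventually (\<lambda>h. \<bar>(f (0 + h) - f 0) / h\<bar> \<le> A) (at 0)"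
    using le by (auto simp: eventually_at_filter abs_divide pos_divide_le_eq)
qed simp

lemma potential_first_difference:
  fixes \<rho> \<phi> :: "'a::euclidean_space \<Rightarrow> real"
  assumes pot: "screened_potential \<rho> \<phi>" and cont: "continuous_on UNIV \<phi>"
    and K: "AE y in lborel. \<bar>\<rho> (y + a) - \<rho> y\<bar> \<le> K"
  shows "\<bar>\<phi> (x + a) - \<phi> x\<bar> \<le> K"
proof -
  have \<rho>: "integrable lborel \<rho>" using pot by (auto simp: screened_potential_def)
  have r: "integrable lborel (\<lambda>y. \<rho> (y + a) - \<rho> y)"
    by (intro Bochner_Integration.integrable_diff integrable_lborel_translate \<rho>)
  have "\<bar>\<Sum>j\<in>{..<2::nat}. [1, - 1] ! j * \<phi> ([x + a, x] ! j)\<bar> \<le> K + 2 * 0"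
  proof (rule potential_combination_le[OF pot cont])
    fix s :: real assume s: "s > 0"
    have "\<bar>heat_conv s \<rho> (x + a) - heat_conv s \<rho> x\<bar> \<le> K"
      unfolding heat_conv_translate[OF s \<rho>] by (rule heat_conv_abs_le[OF s r K])
    then show "\<bar>\<Sum>j\<in>{..<2::nat}. [1, - 1] ! j * heat_conv s \<rho> ([x + a, x] ! j)\<bar> \<le> K + 0 / sqrt s"
      by (simp add: numeral_2_eq_2)
  qed simp_all
  then show ?thesis by (simp add: numeral_2_eq_2)
qed

text \<open>One difference falls on \<open>\<rho>\<close> and the other one on the heat kernel, where it costs \<open>\<bar>c\<bar> / \<surd>s\<close>. As this is
  integrable at \<open>s = 0\<close>, second differences of \<open>\<phi>\<close> are controlled by first differences of \<open>\<rho>\<close>.\<close>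

lemma potential_second_difference:
  fixes \<rho> \<phi> :: "'a::euclidean_space \<Rightarrow> real"
  assumes pot: "screened_potential \<rho> \<phi>" and cont: "continuous_on UNIV \<phi>"
    and K: "AE y in lborel. \<bar>\<rho> (y + a) - \<rho> y\<bar> \<le> K" "0 \<le> K"
  shows "\<bar>(\<phi> (x + c + a) - \<phi> (x + c)) - (\<phi> (x + a) - \<phi> x)\<bar> \<le> 6 * K * norm c"
proof -
  have \<rho>: "integrable lborel \<rho>" using pot by (auto simp: screened_potential_def)
  have r: "integrable lborel (\<lambda>y. \<rho> (y + a) - \<rho> y)"
    by (intro Bochner_Integration.integrable_diff integrable_lborel_translate \<rho>)
  have "\<bar>\<Sum>j\<in>{..<4::nat}. [1, - 1, - 1, 1] ! j * \<phi> ([x + c + a, x + c, x + a, x] ! j)\<bar> \<le> 0 + 2 * (3 * K * norm c)"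
  proof (rule potential_combination_le[OF pot cont])
    fix s :: real assume s: "s > 0"
    have "\<bar>(heat_conv s \<rho> (x + c + a) - heat_conv s \<rho> (x + c)) - (heat_conv s \<rho> (x + a) - heat_conv s \<rho> x)\<bar>
        \<le> K * (3 * norm c / sqrt s)"
      unfolding heat_conv_translate[OF s \<rho>] by (rule heat_conv_shift_le[OF s r K(1)])
    then show "\<bar>\<Sum>j\<in>{..<4::nat}. [1, - 1, - 1, 1] ! j * heat_conv s \<rho> ([x + c + a, x + c, x + a, x] ! j)\<bar>
        \<le> 0 + 3 * K * norm c / sqrt s"
      by (simp add: eval_nat_numeral algebra_simps)
  qed (use K in simp_all)
  then show ?thesis by (simp add: eval_nat_numeral algebra_simps)
qed

lemma norm_le_if_components_le:
  fixes x :: "'a::euclidean_space"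
  assumes "\<And>b. b \<in> Basis \<Longrightarrow> \<bar>b \<bullet> x\<bar> \<le> A"
  shows "norm x \<le> real DIM('a) * A"
proof -
  have "norm x \<le> (\<Sum>b\<in>Basis. \<bar>x \<bullet> b\<bar>)" by (rule norm_le_l1)
  also have "\<dots> \<le> (\<Sum>b\<in>(Basis::'a set). A)"
    using assms by (intro sum_mono) (simp add: inner_commute)
  finally show ?thesis by simp
qed

text \<open>The bound \<open>\<bar>\<partial>\<^sub>b\<rho>\<bar> \<le> A\<close> in terms of difference quotients. It depends only on the almost everywhere
  class of \<open>\<rho>\<close>, as it must: where \<open>f(t, x, v)\<close> is not integrable in \<open>v\<close>, the density has the default value 0.\<close>

definition steepness_bound :: "real \<Rightarrow> ('a::euclidean_space \<Rightarrow> real) \<Rightarrow> bool" where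
  "steepness_bound A \<rho> \<longleftrightarrow>
     0 \<le> A \<and> (\<forall>b\<in>Basis. \<forall>\<tau>. AE y in lborel. \<bar>\<rho> (y + \<tau> *\<^sub>R b) - \<rho> y\<bar> \<le> A * \<bar>\<tau>\<bar>)"

definition field_of :: "('a::euclidean_space \<Rightarrow> real) \<Rightarrow> ('a \<Rightarrow> real) \<Rightarrow> ('a \<Rightarrow> 'a) \<Rightarrow> bool" where
  "field_of \<rho> \<phi> E \<longleftrightarrow> screened_potential \<rho> \<phi> \<and> (\<forall>x. GDERIV \<phi> x :> - E x)"

lemma field_of_continuous:
  assumes "field_of \<rho> \<phi> E"
  shows "continuous_on UNIV \<phi>"
  using assms by (auto simp: field_of_def gderiv_def intro!: continuous_at_imp_continuous_on
      intro: has_derivative_continuous)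

lemma field_bound:
  fixes \<rho> :: "'a::euclidean_space \<Rightarrow> real"
  assumes f: "field_of \<rho> \<phi> E" and A: "steepness_bound A \<rho>"
  shows "norm (E x) \<le> real DIM('a) * A"
proof (rule norm_le_if_components_le)
  fix b :: 'a assume b: "b \<in> Basis"
  have "\<bar>b \<bullet> (- E x)\<bar> \<le> A"
  proof (rule DERIV_abs_le)
    show "((\<lambda>\<theta>. \<phi> (x + \<theta> *\<^sub>R b)) has_real_derivative b \<bullet> (- E x)) (at 0)"
      by (rule GDERIV_along_line) (use f in \<open>simp add: field_of_def\<close>)
    show "\<bar>\<phi> (x + \<tau> *\<^sub>R b) - \<phi> (x + 0 *\<^sub>R b)\<bar> \<le> A * \<bar>\<tau>\<bar>" for \<tau>
      using potential_first_difference[OF _ field_of_continuous[OF f], of \<rho> "\<tau> *\<^sub>R b" "A * \<bar>\<tau>\<bar>" x]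
        f A b by (simp add: field_of_def steepness_bound_def)
  qed
  then show "\<bar>b \<bullet> E x\<bar> \<le> A" by simp
qed

lemma field_Lipschitz:
  fixes \<rho> :: "'a::euclidean_space \<Rightarrow> real"
  assumes f: "field_of \<rho> \<phi> E" and A: "steepness_bound A \<rho>"
  shows "norm (E y - E x) \<le> real DIM('a) * (6 * A * norm (y - x))"
proof (rule norm_le_if_components_le)
  fix b :: 'a assume b: "b \<in> Basis"
  define c where "c = y - x"
  have "\<bar>b \<bullet> (- E (x + c)) - b \<bullet> (- E x)\<bar> \<le> 6 * A * norm c"
  proof (rule DERIV_abs_le)
    show "((\<lambda>\<theta>. \<phi> (x + c + \<theta> *\<^sub>R b) - \<phi> (x + \<theta> *\<^sub>R b)) has_real_derivative b \<bullet> (- E (x + c)) - b \<bullet> (- E x)) (at 0)"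
      by (intro DERIV_diff GDERIV_along_line) (use f in \<open>simp_all add: field_of_def\<close>)
    fix \<tau> :: real
    have "\<bar>(\<phi> (x + c + \<tau> *\<^sub>R b) - \<phi> (x + c)) - (\<phi> (x + \<tau> *\<^sub>R b) - \<phi> x)\<bar> \<le> 6 * (A * \<bar>\<tau>\<bar>) * norm c"
      using A b f by (intro potential_second_difference[OF _ field_of_continuous[OF f], of \<rho>])
        (simp_all add: steepness_bound_def field_of_def)
    then show "\<bar>\<phi> (x + c + \<tau> *\<^sub>R b) - \<phi> (x + \<tau> *\<^sub>R b) - (\<phi> (x + c + 0 *\<^sub>R b) - \<phi> (x + 0 *\<^sub>R b))\<bar>
        \<le> 6 * A * norm c * \<bar>\<tau>\<bar>"
      by (simp add: algebra_simps)
  qed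
  then show "\<bar>b \<bullet> (E y - E x)\<bar> \<le> 6 * A * norm (y - x)"
    by (simp add: c_def inner_diff_right abs_minus_commute)
qed

lemma field_of_diff:
  assumes "field_of \<rho>1 \<phi>1 E1" "field_of \<rho>2 \<phi>2 E2"
  shows "field_of (\<lambda>x. \<rho>1 x - \<rho>2 x) (\<lambda>x. \<phi>1 x - \<phi>2 x) (\<lambda>x. E1 x - E2 x)"
proof -
  have F: "fourier (\<lambda>x. f x - g x) \<xi> = fourier f \<xi> - fourier g \<xi>"
    if [measurable]: "integrable lborel f" "integrable lborel g" for f g :: "'a \<Rightarrow> real" and \<xi>
  proof -
    have "integrable lborel (\<lambda>x. exp (- \<i> * of_real (x \<bullet> \<xi>)) * complex_of_real (f x))"
      if f: "integrable lborel f" for f :: "'a \<Rightarrow> real"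
    proof (rule Bochner_Integration.integrable_bound[OF f])
      have [measurable]: "f \<in> borel_measurable borel" using f by auto
      show "(\<lambda>x. exp (- \<i> * of_real (x \<bullet> \<xi>)) * complex_of_real (f x)) \<in> borel_measurable lborel"
        by measurable
    qed (simp add: norm_mult norm_iexp)
    then show ?thesis
      using that unfolding fourier_def of_real_diff right_diff_distrib
      by (intro Bochner_Integration.integral_diff) blast+
  qed
  have G: "GDERIV (\<lambda>x. \<phi>1 x - \<phi>2 x) x :> - (E1 x - E2 x)" for x
    using has_derivative_diff[of \<phi>1 _ "at x" \<phi>2] assms
    by (fastforce simp: field_of_def gderiv_def inner_diff_right algebra_simps)
  show ?thesis
    using assms G by (auto simp: field_of_def screened_potential_def F right_diff_distrib)
qed

lemma steepness_bound_diff: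
  assumes "steepness_bound A \<rho>1" "steepness_bound B \<rho>2"
  shows "steepness_bound (A + B) (\<lambda>x. \<rho>1 x - \<rho>2 x)"
  unfolding steepness_bound_def
proof (intro conjI ballI allI)
  show "0 \<le> A + B" using assms by (simp add: steepness_bound_def)
  fix b :: 'a and \<tau> :: real assume b: "b \<in> Basis"
  have "AE y in lborel. \<bar>\<rho>1 (y + \<tau> *\<^sub>R b) - \<rho>1 y\<bar> \<le> A * \<bar>\<tau>\<bar>"
    "AE y in lborel. \<bar>\<rho>2 (y + \<tau> *\<^sub>R b) - \<rho>2 y\<bar> \<le> B * \<bar>\<tau>\<bar>"
    using assms b by (auto simp: steepness_bound_def)
  then show "AE y in lborel. \<bar>\<rho>1 (y + \<tau> *\<^sub>R b) - \<rho>2 (y + \<tau> *\<^sub>R b) - (\<rho>1 y - \<rho>2 y)\<bar> \<le> (A + B) * \<bar>\<tau>\<bar>"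
    by eventually_elim (simp add: distrib_right)
qed

lemma steepness_bound_mono: "steepness_bound A \<rho> \<Longrightarrow> A \<le> B \<Longrightarrow> steepness_bound B \<rho>"
  unfolding steepness_bound_def
proof (intro conjI ballI allI)
  fix b :: 'a and \<tau> :: real
  assume st: "0 \<le> A \<and> (\<forall>b\<in>Basis. \<forall>\<tau>. AE y in lborel. \<bar>\<rho> (y + \<tau> *\<^sub>R b) - \<rho> y\<bar> \<le> A * \<bar>\<tau>\<bar>)"
    and le: "A \<le> B" and "b \<in> Basis"
  then have "AE y in lborel. \<bar>\<rho> (y + \<tau> *\<^sub>R b) - \<rho> y\<bar> \<le> A * \<bar>\<tau>\<bar>" by blast
  then show "AE y in lborel. \<bar>\<rho> (y + \<tau> *\<^sub>R b) - \<rho> y\<bar> \<le> B * \<bar>\<tau>\<bar>"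
    by eventually_elim (use mult_right_mono[OF le, of "\<bar>\<tau>\<bar>"] in linarith)
qed simp

text \<open>A density that is small in \<open>L\<^sup>1\<close> has, after smoothing at a fixed scale \<open>\<epsilon>\<close>, a uniformly small
  potential, and equi-Lipschitz potentials are uniformly close to their smoothing. A mean value
  argument with the Lipschitz bound of the field turns this into smallness of the field.\<close>

lemma field_small_if_density_L1_small:
  fixes A \<kappa> :: real
  assumes A: "A \<ge> 0" and \<kappa>: "\<kappa> > 0"
  obtains \<eta> where "\<eta> > 0"
    "\<And>(\<rho> :: 'a::euclidean_space \<Rightarrow> real) \<phi> E x. field_of \<rho> \<phi> E \<Longrightarrow> steepness_bound A \<rho> \<Longrightarrow>
       (LBINT y. \<bar>\<rho> y\<bar>) \<le> \<eta> \<Longrightarrow> norm (E x) \<le> \<kappa>"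
proof -
  define n where "n = real DIM('a)"
  have n: "n \<ge> 1" using DIM_positive[where 'a='a] by (simp add: n_def)
  \<comment> \<open>the step of the mean value argument: over a distance \<open>\<tau>\<close> the field changes by at most \<open>\<kappa> / (2 n)\<close>\<close>
  define \<tau> where "\<tau> = \<kappa> / (12 * n * n * (A + 1))"
  have \<tau>: "\<tau> > 0" using \<kappa> n A by (simp add: \<tau>_def)
  \<comment> \<open>the bound for the potential that makes its difference quotient over \<open>\<tau>\<close> at most \<open>\<kappa> / (2 n)\<close>\<close>
  define S where "S = \<kappa> * \<tau> / (4 * n)"
  have S: "S > 0" using \<kappa> n \<tau> by (simp add: S_def)
  \<comment> \<open>smoothing at time \<open>q\<^sup>2\<close> changes the potential by at most \<open>S / 2\<close>\<close>
  define q where "q = S / (4 * n * (A + 1) * sqrt 2 ^ DIM('a))"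
  have q: "q > 0" using S n A by (simp add: q_def)
  show ?thesis
  proof (rule that)
    show "S / 2 * q ^ DIM('a) > 0" using S q by simp
    fix \<rho> :: "'a \<Rightarrow> real" and \<phi> E x
    assume f: "field_of \<rho> \<phi> E" and st: "steepness_bound A \<rho>"
      and small: "(LBINT y. \<bar>\<rho> y\<bar>) \<le> S / 2 * q ^ DIM('a)"
    have pot: "screened_potential \<rho> \<phi>" using f by (simp add: field_of_def)
    have cont: "continuous_on UNIV \<phi>" by (rule field_of_continuous[OF f])
    have \<rho>: "integrable lborel \<rho>" and \<phi>: "integrable lborel \<phi>"
      using pot by (auto simp: screened_potential_def)
    have L: "\<bar>\<phi> y - \<phi> z\<bar> \<le> n * A * norm (y - z)" for y z
      unfolding n_def
    proof (rule Lipschitz_if_directional[OF A])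
      fix b y :: 'a and \<tau> :: real assume "b \<in> Basis"
      then show "\<bar>\<phi> (y + \<tau> *\<^sub>R b) - \<phi> y\<bar> \<le> A * \<bar>\<tau>\<bar>"
        using st by (intro potential_first_difference[OF pot cont]) (simp add: steepness_bound_def)
    qed
    have sup: "\<bar>\<phi> z\<bar> \<le> S" for z
    proof -
      have q2: "q\<^sup>2 > 0" "sqrt (q\<^sup>2) = q" using q by simp_all
      have "\<bar>heat_conv (q\<^sup>2) \<phi> z - \<phi> z\<bar> \<le> n * A * (2 * sqrt (q\<^sup>2) * sqrt 2 ^ DIM('a))"
        using L[of _ z] by (intro heat_conv_approx_Lipschitz[OF q2(1) \<phi>]) (simp add: norm_minus_commute)
      also have "\<dots> = A / (A + 1) * (S / 2)"
        using n A S by (simp add: q2(2) q_def)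
      also have "\<dots> \<le> 1 * (S / 2)"
        using A S by (intro mult_right_mono) auto
      finally have 1: "\<bar>heat_conv (q\<^sup>2) \<phi> z - \<phi> z\<bar> \<le> S / 2" by simp
      have "heat_conv (q\<^sup>2) \<phi> z = (LBINT s. indicator {0<..} s * exp (- s) * heat_conv (q\<^sup>2 + s) \<rho> z)"
        by (rule heat_conv_potential[OF pot q2(1)])
      also have "\<bar>\<dots>\<bar> \<le> (LBINT s. indicator {0<..} s * exp (- (s * 1)) * (S / 2))"
      proof (rule abs_integral_le)
        show "integrable lborel (\<lambda>s. indicator {0<..} s * exp (- (s * 1)) * (S / 2))"
          by (intro integrable_mult_left integral_exp_ray) simp
        fix s :: real
        show "\<bar>indicator {0<..} s * exp (- s) * heat_conv (q\<^sup>2 + s) \<rho> z\<bar> \<le> indicator {0<..} s * exp (- (s * 1)) * (S / 2)"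
        proof (cases "s > 0")
          case True
          have "\<bar>heat_conv (q\<^sup>2 + s) \<rho> z\<bar> \<le> 1 / sqrt (q\<^sup>2 + s) ^ DIM('a) * (LBINT y. \<bar>\<rho> y\<bar>)"
            using True q by (intro heat_conv_abs_le_L1 \<rho>) (simp add: add_pos_pos)
          also have "\<dots> \<le> 1 / q ^ DIM('a) * (S / 2 * q ^ DIM('a))"
          proof (intro mult_mono small divide_left_mono power_mono)
            show "q \<le> sqrt (q\<^sup>2 + s)" using True by (intro real_le_rsqrt) simp
          qed (use q True S in \<open>auto intro!: add_pos_pos mult_pos_pos zero_less_power\<close>)
          also have "\<dots> = S / 2" using q by simp
          finally show ?thesis using True by (simp add: abs_mult)
        qed simp
      qed
      also have "\<dots> = S / 2"
        using integral_exp_ray(1)[of 1] by simp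
      finally show ?thesis using 1 by linarith
    qed
    have "norm (E x) \<le> n * (\<kappa> / n)"
      unfolding n_def
    proof (rule norm_le_if_components_le, fold n_def)
      fix b :: 'a assume b: "b \<in> Basis"
      have "\<exists>\<theta>>0. \<theta> < \<tau> \<and> \<phi> (x + \<tau> *\<^sub>R b) - \<phi> (x + 0 *\<^sub>R b) = (\<tau> - 0) * (b \<bullet> (- E (x + \<theta> *\<^sub>R b)))"
        using f by (intro MVT2 \<tau> GDERIV_along_line) (simp add: field_of_def)
      then obtain \<theta> where \<theta>: "0 < \<theta>" "\<theta> < \<tau>"
        "\<phi> (x + \<tau> *\<^sub>R b) - \<phi> x = - \<tau> * (b \<bullet> E (x + \<theta> *\<^sub>R b))" by auto
      have "\<tau> * \<bar>b \<bullet> E (x + \<theta> *\<^sub>R b)\<bar> = \<bar>\<phi> (x + \<tau> *\<^sub>R b) - \<phi> x\<bar>"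
        using \<tau> by (simp add: \<theta>(3) abs_mult)
      also have "\<dots> \<le> 2 * S" using sup[of "x + \<tau> *\<^sub>R b"] sup[of x] by linarith
      also have "\<dots> = \<tau> * (\<kappa> / (2 * n))" using n by (simp add: S_def)
      finally have 1: "\<bar>b \<bullet> E (x + \<theta> *\<^sub>R b)\<bar> \<le> \<kappa> / (2 * n)"
        using \<tau> by (simp only: mult_le_cancel_left_pos)
      have "\<bar>b \<bullet> (E (x + \<theta> *\<^sub>R b) - E x)\<bar> \<le> norm (E (x + \<theta> *\<^sub>R b) - E x)"
        by (subst inner_commute) (rule Basis_le_norm[OF b])
      also have "\<dots> \<le> n * (6 * A * norm (\<theta> *\<^sub>R b))"
        using field_Lipschitz[OF f st, of "x + \<theta> *\<^sub>R b" x] by (simp add: n_def)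
      also have "\<dots> \<le> n * (6 * (A + 1) * \<tau>)"
        using \<theta> n A b by (intro mult_left_mono mult_mono) auto
      also have "\<dots> = \<kappa> / (2 * n)"
      proof -
        obtain a where a: "A + 1 = a" "a > 0" using A by force
        show ?thesis unfolding \<tau>_def a(1) using n a(2) by (simp add: field_simps)
      qed
      finally have "\<bar>b \<bullet> E x\<bar> \<le> \<kappa> / (2 * n) + \<kappa> / (2 * n)"
        using 1 by (simp add: inner_diff_right)
      also have "\<dots> = \<kappa> / n" using n by (simp add: field_simps)
      finally show "\<bar>b \<bullet> E x\<bar> \<le> \<kappa> / n" .
    qed
    then show "norm (E x) \<le> \<kappa>" using n by simp
  qed
qed


section \<open>Scattering in a decaying force field\<close>

text \<open>The weight \<open>w\<close> describes the decay and \<open>\<delta>\<close> the size of the force. One factor \<open>2 + t\<close> in the moment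
  condition pays for the time that a force has to displace a particle, the other one for the linear
  separation of free trajectories with different velocities.\<close>

locale decaying_force =
  fixes E :: "real \<Rightarrow> 'a::euclidean_space \<Rightarrow> 'a" and \<delta> :: real and w :: "real \<Rightarrow> real"
  assumes E_cont: "continuous_on UNIV (\<lambda>(t, x). E t x)"
    and E_bound: "\<And>t x. t \<ge> 0 \<Longrightarrow> norm (E t x) \<le> \<delta> * w t"
    and E_Lipschitz: "\<And>t x y. t \<ge> 0 \<Longrightarrow> norm (E t x - E t y) \<le> \<delta> * w t * norm (x - y)"
    and w_nonneg: "\<And>t. t \<ge> 0 \<Longrightarrow> 0 \<le> w t"
    and w_integrable: "integrable lborel (\<lambda>t. indicator {0..} t * ((2 + t)\<^sup>2 * w t))"
    and w_integral_le: "(LBINT t. indicator {0..} t * ((2 + t)\<^sup>2 * w t)) \<le> 1"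
    and \<delta>: "0 \<le> \<delta>" "\<delta> \<le> 1 / 2"
begin

definition force_integral :: "real set \<Rightarrow> (real \<Rightarrow> real) \<Rightarrow> (real \<Rightarrow> 'a) \<Rightarrow> 'a" where
  "force_integral S k z = (LBINT \<sigma>. indicator S \<sigma> *\<^sub>R (k \<sigma> *\<^sub>R E \<sigma> (z \<sigma>)))"

lemma continuous_force_along:
  assumes "continuous_on UNIV z"
  shows "continuous_on UNIV (\<lambda>\<sigma>. E \<sigma> (z \<sigma>))"
proof -
  have "continuous_on UNIV (\<lambda>\<sigma>. (\<sigma>, z \<sigma>))" by (intro continuous_intros assms)
  from continuous_on_compose2[OF E_cont this] show ?thesis by simp
qed

lemma w_moments:
  assumes [measurable]: "S \<in> sets borel" and S: "S \<subseteq> {0..}"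
  shows "integrable lborel (\<lambda>t. indicator S t * ((2 + t) * w t))"
    and "(LBINT t. indicator S t * ((2 + t) * w t)) \<le> 1"
proof -
  let ?g = "\<lambda>t. indicator {0..} t * ((2 + t)\<^sup>2 * w t)"
  have [measurable]: "?g \<in> borel_measurable borel" using w_integrable by auto
  have eq: "indicator S t * ((2 + t) * w t) = indicator S t * (?g t / (2 + t))" for t :: real
    using S by (auto simp: indicator_def power2_eq_square)
  have le: "0 \<le> indicator S t * ((2 + t) * w t)" "indicator S t * ((2 + t) * w t) \<le> ?g t" for t :: real
  proof -
    show "0 \<le> indicator S t * ((2 + t) * w t)"
      using S w_nonneg[of t] by (auto simp: indicator_def)
    show "indicator S t * ((2 + t) * w t) \<le> ?g t"
    proof (cases "t \<in> S")
      case True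
      then have t: "t \<ge> 0" using S by auto
      have "(2 + t) * w t * 1 \<le> (2 + t) * w t * (2 + t)"
        using t w_nonneg[OF t] by (intro mult_left_mono) auto
      then show ?thesis using True t by (simp add: power2_eq_square mult_ac)
    qed (use w_nonneg[of t] in \<open>auto simp: indicator_def\<close>)
  qed
  show i: "integrable lborel (\<lambda>t. indicator S t * ((2 + t) * w t))"
  proof (rule Bochner_Integration.integrable_bound[OF w_integrable])
    show "(\<lambda>t. indicator S t * ((2 + t) * w t)) \<in> borel_measurable lborel"
      unfolding eq by measurable
    show "AE t in lborel. norm (indicator S t * ((2 + t) * w t)) \<le> norm (?g t)"
    proof (rule AE_I2)
      fix t :: real
      show "norm (indicator S t * ((2 + t) * w t)) \<le> norm (?g t)"
        using le[of t] by (metis abs_ge_self abs_of_nonneg order_trans real_norm_def)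
    qed
  qed
  show "(LBINT t. indicator S t * ((2 + t) * w t)) \<le> 1"
    using integral_mono[OF i w_integrable le(2)] w_integral_le by linarith
qed

context
  fixes S :: "real set" and k :: "real \<Rightarrow> real"
  assumes S[measurable]: "S \<in> sets borel" and S0: "S \<subseteq> {0..}"
    and k[measurable]: "k \<in> borel_measurable borel" and k_le: "\<And>\<sigma>. \<sigma> \<ge> 0 \<Longrightarrow> \<bar>k \<sigma>\<bar> \<le> 2 + \<sigma>"
begin

lemma force_integrable:
  assumes z: "continuous_on UNIV z"
  shows "integrable lborel (\<lambda>\<sigma>. indicator S \<sigma> *\<^sub>R (k \<sigma> *\<^sub>R E \<sigma> (z \<sigma>)))"
    and "norm (force_integral S k z) \<le> \<delta> * (LBINT \<sigma>. indicator S \<sigma> * ((2 + \<sigma>) * w \<sigma>))"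
proof -
  have [measurable]: "(\<lambda>\<sigma>. E \<sigma> (z \<sigma>)) \<in> borel_measurable borel"
    by (intro borel_measurable_continuous_onI continuous_force_along z)
  have le: "norm (indicator S \<sigma> *\<^sub>R (k \<sigma> *\<^sub>R E \<sigma> (z \<sigma>))) \<le> \<delta> * (indicator S \<sigma> * ((2 + \<sigma>) * w \<sigma>))" for \<sigma>
  proof (cases "\<sigma> \<in> S")
    case True
    then have "\<sigma> \<ge> 0" using S0 by auto
    then have "\<bar>k \<sigma>\<bar> * norm (E \<sigma> (z \<sigma>)) \<le> (2 + \<sigma>) * (\<delta> * w \<sigma>)"
      by (intro mult_mono k_le E_bound) auto
    then show ?thesis using True by (simp add: mult_ac)
  qed simp
  have i: "integrable lborel (\<lambda>\<sigma>. \<delta> * (indicator S \<sigma> * ((2 + \<sigma>) * w \<sigma>)))"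
    by (intro integrable_mult_right w_moments S S0)
  show j: "integrable lborel (\<lambda>\<sigma>. indicator S \<sigma> *\<^sub>R (k \<sigma> *\<^sub>R E \<sigma> (z \<sigma>)))"
    by (rule Bochner_Integration.integrable_bound[OF i])
      (measurable, use order_trans[OF le abs_ge_self] in auto)
  show "norm (force_integral S k z) \<le> \<delta> * (LBINT \<sigma>. indicator S \<sigma> * ((2 + \<sigma>) * w \<sigma>))"
    using norm_integral_le_AE[OF i AE_I2[OF le]] by (simp add: force_integral_def)
qed

lemma force_integral_le:
  assumes z: "continuous_on UNIV z"
  shows "norm (force_integral S k z) \<le> \<delta>"
  using force_integrable(2)[OF z] mult_left_mono[OF w_moments(2)[OF S S0] \<delta>(1)] by simp

text \<open>The hypothesis admits a linear growth of the distance, as between two free trajectories.\<close>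

lemma force_integral_diff_le:
  assumes z: "continuous_on UNIV z1" "continuous_on UNIV z2"
    and D: "D \<ge> 0" "\<And>\<sigma>. \<sigma> \<ge> 0 \<Longrightarrow> norm (z1 \<sigma> - z2 \<sigma>) \<le> D * (2 + \<sigma>)"
  shows "norm (force_integral S k z1 - force_integral S k z2) \<le> \<delta> * D"
proof -
  note i1 = force_integrable(1)[OF z(1)] and i2 = force_integrable(1)[OF z(2)]
  let ?d = "\<lambda>\<sigma>. indicator S \<sigma> *\<^sub>R (k \<sigma> *\<^sub>R E \<sigma> (z1 \<sigma>)) - indicator S \<sigma> *\<^sub>R (k \<sigma> *\<^sub>R E \<sigma> (z2 \<sigma>))"
  have "norm (force_integral S k z1 - force_integral S k z2) = norm (LBINT \<sigma>. ?d \<sigma>)"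
    unfolding force_integral_def by (subst Bochner_Integration.integral_diff[OF i1 i2]) simp
  also have "\<dots> \<le> (LBINT \<sigma>. \<delta> * D * (indicator {0..} \<sigma> * ((2 + \<sigma>)\<^sup>2 * w \<sigma>)))"
  proof (rule norm_integral_le_AE[OF _ AE_I2])
    show "integrable lborel (\<lambda>\<sigma>. \<delta> * D * (indicator {0..} \<sigma> * ((2 + \<sigma>)\<^sup>2 * w \<sigma>)))"
      by (intro integrable_mult_right w_integrable)
    fix \<sigma> :: real
    show "norm (?d \<sigma>) \<le> \<delta> * D * (indicator {0..} \<sigma> * ((2 + \<sigma>)\<^sup>2 * w \<sigma>))"
    proof (cases "\<sigma> \<in> S")
      case True
      then have \<sigma>: "\<sigma> \<ge> 0" using S0 by auto
      have "norm (E \<sigma> (z1 \<sigma>) - E \<sigma> (z2 \<sigma>)) \<le> \<delta> * w \<sigma> * norm (z1 \<sigma> - z2 \<sigma>)"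
        by (rule E_Lipschitz[OF \<sigma>])
      also have "\<dots> \<le> \<delta> * w \<sigma> * (D * (2 + \<sigma>))"
        using \<delta>(1) w_nonneg[OF \<sigma>] by (intro mult_left_mono D(2) \<sigma>) auto
      finally have "\<bar>k \<sigma>\<bar> * norm (E \<sigma> (z1 \<sigma>) - E \<sigma> (z2 \<sigma>)) \<le> (2 + \<sigma>) * (\<delta> * w \<sigma> * (D * (2 + \<sigma>)))"
        using \<sigma> by (intro mult_mono k_le) auto
      also have "\<dots> = \<delta> * D * ((2 + \<sigma>)\<^sup>2 * w \<sigma>)" by (simp add: power2_eq_square mult_ac)
      finally show ?thesis using True \<sigma> by (simp flip: scaleR_diff_right)
    qed (use \<delta>(1) D(1) w_nonneg in \<open>auto simp: indicator_def\<close>)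
  qed
  also have "\<dots> \<le> \<delta> * D"
    using mult_left_mono[OF w_integral_le, of "\<delta> * D"] \<delta>(1) D(1) by simp
  finally show ?thesis .
qed

end

text \<open>The deviation \<open>y\<close> from the free trajectory \<open>x + s v\<close> solves
  \<open>y(s) = \<integral> (\<sigma> - s)\<^sub>+ E(\<sigma>, x + \<sigma> v + y(\<sigma>)) d\<sigma>\<close>. With \<open>\<sigma>\<close> in \<open>[0, T]\<close> this is the trajectory which
  agrees with the free one at time \<open>T\<close>; with \<open>\<sigma>\<close> in \<open>[0, \<infinity>)\<close> it is the one which does so
  asymptotically. Both cases are instances of one contraction, and this makes them comparable.\<close>

definition elapsed :: "real \<Rightarrow> real \<Rightarrow> real" where
  "elapsed s \<sigma> = max (\<sigma> - max s 0) 0"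

lemma elapsed_measurable[measurable]: "elapsed s \<in> borel_measurable borel"
  unfolding elapsed_def[abs_def] by measurable

lemma elapsed_le: "\<sigma> \<ge> 0 \<Longrightarrow> \<bar>elapsed s \<sigma>\<bar> \<le> 2 + \<sigma>"
  by (auto simp: elapsed_def)

lemma ex_deviation:
  assumes S[measurable]: "S \<in> sets borel" and S0: "S \<subseteq> {0..}"
  shows "\<exists>y::real \<Rightarrow>\<^sub>C 'a. \<forall>s. y s = force_integral S (elapsed s) (\<lambda>\<sigma>. x + \<sigma> *\<^sub>R v + y \<sigma>)"
proof -
  define F where "F y s = force_integral S (elapsed s) (\<lambda>\<sigma>. x + \<sigma> *\<^sub>R v + apply_bcontfun y \<sigma>)" for y s
  have z: "continuous_on UNIV (\<lambda>\<sigma>. x + \<sigma> *\<^sub>R v + apply_bcontfun y \<sigma>)" for y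
    by (intro continuous_intros) auto
  have Lip: "norm (F y s - F y t) \<le> \<delta> * \<bar>s - t\<bar>" for y s t
  proof -
    have i: "integrable lborel (\<lambda>\<sigma>. indicator S \<sigma> *\<^sub>R (elapsed s \<sigma> *\<^sub>R E \<sigma> (x + \<sigma> *\<^sub>R v + apply_bcontfun y \<sigma>)))" for s
      by (rule force_integrable(1)[OF S S0 elapsed_measurable elapsed_le z])
    let ?E = "\<lambda>\<sigma>. E \<sigma> (x + \<sigma> *\<^sub>R v + apply_bcontfun y \<sigma>)"
    have "norm (F y s - F y t) = norm (LBINT \<sigma>. indicator S \<sigma> *\<^sub>R (elapsed s \<sigma> *\<^sub>R ?E \<sigma>) -
        indicator S \<sigma> *\<^sub>R (elapsed t \<sigma> *\<^sub>R ?E \<sigma>))"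
      unfolding F_def force_integral_def by (subst Bochner_Integration.integral_diff[OF i i]) simp
    also have "\<dots> \<le> (LBINT \<sigma>. \<bar>s - t\<bar> * \<delta> * (indicator S \<sigma> * ((2 + \<sigma>) * w \<sigma>)))"
    proof (rule norm_integral_le_AE[OF _ AE_I2])
      show "integrable lborel (\<lambda>\<sigma>. \<bar>s - t\<bar> * \<delta> * (indicator S \<sigma> * ((2 + \<sigma>) * w \<sigma>)))"
        by (intro integrable_mult_right w_moments S S0)
      fix \<sigma> :: real
      show "norm (indicator S \<sigma> *\<^sub>R (elapsed s \<sigma> *\<^sub>R ?E \<sigma>) - indicator S \<sigma> *\<^sub>R (elapsed t \<sigma> *\<^sub>R ?E \<sigma>))
        \<le> \<bar>s - t\<bar> * \<delta> * (indicator S \<sigma> * ((2 + \<sigma>) * w \<sigma>))"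
      proof (cases "\<sigma> \<in> S")
        case True
        then have \<sigma>: "\<sigma> \<ge> 0" using S0 by auto
        have "\<bar>elapsed s \<sigma> - elapsed t \<sigma>\<bar> * norm (?E \<sigma>) \<le> \<bar>s - t\<bar> * (\<delta> * w \<sigma>)"
          by (intro mult_mono E_bound \<sigma>) (auto simp: elapsed_def)
        also have "\<dots> \<le> \<bar>s - t\<bar> * (\<delta> * ((2 + \<sigma>) * w \<sigma>))"
          using \<sigma> w_nonneg[OF \<sigma>] \<delta>(1) by (intro mult_left_mono mult_le_cancel_right1[THEN iffD2]) auto
        finally show ?thesis using True by (simp flip: scaleR_diff_left add: mult_ac)
      qed simp
    qed
    also have "\<dots> \<le> \<bar>s - t\<bar> * \<delta> * 1"
      using mult_left_mono[OF w_moments(2)[OF S S0], of "\<bar>s - t\<bar> * \<delta>"] \<delta>(1) by simp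
    finally show ?thesis by (simp add: mult_ac)
  qed
  have bc: "F y \<in> bcontfun" for y
  proof (rule bcontfun_normI)
    have "\<delta>-lipschitz_on UNIV (F y)"
      using Lip \<delta>(1) by (intro lipschitz_onI) (auto simp: dist_norm)
    then show "continuous_on UNIV (F y)" by (rule lipschitz_on_continuous_on)
    show "norm (F y s) \<le> \<delta>" for s
      unfolding F_def by (rule force_integral_le[OF S S0 elapsed_measurable elapsed_le z])
  qed
  have "\<exists>!y. Bcontfun (F y) = y"
  proof (rule banach_fix_type)
    show "\<forall>y1 y2. dist (Bcontfun (F y1)) (Bcontfun (F y2)) \<le> 1 / 2 * dist y1 y2"
    proof (intro allI dist_bound)
      fix y1 y2 :: "real \<Rightarrow>\<^sub>C 'a" and s
      have "norm (F y1 s - F y2 s) \<le> \<delta> * dist y1 y2"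
        unfolding F_def
      proof (rule force_integral_diff_le[OF S S0 elapsed_measurable elapsed_le z z])
        fix \<sigma> :: real assume "\<sigma> \<ge> 0"
        have "norm (y1 \<sigma> - y2 \<sigma>) \<le> dist y1 y2 * 1"
          using dist_bounded[of y1 \<sigma> y2] by (simp add: dist_norm)
        also have "\<dots> \<le> dist y1 y2 * (2 + \<sigma>)" using \<open>\<sigma> \<ge> 0\<close> by (intro mult_left_mono) auto
        finally show "norm (x + \<sigma> *\<^sub>R v + y1 \<sigma> - (x + \<sigma> *\<^sub>R v + y2 \<sigma>)) \<le> dist y1 y2 * (2 + \<sigma>)"
          by simp
      qed auto
      also have "\<dots> \<le> 1 / 2 * dist y1 y2" using \<delta>(2) by (intro mult_right_mono) auto
      finally show "dist (Bcontfun (F y1) s) (Bcontfun (F y2) s) \<le> 1 / 2 * dist y1 y2"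
        by (simp add: dist_norm Bcontfun_inverse bc)
    qed
  qed auto
  then obtain y where "Bcontfun (F y) = y" by blast
  then have "apply_bcontfun y s = F y s" for s
    using Bcontfun_inverse[OF bc[of y]] by metis
  then show ?thesis unfolding F_def by blast
qed

definition deviation :: "real set \<Rightarrow> 'a \<Rightarrow> 'a \<Rightarrow> real \<Rightarrow>\<^sub>C 'a" where
  "deviation S x v = (SOME y. \<forall>s. apply_bcontfun y s =
     force_integral S (elapsed s) (\<lambda>\<sigma>. x + \<sigma> *\<^sub>R v + apply_bcontfun y \<sigma>))"

abbreviation trajectory :: "real set \<Rightarrow> 'a \<Rightarrow> 'a \<Rightarrow> real \<Rightarrow> 'a" where
  "trajectory S x v \<sigma> \<equiv> x + \<sigma> *\<^sub>R v + apply_bcontfun (deviation S x v) \<sigma>"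

text \<open>The starting point \<open>(X(0), V(0))\<close> of the trajectory, relative to \<open>(x, v)\<close>.\<close>

definition position_shift :: "real set \<Rightarrow> 'a \<Rightarrow> 'a \<Rightarrow> 'a" where
  "position_shift S x v = force_integral S (\<lambda>\<sigma>. \<sigma>) (trajectory S x v)"

definition velocity_shift :: "real set \<Rightarrow> 'a \<Rightarrow> 'a \<Rightarrow> 'a" where
  "velocity_shift S x v = - force_integral S (\<lambda>_. 1) (trajectory S x v)"

context
  fixes S :: "real set"
  assumes S[measurable]: "S \<in> sets borel" and S0: "S \<subseteq> {0..}"
begin

lemma deviation_eq:
  "apply_bcontfun (deviation S x v) s = force_integral S (elapsed s) (trajectory S x v)"
  using someI_ex[OF ex_deviation[OF S S0, of x v]] unfolding deviation_def by blast

lemma continuous_trajectory: "continuous_on UNIV (trajectory S x v)"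
  by (intro continuous_intros) auto

lemma position_shift_eq: "position_shift S x v = apply_bcontfun (deviation S x v) 0"
  unfolding deviation_eq[of x v 0] position_shift_def force_integral_def
  using S0 by (intro Bochner_Integration.integral_cong) (auto simp: indicator_def elapsed_def)

lemma position_shift_le: "norm (position_shift S x v) \<le> \<delta>"
  unfolding position_shift_def
  by (rule force_integral_le[OF S S0 _ _ continuous_trajectory]) auto

lemma velocity_shift_le: "norm (velocity_shift S x v) \<le> \<delta>"
  unfolding velocity_shift_def norm_minus_cancel
  by (rule force_integral_le[OF S S0 _ _ continuous_trajectory]) auto

lemma trajectory_diff_le:
  assumes "\<sigma> \<ge> 0"
  shows "norm (trajectory S x v \<sigma> - trajectory S x' v' \<sigma>) \<le>
    (norm (x - x') + norm (v - v') + dist (deviation S x v) (deviation S x' v')) * (2 + \<sigma>)"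
proof -
  let ?D = "dist (deviation S x v) (deviation S x' v')"
  have "trajectory S x v \<sigma> - trajectory S x' v' \<sigma> = (x - x') + \<sigma> *\<^sub>R (v - v') +
      (apply_bcontfun (deviation S x v) \<sigma> - apply_bcontfun (deviation S x' v') \<sigma>)"
    by (simp add: algebra_simps)
  also have "norm \<dots> \<le> norm (x - x') + norm (\<sigma> *\<^sub>R (v - v')) + ?D"
    by (intro order_trans[OF norm_triangle_ineq] add_mono norm_triangle_ineq)
      (use dist_bounded[of "deviation S x v" \<sigma> "deviation S x' v'"] in \<open>simp add: dist_norm\<close>)
  also have "\<dots> \<le> norm (x - x') * (2 + \<sigma>) + norm (v - v') * (2 + \<sigma>) + ?D * (2 + \<sigma>)"
    using assms mult_left_mono[of 1 "2 + \<sigma>" "norm (x - x')"] mult_left_mono[of 1 "2 + \<sigma>" ?D]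
      mult_left_mono[of \<sigma> "2 + \<sigma>" "norm (v - v')"]
    by (intro add_mono) (simp_all add: mult.commute[of \<sigma>])
  finally show ?thesis by (simp add: distrib_right)
qed

text \<open>The distance reappears on the right with a factor \<open>\<delta> \<le> 1 / 2\<close> and is absorbed.\<close>

lemma dist_deviation_le:
  "dist (deviation S x v) (deviation S x' v') \<le> norm (x - x') + norm (v - v')"
proof -
  let ?D = "dist (deviation S x v) (deviation S x' v')"
  have "?D \<le> \<delta> * (norm (x - x') + norm (v - v') + ?D)"
  proof (rule dist_bound)
    fix s
    show "dist (deviation S x v s) (deviation S x' v' s) \<le> \<delta> * (norm (x - x') + norm (v - v') + ?D)"
      unfolding deviation_eq[of x v s] deviation_eq[of x' v' s]
      by (subst dist_norm, rule force_integral_diff_le[OF S S0 elapsed_measurable elapsed_le continuous_trajectory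
            continuous_trajectory]) (auto intro: trajectory_diff_le)
  qed
  also have "\<dots> \<le> 1 / 2 * (norm (x - x') + norm (v - v') + ?D)"
    using \<delta>(2) by (intro mult_right_mono) auto
  finally show ?thesis by simp
qed

lemma shift_Lipschitz:
  "norm (position_shift S x v - position_shift S x' v') \<le> norm (x - x') + norm (v - v')"
  "norm (velocity_shift S x v - velocity_shift S x' v') \<le> norm (x - x') + norm (v - v')"
proof -
  let ?d = "norm (x - x') + norm (v - v')"
  have "norm (force_integral S k (trajectory S x v) - force_integral S k (trajectory S x' v')) \<le> ?d"
    if [measurable]: "k \<in> borel_measurable borel" and "\<And>\<sigma>. \<sigma> \<ge> 0 \<Longrightarrow> \<bar>k \<sigma>\<bar> \<le> 2 + \<sigma>" for k
  proof -
    have "norm (force_integral S k (trajectory S x v) - force_integral S k (trajectory S x' v')) \<le>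
        \<delta> * (?d + dist (deviation S x v) (deviation S x' v'))"
      by (rule force_integral_diff_le[OF S S0 that continuous_trajectory continuous_trajectory])
        (auto intro: trajectory_diff_le)
    also have "\<dots> \<le> 1 / 2 * (?d + ?d)"
      using \<delta> by (intro mult_mono add_left_mono dist_deviation_le) auto
    finally show ?thesis by simp
  qed
  from this[of "\<lambda>\<sigma>. \<sigma>"] this[of "\<lambda>_. 1"]
  show "norm (position_shift S x v - position_shift S x' v') \<le> ?d"
    "norm (velocity_shift S x v - velocity_shift S x' v') \<le> ?d"
    by (auto simp: position_shift_def velocity_shift_def norm_minus_commute)
qed

end

definition tail :: "real \<Rightarrow> real" where
  "tail T = (LBINT \<sigma>. indicator {T<..} \<sigma> * ((2 + \<sigma>) * w \<sigma>))"

text \<open>Cutting the force off at time \<open>T\<close> changes every force integral by at most the tail of the weight,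
  and the contraction turns this into the same rate for the trajectories.\<close>

lemma force_integral_cutoff_le:
  assumes T: "T \<ge> 0" and k[measurable]: "k \<in> borel_measurable borel"
    and k_le: "\<And>\<sigma>. \<sigma> \<ge> 0 \<Longrightarrow> \<bar>k \<sigma>\<bar> \<le> 2 + \<sigma>" and z: "continuous_on UNIV z"
  shows "norm (force_integral {0..T} k z - force_integral {0..} k z) \<le> \<delta> * tail T"
proof -
  have sub: "{0..T} \<subseteq> {0..}" "{0..} \<subseteq> {0::real..}" "{T<..} \<subseteq> {0..}" using T by auto
  note i = force_integrable(1)[OF _ sub(1) k k_le z] and j = force_integrable(1)[OF _ sub(3) k k_le z]
  have "force_integral {0..} k z = (LBINT \<sigma>. indicator {0..T} \<sigma> *\<^sub>R (k \<sigma> *\<^sub>R E \<sigma> (z \<sigma>)) +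
      indicator {T<..} \<sigma> *\<^sub>R (k \<sigma> *\<^sub>R E \<sigma> (z \<sigma>)))"
    unfolding force_integral_def using T
    by (intro Bochner_Integration.integral_cong) (auto simp: indicator_def)
  also have "\<dots> = force_integral {0..T} k z + force_integral {T<..} k z"
    unfolding force_integral_def by (rule Bochner_Integration.integral_add; (rule i j, simp))
  finally have "norm (force_integral {0..T} k z - force_integral {0..} k z) = norm (force_integral {T<..} k z)"
    by simp
  also have "\<dots> \<le> \<delta> * tail T"
    unfolding tail_def by (rule force_integrable(2)[OF _ sub(3) k k_le z]) simp_all
  finally show ?thesis .
qed

lemma tail_nonneg: "T \<ge> 0 \<Longrightarrow> 0 \<le> tail T"
  unfolding tail_def using w_nonneg
  by (intro Bochner_Integration.integral_nonneg) (auto simp: indicator_def)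

lemma dist_deviation_cutoff_le:
  assumes T: "T \<ge> 0"
  shows "dist (deviation {0..T} x v) (deviation {0..} x v) \<le> tail T"
proof -
  have S: "{0..T} \<in> sets borel" "{0..T} \<subseteq> {0..}" "{0::real..} \<in> sets borel" "{0..} \<subseteq> {0::real..}" by auto
  let ?D = "dist (deviation {0..T} x v) (deviation {0..} x v)"
  have "?D \<le> \<delta> * ?D + \<delta> * tail T"
  proof (rule dist_bound)
    fix s
    have 1: "norm (force_integral {0..T} (elapsed s) (trajectory {0..T} x v) -
        force_integral {0..T} (elapsed s) (trajectory {0..} x v)) \<le> \<delta> * ?D"
    proof (rule force_integral_diff_le[OF S(1,2) elapsed_measurable elapsed_le continuous_trajectory[OF S(1,2)]
          continuous_trajectory[OF S(3,4)]])
      fix \<sigma> :: real assume \<sigma>: "\<sigma> \<ge> 0"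
      have "norm (trajectory {0..T} x v \<sigma> - trajectory {0..} x v \<sigma>) \<le> ?D * 1"
        using dist_bounded[of "deviation {0..T} x v" \<sigma> "deviation {0..} x v"] by (simp add: dist_norm)
      also have "\<dots> \<le> ?D * (2 + \<sigma>)" using \<sigma> by (intro mult_left_mono) auto
      finally show "norm (trajectory {0..T} x v \<sigma> - trajectory {0..} x v \<sigma>) \<le> ?D * (2 + \<sigma>)" .
    qed auto
    have 2: "norm (force_integral {0..T} (elapsed s) (trajectory {0..} x v) -
        force_integral {0..} (elapsed s) (trajectory {0..} x v)) \<le> \<delta> * tail T"
      by (rule force_integral_cutoff_le[OF T elapsed_measurable elapsed_le continuous_trajectory[OF S(3,4)]])
    show "dist (deviation {0..T} x v s) (deviation {0..} x v s) \<le> \<delta> * ?D + \<delta> * tail T"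
      unfolding deviation_eq[OF S(1,2), of x v s] deviation_eq[OF S(3,4), of x v s]
      by (subst dist_norm) (rule norm_diff_triangle_le[OF 1 2])
  qed
  also have "\<dots> \<le> 1 / 2 * ?D + 1 / 2 * tail T"
    using \<delta>(2) tail_nonneg[OF T] by (intro add_mono mult_right_mono) auto
  finally show ?thesis by simp
qed

lemma shift_cutoff_le:
  assumes T: "T \<ge> 0"
  shows "norm (position_shift {0..T} x v - position_shift {0..} x v) \<le> 2 * \<delta> * tail T"
    "norm (velocity_shift {0..T} x v - velocity_shift {0..} x v) \<le> 2 * \<delta> * tail T"
proof -
  have S: "{0..T} \<in> sets borel" "{0..T} \<subseteq> {0..}" "{0::real..} \<in> sets borel" "{0..} \<subseteq> {0::real..}" by auto
  have "norm (force_integral {0..T} k (trajectory {0..T} x v) - force_integral {0..} k (trajectory {0..} x v))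
      \<le> \<delta> * tail T + \<delta> * tail T"
    if k: "k \<in> borel_measurable borel" "\<And>\<sigma>. \<sigma> \<ge> 0 \<Longrightarrow> \<bar>k \<sigma>\<bar> \<le> 2 + \<sigma>" for k
  proof (rule norm_diff_triangle_le)
    show "norm (force_integral {0..T} k (trajectory {0..T} x v) -
        force_integral {0..T} k (trajectory {0..} x v)) \<le> \<delta> * tail T"
    proof (rule force_integral_diff_le[OF S(1,2) k continuous_trajectory[OF S(1,2)]
          continuous_trajectory[OF S(3,4)]])
      fix \<sigma> :: real assume \<sigma>: "\<sigma> \<ge> 0"
      have "norm (trajectory {0..T} x v \<sigma> - trajectory {0..} x v \<sigma>) \<le> dist (deviation {0..T} x v) (deviation {0..} x v)"
        using dist_bounded[of "deviation {0..T} x v" \<sigma> "deviation {0..} x v"] by (simp add: dist_norm)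
      also have "\<dots> \<le> tail T * 1" using dist_deviation_cutoff_le[OF T] by simp
      also have "\<dots> \<le> tail T * (2 + \<sigma>)" using \<sigma> tail_nonneg[OF T] by (intro mult_left_mono) auto
      finally show "norm (trajectory {0..T} x v \<sigma> - trajectory {0..} x v \<sigma>) \<le> tail T * (2 + \<sigma>)" .
    qed (use tail_nonneg[OF T] in auto)
    show "norm (force_integral {0..T} k (trajectory {0..} x v) - force_integral {0..} k (trajectory {0..} x v))
        \<le> \<delta> * tail T"
      by (rule force_integral_cutoff_le[OF T k continuous_trajectory[OF S(3,4)]])
  qed
  from this[of "\<lambda>\<sigma>. \<sigma>"] this[of "\<lambda>_. 1"]
  show "norm (position_shift {0..T} x v - position_shift {0..} x v) \<le> 2 * \<delta> * tail T"
    "norm (velocity_shift {0..T} x v - velocity_shift {0..} x v) \<le> 2 * \<delta> * tail T"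
    by (auto simp: position_shift_def velocity_shift_def norm_minus_commute)
qed

text \<open>The derivative of the deviation, which is \<open>- \<integral> E d\<sigma>\<close> over \<open>[s, T]\<close>. Integrals starting at 0 are the form in
  which the fundamental theorem of calculus applies.\<close>

definition velocity_deviation :: "real \<Rightarrow> 'a \<Rightarrow> 'a \<Rightarrow> real \<Rightarrow> 'a" where
  "velocity_deviation T x v s =
     integral {0..s} (\<lambda>\<sigma>. E \<sigma> (trajectory {0..T} x v \<sigma>)) - integral {0..T} (\<lambda>\<sigma>. E \<sigma> (trajectory {0..T} x v \<sigma>))"

context
  fixes T :: real and x v :: 'a
  assumes T: "T \<ge> 0"
begin

lemma force_continuous: "continuous_on UNIV (\<lambda>\<sigma>. E \<sigma> (trajectory {0..T} x v \<sigma>))"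
  by (intro continuous_force_along continuous_trajectory) auto

lemma deviation_eq_integral:
  assumes s: "s \<in> {0..T}"
  shows "deviation {0..T} x v s =
    (integral {0..T} (\<lambda>\<sigma>. \<sigma> *\<^sub>R E \<sigma> (trajectory {0..T} x v \<sigma>)) - integral {0..s} (\<lambda>\<sigma>. \<sigma> *\<^sub>R E \<sigma> (trajectory {0..T} x v \<sigma>)))
    + s *\<^sub>R velocity_deviation T x v s"
proof -
  let ?e = "\<lambda>\<sigma>. E \<sigma> (trajectory {0..T} x v \<sigma>)"
  have e: "continuous_on A ?e" for A
    using force_continuous continuous_on_subset by blast
  have split: "integral {s..T} f = integral {0..T} f - integral {0..s} f"
    if "continuous_on {0..T} f" for f :: "real \<Rightarrow> 'a"
  proof -
    have "integral {0..s} f + integral {s..T} f = integral {0..T} f"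
      using s that by (intro Henstock_Kurzweil_Integration.integral_combine integrable_continuous_real) auto
    then show ?thesis by (metis add_diff_cancel_left')
  qed
  have "deviation {0..T} x v s = force_integral {0..T} (elapsed s) (trajectory {0..T} x v)"
    by (rule deviation_eq) auto
  also have "\<dots> = (LINT \<sigma>:{s..T}|lborel. (\<sigma> - s) *\<^sub>R ?e \<sigma>)"
    unfolding force_integral_def set_lebesgue_integral_def using s
    by (intro Bochner_Integration.integral_cong) (auto simp: indicator_def elapsed_def)
  also have "\<dots> = integral {s..T} (\<lambda>\<sigma>. (\<sigma> - s) *\<^sub>R ?e \<sigma>)"
    by (intro set_borel_integral_eq_integral borel_integrable_atLeastAtMost' continuous_intros e)
  also have "\<dots> = integral {s..T} (\<lambda>\<sigma>. \<sigma> *\<^sub>R ?e \<sigma>) - s *\<^sub>R integral {s..T} ?e"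
    unfolding scaleR_diff_left
    by (subst integral_diff) (auto intro!: integrable_continuous_real continuous_intros e)
  also have "integral {s..T} (\<lambda>\<sigma>. \<sigma> *\<^sub>R ?e \<sigma>) =
      integral {0..T} (\<lambda>\<sigma>. \<sigma> *\<^sub>R ?e \<sigma>) - integral {0..s} (\<lambda>\<sigma>. \<sigma> *\<^sub>R ?e \<sigma>)"
    by (intro split continuous_intros e)
  also have "integral {s..T} ?e = - velocity_deviation T x v s"
    unfolding split[OF e] by (simp add: velocity_deviation_def)
  finally show ?thesis by simp
qed

lemma velocity_deviation_has_derivative:
  assumes s: "s \<in> {0..T}"
  shows "(velocity_deviation T x v has_vector_derivative E s (trajectory {0..T} x v s)) (at s within {0..T})"
proof -
  have "continuous_on {0..T} (\<lambda>\<sigma>. E \<sigma> (trajectory {0..T} x v \<sigma>))"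
    using force_continuous continuous_on_subset by blast
  from has_vector_derivative_diff[OF integral_has_vector_derivative[OF this s] has_vector_derivative_const]
  show ?thesis by (simp add: velocity_deviation_def[abs_def])
qed

lemma deviation_has_derivative:
  assumes s: "s \<in> {0..T}"
  shows "(deviation {0..T} x v has_vector_derivative velocity_deviation T x v s) (at s within {0..T})"
proof -
  let ?e = "\<lambda>\<sigma>. E \<sigma> (trajectory {0..T} x v \<sigma>)"
  have "continuous_on {0..T} (\<lambda>\<sigma>. \<sigma> *\<^sub>R ?e \<sigma>)"
    by (intro continuous_intros) (use force_continuous continuous_on_subset in blast)
  note d1 = integral_has_vector_derivative[OF this s]
  have id: "((\<lambda>s. s) has_real_derivative 1) (at s within {0..T})"
    by (auto intro!: derivative_eq_intros)
  have "((\<lambda>s. (integral {0..T} (\<lambda>\<sigma>. \<sigma> *\<^sub>R ?e \<sigma>) - integral {0..s} (\<lambda>\<sigma>. \<sigma> *\<^sub>R ?e \<sigma>))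
      + s *\<^sub>R velocity_deviation T x v s) has_vector_derivative
      (0 - s *\<^sub>R ?e s) + (s *\<^sub>R ?e s + 1 *\<^sub>R velocity_deviation T x v s)) (at s within {0..T})"
    by (intro has_vector_derivative_add has_vector_derivative_diff has_vector_derivative_const d1
        has_vector_derivative_scaleR id velocity_deviation_has_derivative s)
  then have "((\<lambda>s. (integral {0..T} (\<lambda>\<sigma>. \<sigma> *\<^sub>R ?e \<sigma>) - integral {0..s} (\<lambda>\<sigma>. \<sigma> *\<^sub>R ?e \<sigma>))
      + s *\<^sub>R velocity_deviation T x v s) has_vector_derivative velocity_deviation T x v s) (at s within {0..T})"
    by simp
  then show ?thesis
    by (rule has_vector_derivative_transform[OF s, rotated]) (rule deviation_eq_integral)
qed

lemma deviation_end: "deviation {0..T} x v T = 0" "velocity_deviation T x v T = 0"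
  using deviation_eq_integral[of T] T by (auto simp: velocity_deviation_def)

lemma velocity_deviation_0: "velocity_deviation T x v 0 = velocity_shift {0..T} x v"
proof -
  have "velocity_shift {0..T} x v = - (LINT \<sigma>:{0..T}|lborel. E \<sigma> (trajectory {0..T} x v \<sigma>))"
    by (simp add: velocity_shift_def force_integral_def set_lebesgue_integral_def)
  also have "(LINT \<sigma>:{0..T}|lborel. E \<sigma> (trajectory {0..T} x v \<sigma>)) = integral {0..T} (\<lambda>\<sigma>. E \<sigma> (trajectory {0..T} x v \<sigma>))"
    by (intro set_borel_integral_eq_integral borel_integrable_atLeastAtMost')
      (use force_continuous continuous_on_subset in blast)
  finally show ?thesis by (simp add: velocity_deviation_def)
qed

text \<open>The characteristic through \<open>(x + T v, v)\<close> at time \<open>T\<close> starts at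
  \<open>(x + position_shift, v + velocity_shift)\<close>.\<close>

lemma transported_along_characteristics:
  fixes G :: "real \<Rightarrow> 'a \<times> 'a \<Rightarrow> real"
  assumes G: "\<And>t x v. t \<ge> 0 \<Longrightarrow> ((\<lambda>(t, z). G t z) has_derivative
        (\<lambda>(\<tau>, y, u). \<tau> * Gt t (x, v) + y \<bullet> Gx t (x, v) + u \<bullet> Gv t (x, v))) (at (t, x, v) within {0..} \<times> UNIV)"
    and transport: "\<And>t x v. t \<ge> 0 \<Longrightarrow> Gt t (x, v) + v \<bullet> Gx t (x, v) + E t x \<bullet> Gv t (x, v) = 0"
  shows "G T (x + T *\<^sub>R v, v) = G 0 (x + position_shift {0..T} x v, v + velocity_shift {0..T} x v)"
proof -
  let ?X = "trajectory {0..T} x v" and ?V = "\<lambda>s. v + velocity_deviation T x v s"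
  let ?c = "\<lambda>s. (s, ?X s, ?V s)"
  have "((\<lambda>s. case ?c s of (t, z) \<Rightarrow> G t z) has_derivative (\<lambda>h. 0)) (at s within {0..T})" if s: "s \<in> {0..T}" for s
  proof -
    have X: "(?X has_derivative (\<lambda>h. h *\<^sub>R ?V s)) (at s within {0..T})"
      using deviation_has_derivative[OF s] unfolding has_vector_derivative_def
      by (auto intro!: derivative_eq_intros simp: algebra_simps)
    have V: "(?V has_derivative (\<lambda>h. h *\<^sub>R E s (?X s))) (at s within {0..T})"
      using velocity_deviation_has_derivative[OF s] unfolding has_vector_derivative_def
      by (auto intro!: derivative_eq_intros)
    have c: "(?c has_derivative (\<lambda>h. (h, h *\<^sub>R ?V s, h *\<^sub>R E s (?X s)))) (at s within {0..T})"
      by (intro has_derivative_Pair X V has_derivative_ident)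
    have "((\<lambda>s. (\<lambda>(t, z). G t z) (?c s)) has_derivative
        (\<lambda>h. (\<lambda>(\<tau>, y, u). \<tau> * Gt s (?X s, ?V s) + y \<bullet> Gx s (?X s, ?V s) + u \<bullet> Gv s (?X s, ?V s))
          (h, h *\<^sub>R ?V s, h *\<^sub>R E s (?X s)))) (at s within {0..T})"
    proof (rule has_derivative_in_compose[OF c])
      show "((\<lambda>(t, z). G t z) has_derivative
          (\<lambda>(\<tau>, y, u). \<tau> * Gt s (?X s, ?V s) + y \<bullet> Gx s (?X s, ?V s) + u \<bullet> Gv s (?X s, ?V s)))
          (at (?c s) within ?c ` {0..T})"
        by (rule has_derivative_subset[OF G]) (use s in auto)
    qed
    moreover have "(\<lambda>(\<tau>, y, u). \<tau> * Gt s (?X s, ?V s) + y \<bullet> Gx s (?X s, ?V s) + u \<bullet> Gv s (?X s, ?V s))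
          (h, h *\<^sub>R ?V s, h *\<^sub>R E s (?X s)) = 0" for h
    proof -
      have "(\<lambda>(\<tau>, y, u). \<tau> * Gt s (?X s, ?V s) + y \<bullet> Gx s (?X s, ?V s) + u \<bullet> Gv s (?X s, ?V s))
          (h, h *\<^sub>R ?V s, h *\<^sub>R E s (?X s)) =
          h * (Gt s (?X s, ?V s) + ?V s \<bullet> Gx s (?X s, ?V s) + E s (?X s) \<bullet> Gv s (?X s, ?V s))"
        by (simp add: distrib_left)
      also have "\<dots> = 0" using transport[of s "?X s" "?V s"] s by simp
      finally show ?thesis .
    qed
    ultimately show ?thesis by simp
  qed
  then obtain c where c: "\<And>s. s \<in> {0..T} \<Longrightarrow> (case ?c s of (t, z) \<Rightarrow> G t z) = c"
    using has_derivative_zero_constant[of "{0..T}" "\<lambda>s. case ?c s of (t, z) \<Rightarrow> G t z"] by auto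
  have "G T (?X T, ?V T) = G 0 (?X 0, ?V 0)" using c[of T] c[of 0] T by simp
  moreover have "position_shift {0..T} x v = deviation {0..T} x v 0"
    by (rule position_shift_eq) auto
  ultimately show ?thesis
    by (simp add: deviation_end velocity_deviation_0)
qed

end

end


section \<open>Lipschitz functions have bounded weak derivatives\<close>

lemma convergent_if_approximable:
  fixes c :: "nat \<Rightarrow> real"
  assumes "\<And>e. e > 0 \<Longrightarrow> \<exists>d. convergent d \<and> (\<forall>n. \<bar>c n - d n\<bar> \<le> e)"
  shows "convergent c"
proof (rule Cauchy_convergent, rule metric_CauchyI)
  fix e :: real assume "e > 0"
  then obtain d where d: "convergent d" "\<And>n. \<bar>c n - d n\<bar> \<le> e / 4" using assms[of "e / 4"] by auto
  obtain M where M: "\<And>m n. m \<ge> M \<Longrightarrow> n \<ge> M \<Longrightarrow> dist (d m) (d n) < e / 4"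
    using metric_CauchyD[OF convergent_Cauchy[OF d(1)], of "e / 4"] \<open>e > 0\<close> by auto
  show "\<exists>M. \<forall>m\<ge>M. \<forall>n\<ge>M. dist (c m) (c n) < e"
  proof (intro exI allI impI)
    fix m n assume "m \<ge> M" "n \<ge> M"
    then show "dist (c m) (c n) < e"
      using M[of m n] d(2)[of m] d(2)[of n] \<open>e > 0\<close> unfolding dist_real_def by linarith
  qed
qed

locale bounded_sequence =
  fixes q :: "nat \<Rightarrow> 'a::euclidean_space \<Rightarrow> real" and L :: real
  assumes q_measurable[measurable]: "\<And>n. q n \<in> borel_measurable borel"
    and q_le: "\<And>n x. \<bar>q n x\<bar> \<le> L"
begin

lemma L_nonneg: "0 \<le> L" using q_le[of 0 undefined] by linarith

lemma integrable_mult_q: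
  assumes "integrable lborel u"
  shows "integrable lborel (\<lambda>x. u x * q n x)"
proof (rule Bochner_Integration.integrable_bound)
  show "integrable lborel (\<lambda>x. L * u x)" using assms by simp
  show "(\<lambda>x. u x * q n x) \<in> borel_measurable lborel" using assms by measurable
  show "AE x in lborel. norm (u x * q n x) \<le> norm (L * u x)"
    using mult_left_mono[OF q_le[of n]] L_nonneg
    by (intro AE_I2) (simp add: abs_mult mult.commute[of L])
qed

lemma integral_mult_q_diff_le:
  assumes u: "integrable lborel u" "integrable lborel u'"
  shows "\<bar>(LBINT x. u x * q n x) - (LBINT x. u' x * q n x)\<bar> \<le> L * (LBINT x. \<bar>u x - u' x\<bar>)"
proof -
  have "(LBINT x. u x * q n x) - (LBINT x. u' x * q n x) = (LBINT x. (u x - u' x) * q n x)"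
    by (simp add: left_diff_distrib integrable_mult_q u)
  also have "\<bar>\<dots>\<bar> \<le> (LBINT x. L * \<bar>u x - u' x\<bar>)"
  proof (rule abs_integral_le)
    show "integrable lborel (\<lambda>x. L * \<bar>u x - u' x\<bar>)" using u by simp
    show "\<bar>(u x - u' x) * q n x\<bar> \<le> L * \<bar>u x - u' x\<bar>" for x
      using mult_left_mono[OF q_le[of n x], of "\<bar>u x - u' x\<bar>"] by (simp add: abs_mult mult.commute)
  qed
  finally show ?thesis by simp
qed

text \<open>Integration against \<open>q n\<close> is Lipschitz on \<open>L\<^sup>1\<close> with a constant that does not depend on \<open>n\<close>.\<close>

lemma convergent_L1_closed:
  assumes u: "integrable lborel u" and s: "\<And>i. integrable lborel (s i)"
    and conv: "\<And>i. convergent (\<lambda>n. LBINT x. s i x * q n x)"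
    and lim: "\<And>x. (\<lambda>i. s i x) \<longlonglongrightarrow> u x" and g: "integrable lborel g" "\<And>i x. \<bar>s i x\<bar> \<le> g x"
  shows "convergent (\<lambda>n. LBINT x. u x * q n x)"
proof (rule convergent_if_approximable)
  fix e :: real assume e: "e > 0"
  have [measurable]: "u \<in> borel_measurable borel" "s i \<in> borel_measurable borel" for i using u s[of i] by auto
  have "(\<lambda>i. LBINT x. \<bar>u x - s i x\<bar>) \<longlonglongrightarrow> integral\<^sup>L (lborel :: 'a measure) (\<lambda>_. 0 :: real)"
  proof (rule integral_dominated_convergence)
    show "integrable lborel (\<lambda>x. \<bar>u x\<bar> + g x)" using u g by simp
    show "AE x in lborel. (\<lambda>i. \<bar>u x - s i x\<bar>) \<longlonglongrightarrow> 0"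
    proof (intro AE_I2 tendsto_rabs_zero)
      show "(\<lambda>i. u x - s i x) \<longlonglongrightarrow> 0" for x
        using tendsto_diff[OF tendsto_const[of "u x"] lim[of x]] by simp
    qed
    show "AE x in lborel. norm \<bar>u x - s i x\<bar> \<le> \<bar>u x\<bar> + g x" for i
    proof (rule AE_I2)
      show "norm \<bar>u x - s i x\<bar> \<le> \<bar>u x\<bar> + g x" for x
        using g(2)[of i x] by (simp add: abs_le_iff) linarith
    qed
  qed auto
  then have "(\<lambda>i. L * (LBINT x. \<bar>u x - s i x\<bar>)) \<longlonglongrightarrow> L * 0" by (intro tendsto_intros) simp
  then have "eventually (\<lambda>i. L * (LBINT x. \<bar>u x - s i x\<bar>) < e) sequentially"
    using e by (intro order_tendstoD(2)) auto
  then obtain i where "L * (LBINT x. \<bar>u x - s i x\<bar>) < e" by (auto simp: eventually_sequentially)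
  then have "\<bar>(LBINT x. u x * q n x) - (LBINT x. s i x * q n x)\<bar> \<le> e" for n
    using integral_mult_q_diff_le[OF u s[of i], of n] by linarith
  then show "\<exists>d. convergent d \<and> (\<forall>n. \<bar>(LBINT x. u x * q n x) - d n\<bar> \<le> e)"
    using conv[of i] by (intro exI[of _ "\<lambda>n. LBINT x. s i x * q n x"]) auto
qed

end

text \<open>If moreover the integrals over boxes converge, there is a weak limit in \<open>L\<^sup>\<infinity>\<close>: convergence extends from
  boxes to Borel sets and to integrable functions, and the limits of the integrals of \<open>q n + L\<close> form
  a measure whose Radon-Nikodym density lies between \<open>0\<close> and \<open>2 L\<close>.\<close>

locale weakly_convergent = bounded_sequence +
  assumes box: "\<And>a b. convergent (\<lambda>n. LBINT x. indicator (box a b) x * q n x)"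
begin

text \<open>The sets with this property form a Dynkin system that contains the boxes.\<close>

lemma convergent_indicator_Int_box:
  assumes A: "A \<in> sets borel"
  shows "convergent (\<lambda>n. LBINT x. indicator (A \<inter> box a b) x * q n x)"
proof -
  have fin: "emeasure lborel (A \<inter> box a b) < \<infinity>" for A
    by (rule le_less_trans[OF emeasure_mono[of _ "box a b"]]) (auto simp: emeasure_lborel_box_eq less_top[symmetric])
  have int: "integrable lborel (indicator (A \<inter> box a b) :: 'a \<Rightarrow> real)" if "A \<in> sets borel" for A
    using that fin[of A] by auto
  have st: "Int_stable (range (\<lambda>(a, b). box a b :: 'a set))"
    by (auto simp: Int_stable_def box_Int_box)
  have cl: "range (\<lambda>(a, b). box a b :: 'a set) \<subseteq> Pow UNIV" by simp
  have eq: "sigma_sets UNIV (range (\<lambda>(a, b). box a b :: 'a set)) = sets borel"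
    by (subst borel_eq_box) (simp add: sets_measure_of)
  have "A \<in> sigma_sets UNIV (range (\<lambda>(a, b). box a b :: 'a set))" using A eq by simp
  from st cl this show ?thesis
  proof (induction rule: sigma_sets_induct_disjoint)
    case (basic A)
    then show ?case using box by (auto simp: box_Int_box)
  next
    case empty
    then show ?case by (simp add: convergent_const)
  next
    case (compl A)
    have A: "A \<in> sets borel" using compl eq by simp
    have "(LBINT x. indicator ((UNIV - A) \<inter> box a b) x * q n x) =
        (LBINT x. indicator (box a b) x * q n x) - (LBINT x. indicator (A \<inter> box a b) x * q n x)" for n
    proof -
      have i: "integrable lborel (\<lambda>x. indicator (box a b) x * q n x)"
        using integrable_mult_q[OF int[of UNIV], of n] by simp
      have "(LBINT x. indicator ((UNIV - A) \<inter> box a b) x * q n x) =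
          (LBINT x. indicator (box a b) x * q n x - indicator (A \<inter> box a b) x * q n x)"
        by (intro Bochner_Integration.integral_cong) (auto simp: indicator_def)
      then show ?thesis
        by (simp only: Bochner_Integration.integral_diff[OF i integrable_mult_q[OF int[OF A]]])
    qed
    then show ?case using compl box by (simp add: convergent_diff)
  next
    case (union A)
    have A: "A i \<in> sets borel" for i using union eq by auto
    show ?case
    proof (rule convergent_L1_closed[of _ "\<lambda>k. indicator ((\<Union>i<k. A i) \<inter> box a b)" "indicator (UNIV \<inter> box a b)"])
      show "integrable lborel (indicator ((\<Union>i. A i) \<inter> box a b) :: 'a \<Rightarrow> real)"
        using A by (intro int) auto
      show ik: "integrable lborel (indicator ((\<Union>i<k. A i) \<inter> box a b) :: 'a \<Rightarrow> real)" for k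
        using A by (intro int) auto
      show "integrable lborel (indicator (UNIV \<inter> box a b) :: 'a \<Rightarrow> real)"
        by (intro int) auto
      show "convergent (\<lambda>n. LBINT x. indicator ((\<Union>i<k. A i) \<inter> box a b) x * q n x)" for k
      proof (induction k)
        case (Suc k)
        have d: "x \<notin> A k" if "i < k" "x \<in> A i" for i x
          using disjoint_family_onD[OF union(1), of i k] that by auto
        have "indicator ((\<Union>i<Suc k. A i) \<inter> box a b) x =
            indicator ((\<Union>i<k. A i) \<inter> box a b) x + (indicator (A k \<inter> box a b) x :: real)" for x
          by (auto simp: indicator_def less_Suc_eq dest: d)
        then have "(LBINT x. indicator ((\<Union>i<Suc k. A i) \<inter> box a b) x * q n x) =
            (LBINT x. indicator ((\<Union>i<k. A i) \<inter> box a b) x * q n x) +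
            (LBINT x. indicator (A k \<inter> box a b) x * q n x)" for n
          using integrable_mult_q[OF ik] integrable_mult_q[OF int[OF A]] by (simp add: distrib_right)
        then show ?case using Suc union(3) by (simp add: convergent_add)
      qed (simp add: convergent_const)
      show "(\<lambda>k. indicator ((\<Union>i<k. A i) \<inter> box a b) x) \<longlonglongrightarrow> (indicator ((\<Union>i. A i) \<inter> box a b) x :: real)" for x
      proof (cases "x \<in> (\<Union>i. A i) \<inter> box a b")
        case True
        then obtain i where i: "x \<in> A i" by auto
        have "eventually (\<lambda>k. indicator ((\<Union>i<k. A i) \<inter> box a b) x = (indicator ((\<Union>i. A i) \<inter> box a b) x :: real)) sequentially"
          using eventually_gt_at_top[of i] by eventually_elim (use i True in \<open>auto simp: indicator_def\<close>)
        then show ?thesis by (rule tendsto_eventually)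
      qed (auto simp: indicator_def)
    qed (auto simp: indicator_def)
  qed
qed

lemma convergent_integrable:
  assumes "integrable lborel u"
  shows "convergent (\<lambda>n. LBINT x. u x * q n x)"
  using assms
proof (induction rule: integrable_induct)
  case (base A c)
  let ?B = "\<lambda>i. box (- (real i *\<^sub>R One)) (real i *\<^sub>R One) :: 'a set"
  have A: "A \<in> sets borel" using base by simp
  have int: "integrable lborel (indicator A :: 'a \<Rightarrow> real)" using base by auto
  have "convergent (\<lambda>n. LBINT x. indicator A x * q n x)"
  proof (rule convergent_L1_closed[of _ "\<lambda>i. indicator (A \<inter> ?B i)"])
    show "integrable lborel (indicator (A \<inter> ?B i) :: 'a \<Rightarrow> real)" for i
      by (rule Bochner_Integration.integrable_bound[OF int]) (use A in \<open>auto simp: indicator_def\<close>)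
    show "(\<lambda>i. indicator (A \<inter> ?B i) x) \<longlonglongrightarrow> (indicator A x :: real)" for x
    proof -
      obtain N where N: "norm x < real N" using reals_Archimedean2 by blast
      have "x \<in> ?B i" if "i \<ge> N" for i
      proof -
        have "\<bar>x \<bullet> j\<bar> < real i" if "j \<in> Basis" for j
          using Basis_le_norm[OF that, of x] N \<open>i \<ge> N\<close> by linarith
        then show ?thesis by (auto simp: mem_box abs_less_iff minus_less_iff)
      qed
      then have "eventually (\<lambda>i. indicator (A \<inter> ?B i) x = (indicator A x :: real)) sequentially"
        by (intro eventually_sequentiallyI[of N]) (auto simp: indicator_def)
      then show ?thesis by (rule tendsto_eventually)
    qed
    show "\<bar>indicator (A \<inter> ?B i) x\<bar> \<le> (indicator A x :: real)" for i x
      by (auto simp: indicator_def)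
  qed (rule int convergent_indicator_Int_box[OF A])+
  then have "convergent (\<lambda>n. c * (LBINT x. indicator A x * q n x))"
    by (intro convergent_mult convergent_const)
  moreover have "(LBINT x. (indicator A x *\<^sub>R c) * q n x) = c * (LBINT x. indicator A x * q n x)" for n
    by (subst integral_mult_right_zero[symmetric]) (simp add: mult_ac)
  ultimately show ?case by simp
next
  case (add f g)
  then show ?case by (simp add: distrib_right integrable_mult_q convergent_add)
next
  case (lim f s)
  show ?case
    by (rule convergent_L1_closed[of f s "\<lambda>x. 2 * \<bar>f x\<bar>"]) (use lim in auto)
qed

definition weak_integral :: "('a \<Rightarrow> real) \<Rightarrow> real" where
  "weak_integral u = lim (\<lambda>n. LBINT x. u x * q n x)"

lemma weak_integral_LIMSEQ:
  "integrable lborel u \<Longrightarrow> (\<lambda>n. LBINT x. u x * q n x) \<longlonglongrightarrow> weak_integral u"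
  unfolding weak_integral_def using convergent_integrable convergent_LIMSEQ_iff by blast

lemma weak_integral_add:
  assumes "integrable lborel u" "integrable lborel u'"
  shows "weak_integral (\<lambda>x. u x + u' x) = weak_integral u + weak_integral u'"
proof (rule LIMSEQ_unique)
  show "(\<lambda>n. LBINT x. (u x + u' x) * q n x) \<longlonglongrightarrow> weak_integral (\<lambda>x. u x + u' x)"
    using assms by (intro weak_integral_LIMSEQ) simp
  show "(\<lambda>n. LBINT x. (u x + u' x) * q n x) \<longlonglongrightarrow> weak_integral u + weak_integral u'"
    using tendsto_add[OF weak_integral_LIMSEQ[OF assms(1)] weak_integral_LIMSEQ[OF assms(2)]] assms
    by (simp add: distrib_right integrable_mult_q)
qed

lemma weak_integral_cmult:
  assumes "integrable lborel u"
  shows "weak_integral (\<lambda>x. c * u x) = c * weak_integral u"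
proof (rule LIMSEQ_unique)
  show "(\<lambda>n. LBINT x. (c * u x) * q n x) \<longlonglongrightarrow> weak_integral (\<lambda>x. c * u x)"
    using assms by (intro weak_integral_LIMSEQ) simp
  show "(\<lambda>n. LBINT x. (c * u x) * q n x) \<longlonglongrightarrow> c * weak_integral u"
    using tendsto_mult_left[OF weak_integral_LIMSEQ[OF assms], of c]
    by (simp add: mult.assoc)
qed

lemma weak_integral_le:
  assumes "integrable lborel u"
  shows "\<bar>weak_integral u\<bar> \<le> L * (LBINT x. \<bar>u x\<bar>)"
proof (rule LIMSEQ_le_const2)
  show "(\<lambda>n. \<bar>LBINT x. u x * q n x\<bar>) \<longlonglongrightarrow> \<bar>weak_integral u\<bar>"
    by (intro tendsto_intros weak_integral_LIMSEQ assms)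
  show "\<exists>N. \<forall>n\<ge>N. \<bar>LBINT x. u x * q n x\<bar> \<le> L * (LBINT x. \<bar>u x\<bar>)"
    using integral_mult_q_diff_le[OF assms, of "\<lambda>_. 0"] by auto
qed

lemma weak_integral_nonneg_shift:
  assumes u: "integrable lborel u" "\<And>x. 0 \<le> u x"
  shows "0 \<le> weak_integral u + L * (LBINT x. u x)"
    "weak_integral u + L * (LBINT x. u x) \<le> 2 * L * (LBINT x. u x)"
  using weak_integral_le[OF u(1)] u(2) by (auto simp: abs_le_iff)

text \<open>The heat kernel at time \<open>1\<close> serves as a positive integrable weight, which makes the limit
  measure finite.\<close>

definition mass :: "'a set \<Rightarrow> real" where
  "mass A = weak_integral (\<lambda>x. indicator A x * heat 1 x) + L * (LBINT x. indicator A x * heat 1 x)"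

definition limit_measure :: "'a measure" where
  "limit_measure = measure_of UNIV (sets borel) (\<lambda>A. ennreal (mass A))"

lemma integrable_indicator_heat:
  "A \<in> sets borel \<Longrightarrow> integrable lborel (\<lambda>x::'a. indicator A x * heat 1 x)"
  using integrable_mult_indicator[of A lborel "heat 1", OF _ integrable_heat[of 1]] by simp

lemma mass_bounds:
  assumes "A \<in> sets borel"
  shows "0 \<le> mass A" "mass A \<le> 2 * L * (LBINT x. indicator A x * heat 1 x)"
  unfolding mass_def
  by (intro weak_integral_nonneg_shift integrable_indicator_heat assms;
      simp add: less_imp_le heat_pos)+

text \<open>Countable additivity follows from continuity at the empty set, because \<open>mass A\<close> is at most \<open>2 L\<close> times the
  weighted measure of \<open>A\<close>.\<close>

lemma emeasure_limit_measure:
  assumes A: "A \<in> sets borel"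
  shows "emeasure limit_measure A = ennreal (mass A)"
proof -
  have add: "mass (A \<union> B) = mass A + mass B" if "A \<in> sets borel" "B \<in> sets borel" "A \<inter> B = {}" for A B
  proof -
    have "indicator (A \<union> B) x * heat 1 x = indicator A x * heat 1 x + indicator B x * heat 1 x" for x :: 'a
      using that(3) by (auto simp: indicator_def)
    then show ?thesis
      unfolding mass_def using integrable_indicator_heat[OF that(1)] integrable_indicator_heat[OF that(2)]
      by (simp add: weak_integral_add distrib_left)
  qed
  have mass0: "mass {} = 0" using mass_bounds[of "{}"] by simp
  have sa: "sigma_algebra UNIV (sets (borel :: 'a measure))"
    using sets.sigma_algebra_axioms[of borel] by simp
  interpret sigma_algebra UNIV "sets (borel :: 'a measure)" by (rule sa)
  have pos: "positive (sets borel) (\<lambda>A. ennreal (mass A))"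
    by (simp add: positive_def mass0)
  have "countably_additive (sets borel) (\<lambda>A. ennreal (mass A))"
  proof (rule empty_continuous_imp_countably_additive[OF pos])
    show "additive (sets borel) (\<lambda>A. ennreal (mass A))"
      by (auto simp: additive_def add mass_bounds simp flip: ennreal_plus)
    fix A :: "nat \<Rightarrow> 'a set" assume A: "range A \<subseteq> sets borel" "decseq A" "(\<Inter>i. A i) = {}"
    have [measurable]: "A i \<in> sets borel" for i using A by auto
    have lim: "(\<lambda>i. LBINT x. indicator (A i) x * heat 1 x) \<longlonglongrightarrow> integral\<^sup>L (lborel :: 'a measure) (\<lambda>_. 0 :: real)"
    proof (rule integral_dominated_convergence)
      show "integrable lborel (heat 1 :: 'a \<Rightarrow> real)" by (rule integrable_heat) simp
      show "AE x in lborel. norm (indicator (A i) x * heat 1 x) \<le> heat 1 x" for i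
        by (intro AE_I2) (auto simp: indicator_def abs_heat less_imp_le heat_pos)
      show "AE x in lborel. (\<lambda>i. indicator (A i) x * heat 1 x) \<longlonglongrightarrow> 0"
      proof (rule AE_I2)
        fix x :: 'a
        obtain j where "x \<notin> A j" using A(3) by auto
        then have "x \<notin> A i" if "i \<ge> j" for i using A(2) that by (auto simp: decseq_def)
        then show "(\<lambda>i. indicator (A i) x * heat 1 x) \<longlonglongrightarrow> 0"
          by (intro tendsto_eventually eventually_sequentiallyI[of j]) simp
      qed
    qed auto
    have "(\<lambda>i. mass (A i)) \<longlonglongrightarrow> 0"
    proof (rule tendsto_sandwich[OF _ _ tendsto_const])
      show "(\<lambda>i. 2 * L * (LBINT x. indicator (A i) x * heat 1 x)) \<longlonglongrightarrow> 0"
        using tendsto_mult_left[OF lim, of "2 * L"] by simp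
    qed (auto intro!: always_eventually mass_bounds)
    then show "(\<lambda>i. ennreal (mass (A i))) \<longlonglongrightarrow> 0"
      using tendsto_ennrealI by fastforce
  qed auto
  then show ?thesis
    unfolding limit_measure_def using A pos by (intro emeasure_measure_of_sigma sa)
qed

lemma sets_limit_measure: "sets limit_measure = sets borel"
  unfolding limit_measure_def by (simp add: sets_measure_of sets.sigma_sets_eq[of borel, simplified])

text \<open>The density exceeds \<open>2 L\<close> times the weight only on a null set, since the integral of the excess over
  the set where it is positive vanishes.\<close>

lemma ex_limit_density:
  obtains H where "H \<in> borel_measurable borel" "\<And>x. 0 \<le> H x" "AE x in lborel. H x \<le> 2 * L * heat 1 x"
    "\<And>A. A \<in> sets borel \<Longrightarrow> mass A = (LBINT x. indicator A x * H x)"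
    "integrable lborel H"
proof -
  have "absolutely_continuous lborel limit_measure"
    unfolding absolutely_continuous_def
  proof
    fix A :: "'a set" assume A: "A \<in> null_sets lborel"
    have "(LBINT x. indicator A x * heat 1 x) = integral\<^sup>L (lborel :: 'a measure) (\<lambda>_. 0 :: real)"
      using A AE_not_in[OF A] by (intro integral_cong_AE) (auto simp: indicator_def)
    then have "mass A = 0" using mass_bounds[of A] A by auto
    then show "A \<in> null_sets limit_measure"
      using A by (auto simp: null_sets_def sets_limit_measure emeasure_limit_measure)
  qed
  then obtain G where G[measurable]: "G \<in> borel_measurable lborel"
    and den: "Nonnegative_Lebesgue_Integration.density lborel G = limit_measure"
    using sigma_finite_measure.Radon_Nikodym[OF sigma_finite_lborel, of limit_measure]
    by (auto simp: sets_limit_measure)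
  have em: "(\<integral>\<^sup>+x. G x * indicator A x \<partial>lborel) = ennreal (mass A)" if "A \<in> sets borel" for A
    using emeasure_density[OF G, of A] that by (simp add: den emeasure_limit_measure)
  let ?b = "\<lambda>x. ennreal (2 * L * heat 1 x)"
  let ?A = "{x. ?b x < G x}"
  have A[measurable]: "?A \<in> sets borel" by measurable
  have "(\<integral>\<^sup>+x. G x * indicator ?A x \<partial>lborel) \<le> (\<integral>\<^sup>+x. ?b x * indicator ?A x \<partial>lborel)"
  proof -
    have "(\<integral>\<^sup>+x. ?b x * indicator ?A x \<partial>lborel) = (\<integral>\<^sup>+x. ennreal (2 * L * (indicator ?A x * heat 1 x)) \<partial>lborel)"
      by (intro nn_integral_cong) (auto simp: indicator_def)
    also have "\<dots> = ennreal (LBINT x. 2 * L * (indicator ?A x * heat 1 x))"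
      using L_nonneg by (intro nn_integral_eq_integral integrable_mult_right integrable_indicator_heat A AE_I2)
        (simp add: less_imp_le heat_pos)
    finally show ?thesis
      using mass_bounds(2)[OF A] by (simp add: em[OF A] ennreal_leI)
  qed
  moreover have "(\<integral>\<^sup>+x. G x * indicator ?A x - ?b x * indicator ?A x \<partial>lborel) =
      (\<integral>\<^sup>+x. G x * indicator ?A x \<partial>lborel) - (\<integral>\<^sup>+x. ?b x * indicator ?A x \<partial>lborel)"
  proof (rule nn_integral_diff)
    have "(\<integral>\<^sup>+x. ?b x * indicator ?A x \<partial>lborel) \<le> (\<integral>\<^sup>+x. G x * indicator ?A x \<partial>lborel)"
      by (intro nn_integral_mono) (auto simp: indicator_def)
    then show "(\<integral>\<^sup>+x. ?b x * indicator ?A x \<partial>lborel) \<noteq> \<infinity>"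
      unfolding em[OF A] by (metis ennreal_less_top infinity_ennreal_def le_less_trans less_irrefl)
  qed (auto simp: indicator_def)
  ultimately have "(\<integral>\<^sup>+x. G x * indicator ?A x - ?b x * indicator ?A x \<partial>lborel) = 0"
    by (simp add: diff_eq_0_ennreal em[OF A])
  then have "AE x in lborel. G x * indicator ?A x - ?b x * indicator ?A x = 0"
    by (subst (asm) nn_integral_0_iff_AE) auto
  then have G_le: "AE x in lborel. G x \<le> ?b x"
  proof eventually_elim
    case (elim x)
    show ?case
    proof (rule ccontr)
      assume "\<not> G x \<le> ?b x"
      then have "?b x < G x" by simp
      then have "G x - ?b x = 0" using elim by (simp add: indicator_def)
      then show False using \<open>?b x < G x\<close> by (simp add: ennreal_minus_eq_0 not_le[symmetric] diff_eq_0_iff_ennreal)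
    qed
  qed
  have fin: "AE x in lborel. ennreal (enn2real (G x)) = G x"
    using G_le by eventually_elim (rule ennreal_enn2real, erule le_less_trans[OF _ ennreal_less_top])
  have H: "(\<integral>\<^sup>+x. ennreal (indicator A x * enn2real (G x)) \<partial>lborel) = ennreal (mass A)" if "A \<in> sets borel" for A
    unfolding em[OF that, symmetric] using fin
    by (intro nn_integral_cong_AE) (auto simp: indicator_def elim!: eventually_mono)
  show ?thesis
  proof (rule that[of "\<lambda>x. enn2real (G x)"])
    show "AE x in lborel. enn2real (G x) \<le> 2 * L * heat 1 x"
      using G_le by eventually_elim (use L_nonneg in \<open>auto intro!: enn2real_leI mult_nonneg_nonneg simp: less_imp_le heat_pos\<close>)
    show "integrable lborel (\<lambda>x. enn2real (G x))"
      using H[of UNIV] by (intro integrableI_nonneg) auto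
    show "mass A = (LBINT x. indicator A x * enn2real (G x))" if "A \<in> sets borel" for A
      using H[OF that] mass_bounds(1)[OF that] that
      by (subst integral_eq_nn_integral) auto
  qed auto
qed

text \<open>Undo the weight and the shift by \<open>L\<close>. Integrable functions have the form \<open>k\<close> times the weight, with \<open>k\<close>
  integrable for the weighted measure, and on indicator functions \<open>k\<close> the claim is the definition of
  the density.\<close>

lemma ex_weak_limit:
  obtains h where "h \<in> borel_measurable borel" "AE x in lborel. \<bar>h x\<bar> \<le> L"
    "\<And>\<psi>. integrable lborel \<psi> \<Longrightarrow> (\<lambda>n. LBINT x. \<psi> x * q n x) \<longlonglongrightarrow> (LBINT x. \<psi> x * h x)"
proof -
  obtain H where H[measurable]: "H \<in> borel_measurable borel" and H0: "\<And>x. 0 \<le> H x"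
    and H_le: "AE x in lborel. H x \<le> 2 * L * heat 1 x"
    and H_mass: "\<And>A. A \<in> sets borel \<Longrightarrow> mass A = (LBINT x. indicator A x * H x)"
    and H_int: "integrable lborel H"
    by (rule ex_limit_density) (rule that; assumption)
  define h where "h x = H x / heat 1 x - L" for x
  have [measurable]: "h \<in> borel_measurable borel" unfolding h_def by measurable
  have h_le: "AE x in lborel. \<bar>h x\<bar> \<le> L"
    using H_le
  proof eventually_elim
    case (elim x)
    have "0 \<le> H x / heat 1 x" "H x / heat 1 x \<le> 2 * L"
      using elim H0[of x] heat_pos[of 1 x] by (auto simp: pos_divide_le_eq less_imp_le)
    then show ?case by (simp add: h_def abs_le_iff)
  qed
  have int_h: "integrable lborel (\<lambda>x. u x * h x)" if u: "integrable lborel u" for u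
  proof (rule Bochner_Integration.integrable_bound)
    show "integrable lborel (\<lambda>x. L * u x)" using u by simp
    show "AE x in lborel. norm (u x * h x) \<le> norm (L * u x)"
      using h_le by eventually_elim (use L_nonneg in \<open>simp add: abs_mult mult.commute[of L] mult_left_mono\<close>)
  qed (use u in measurable)
  define M where "M = Nonnegative_Lebesgue_Integration.density lborel (\<lambda>x::'a. ennreal (heat 1 x))"
  have [measurable_cong]: "sets M = sets borel" by (simp add: M_def)
  have intM: "integrable M k \<longleftrightarrow> k \<in> borel_measurable borel \<and> integrable lborel (\<lambda>x. k x * heat 1 x)" for k :: "'a \<Rightarrow> real"
  proof (cases "k \<in> borel_measurable borel")
    case True
    then show ?thesis unfolding M_def
      by (subst integrable_density) (auto simp: less_imp_le heat_pos mult.commute)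
  next
    case False
    then show ?thesis using borel_measurable_integrable[of M k] by (auto simp: M_def)
  qed
  have main: "weak_integral (\<lambda>x. k x * heat 1 x) = (LBINT x. (k x * heat 1 x) * h x)"
    if "integrable M k" for k
    using that
  proof (induction rule: integrable_induct)
    case (base A c)
    then have A: "A \<in> sets borel" by (simp add: M_def)
    note iA = integrable_indicator_heat[OF A]
    have "weak_integral (\<lambda>x. (indicator A x *\<^sub>R c) * heat 1 x) = c * weak_integral (\<lambda>x. indicator A x * heat 1 x)"
      using weak_integral_cmult[OF iA, of c] by (simp add: mult_ac)
    also have "weak_integral (\<lambda>x. indicator A x * heat 1 x) =
        (LBINT x. indicator A x * H x) - (LBINT x. L * (indicator A x * heat 1 x))"
      using H_mass[OF A] by (simp add: mass_def)
    also have "\<dots> = (LBINT x. indicator A x * H x - L * (indicator A x * heat 1 x))"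
      using integrable_mult_indicator[OF _ H_int, of A] A iA by simp
    also have "\<dots> = (LBINT x. (indicator A x * heat 1 x) * h x)"
      using heat_pos[of 1, where 'a='a] by (intro Bochner_Integration.integral_cong) (auto simp: h_def right_diff_distrib less_imp_neq[THEN not_sym])
    also have "c * \<dots> = (LBINT x. ((indicator A x *\<^sub>R c) * heat 1 x) * h x)"
      by (subst integral_mult_right_zero[symmetric]) (simp add: mult_ac)
    finally show ?case .
  next
    case (add f g)
    then show ?case
      using int_h[of "\<lambda>x. f x * heat 1 x"] int_h[of "\<lambda>x. g x * heat 1 x"]
      by (simp add: intM distrib_right weak_integral_add)
  next
    case (lim f s)
    have f: "integrable lborel (\<lambda>x. f x * heat 1 x)" "f \<in> borel_measurable borel"
      and s: "integrable lborel (\<lambda>x. s i x * heat 1 x)" "s i \<in> borel_measurable borel" for i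
      using lim by (auto simp: intM)
    note [measurable] = f(2) s(2)
    have slim: "(\<lambda>i. s i x) \<longlonglongrightarrow> f x" and sle: "\<bar>s i x\<bar> \<le> 2 * \<bar>f x\<bar>" for i x
      using lim by (auto simp: M_def)
    have norm_le: "\<bar>s i x * heat 1 x\<bar> \<le> 2 * \<bar>f x * heat 1 x\<bar>" for i x
      using mult_right_mono[OF sle[of i x], of "heat 1 x"] heat_pos[of 1 x] by (simp add: abs_mult abs_heat)
    have "(\<lambda>i. weak_integral (\<lambda>x. s i x * heat 1 x)) \<longlonglongrightarrow> weak_integral (\<lambda>x. f x * heat 1 x)"
    proof (rule LIM_zero_cancel, rule tendsto_rabs_zero_cancel, rule tendsto_sandwich[OF _ _ tendsto_const])
      have "(\<lambda>i. LBINT x. \<bar>s i x * heat 1 x + - 1 * (f x * heat 1 x)\<bar>) \<longlonglongrightarrow> integral\<^sup>L (lborel :: 'a measure) (\<lambda>_. 0 :: real)"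
      proof (rule integral_dominated_convergence)
        show "integrable lborel (\<lambda>x. 3 * \<bar>f x * heat 1 x\<bar>)" using f by simp
        show "AE x in lborel. (\<lambda>i. \<bar>s i x * heat 1 x + - 1 * (f x * heat 1 x)\<bar>) \<longlonglongrightarrow> 0"
        proof (intro AE_I2 tendsto_rabs_zero)
          show "(\<lambda>i. s i x * heat 1 x + - 1 * (f x * heat 1 x)) \<longlonglongrightarrow> 0" for x
            using tendsto_add[OF tendsto_mult_right[OF slim[of x], of "heat 1 x"] tendsto_const[of "- 1 * (f x * heat 1 x)"]] by simp
        qed
        show "AE x in lborel. norm \<bar>s i x * heat 1 x + - 1 * (f x * heat 1 x)\<bar> \<le> 3 * \<bar>f x * heat 1 x\<bar>" for i
        proof (rule AE_I2)
          show "norm \<bar>s i x * heat 1 x + - 1 * (f x * heat 1 x)\<bar> \<le> 3 * \<bar>f x * heat 1 x\<bar>" for x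
            using norm_le[of i x] by simp
        qed
      qed auto
      from tendsto_mult_left[OF this, of L]
      show "(\<lambda>i. L * (LBINT x. \<bar>s i x * heat 1 x + - 1 * (f x * heat 1 x)\<bar>)) \<longlonglongrightarrow> 0" by simp
      have "weak_integral (\<lambda>x. s i x * heat 1 x + - 1 * (f x * heat 1 x)) =
          weak_integral (\<lambda>x. s i x * heat 1 x) - weak_integral (\<lambda>x. f x * heat 1 x)" for i
        using weak_integral_add[OF s(1) integrable_mult_right[OF f(1), of "-1"]] weak_integral_cmult[OF f(1), of "- 1"] by simp
      moreover have "\<bar>weak_integral (\<lambda>x. s i x * heat 1 x + - 1 * (f x * heat 1 x))\<bar> \<le>
          L * (LBINT x. \<bar>s i x * heat 1 x + - 1 * (f x * heat 1 x)\<bar>)" for i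
        by (intro weak_integral_le Bochner_Integration.integrable_add s integrable_mult_right f)
      ultimately show "eventually (\<lambda>i. \<bar>weak_integral (\<lambda>x. s i x * heat 1 x) - weak_integral (\<lambda>x. f x * heat 1 x)\<bar> \<le>
          L * (LBINT x. \<bar>s i x * heat 1 x + - 1 * (f x * heat 1 x)\<bar>)) sequentially"
        by simp
    qed auto
    moreover have "(\<lambda>i. LBINT x. (s i x * heat 1 x) * h x) \<longlonglongrightarrow> (LBINT x. (f x * heat 1 x) * h x)"
    proof (rule integral_dominated_convergence)
      show "integrable lborel (\<lambda>x. 2 * \<bar>(f x * heat 1 x) * h x\<bar>)" using int_h[OF f(1)] by simp
      show "AE x in lborel. (\<lambda>i. s i x * heat 1 x * h x) \<longlonglongrightarrow> f x * heat 1 x * h x"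
        by (intro AE_I2 tendsto_mult tendsto_const slim)
      show "AE x in lborel. norm (s i x * heat 1 x * h x) \<le> 2 * \<bar>f x * heat 1 x * h x\<bar>" for i
      proof (rule AE_I2)
        show "norm (s i x * heat 1 x * h x) \<le> 2 * \<bar>f x * heat 1 x * h x\<bar>" for x
          using mult_right_mono[OF norm_le[of i x], of "\<bar>h x\<bar>"] by (simp add: abs_mult)
      qed
    qed measurable
    ultimately show ?case using lim by (simp add: LIMSEQ_unique)
  qed
  show ?thesis
  proof (rule that[OF _ h_le])
    fix \<psi> :: "'a \<Rightarrow> real" assume \<psi>: "integrable lborel \<psi>"
    have [measurable]: "\<psi> \<in> borel_measurable borel" using \<psi> by auto
    have eq: "\<psi> x / heat 1 x * heat 1 x = \<psi> x" for x
      using heat_pos[of 1 x] by simp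
    have "integrable M (\<lambda>x. \<psi> x / heat 1 x)"
      unfolding intM eq using \<psi> by (intro conjI) measurable
    from main[OF this] have "weak_integral \<psi> = (LBINT x. \<psi> x * h x)"
      by (simp only: eq)
    then show "(\<lambda>n. LBINT x. \<psi> x * q n x) \<longlonglongrightarrow> (LBINT x. \<psi> x * h x)"
      using weak_integral_LIMSEQ[OF \<psi>] by simp
  qed measurable
qed

end

text \<open>The weak derivative is the weak limit of the difference quotients. Tested against a smooth function
  they converge by differentiation under the integral sign; a box is approximated in \<open>L\<^sup>1\<close> by its bump
  functions.\<close>

lemma ex_bounded_weak_derivative:
  fixes g :: "'a::euclidean_space \<Rightarrow> real"
  assumes g: "continuous_on UNIV g" and b: "b \<in> Basis"
    and Lip: "\<And>x \<tau>. \<bar>g (x + \<tau> *\<^sub>R b) - g x\<bar> \<le> L * \<bar>\<tau>\<bar>"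
  obtains h where "weak_derivative [b] g h" "h \<in> borel_measurable borel" "AE x in lborel. \<bar>h x\<bar> \<le> L"
proof -
  define \<epsilon> where "\<epsilon> n = inverse (real (Suc n))" for n
  have \<epsilon>: "\<epsilon> n > 0" for n by (simp add: \<epsilon>_def)
  define q where "q n x = (g (x + \<epsilon> n *\<^sub>R b) - g x) / \<epsilon> n" for n x
  have gl: "locally_integrable g" by (rule locally_integrable_continuous[OF g])
  have [measurable]: "g \<in> borel_measurable borel" by (rule borel_measurable_continuous_onI[OF g])
  have q_meas[measurable]: "q n \<in> borel_measurable borel" for n unfolding q_def by measurable
  have q_le: "\<bar>q n x\<bar> \<le> L" for n x
    using Lip[of x "\<epsilon> n"] \<epsilon>[of n] by (simp add: q_def abs_divide pos_divide_le_eq)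
  have test_lim: "(\<lambda>n. LBINT x. \<psi> x * q n x) \<longlonglongrightarrow> - (LBINT x. g x * pderiv_dir b \<psi> x)"
    if \<psi>: "test_function \<psi>" for \<psi>
  proof -
    have [measurable]: "\<psi> \<in> borel_measurable borel"
      by (intro test_function_measurable \<psi>)
    let ?F = "\<lambda>\<theta>. LBINT y. g y * \<psi> (y + \<theta> *\<^sub>R b)"
    have eq: "(LBINT x. \<psi> x * q n x) = - ((?F (0 + - \<epsilon> n) - ?F 0) / (- \<epsilon> n))" for n
    proof -
      have "(LBINT x. \<psi> x * q n x) =
          (LBINT x. (g (x + \<epsilon> n *\<^sub>R b) * \<psi> x - g x * \<psi> x) / \<epsilon> n)"
        by (intro Bochner_Integration.integral_cong) (simp_all add: q_def algebra_simps)
      also have "\<dots> = ((LBINT x. g (x + \<epsilon> n *\<^sub>R b) * \<psi> x) - (LBINT x. g x * \<psi> x)) / \<epsilon> n"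
        by (subst integral_divide_zero, subst Bochner_Integration.integral_diff)
          (rule refl locally_integrable_mult_test gl locally_integrable_translate \<psi>)+
      also have "(LBINT x. g (x + \<epsilon> n *\<^sub>R b) * \<psi> x) = ?F (- \<epsilon> n)"
        using integral_lborel_translate[of "\<lambda>y. g y * \<psi> (y + (- \<epsilon> n) *\<^sub>R b)" "\<epsilon> n *\<^sub>R b"] by simp
      finally show ?thesis by (simp add: mult.commute)
    qed
    have "(?F has_real_derivative (LBINT y. g y * pderiv_dir b \<psi> (y + 0 *\<^sub>R b))) (at 0)"
      by (rule DERIV_integral_translated_test[OF gl \<psi> b])
    then have "((\<lambda>h. (?F (0 + h) - ?F 0) / h) \<longlongrightarrow> (LBINT y. g y * pderiv_dir b \<psi> y)) (at 0)"
      by (simp add: DERIV_def)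
    moreover have "filterlim (\<lambda>n. - \<epsilon> n) (at 0) sequentially"
      unfolding filterlim_at using tendsto_minus[OF LIMSEQ_inverse_real_of_nat] \<epsilon>
      by (auto simp: \<epsilon>_def intro!: always_eventually)
    ultimately have "(\<lambda>n. (?F (0 + - \<epsilon> n) - ?F 0) / (- \<epsilon> n)) \<longlonglongrightarrow> (LBINT y. g y * pderiv_dir b \<psi> y)"
      by (rule filterlim_compose)
    from tendsto_minus[OF this] show ?thesis unfolding eq by simp
  qed
  interpret bounded_sequence q L by standard (use q_le in simp_all)
  interpret weakly_convergent q L
  proof
    fix l r :: 'a
    let ?I = "indicator (box l r) :: 'a \<Rightarrow> real"
    show "convergent (\<lambda>n. LBINT x. ?I x * q n x)"
    proof (rule convergent_L1_closed[of ?I "box_bump l r" ?I])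
      show I: "integrable lborel ?I" by (simp add: emeasure_lborel_box_eq)
      then show "integrable lborel ?I" .
      show "\<bar>box_bump l r j x\<bar> \<le> ?I x" for j x
        using box_bump_nonneg[of l r j x] box_bump_le_1[of l r j x] box_bump_eq_0[of x l r j]
        by (cases "x \<in> box l r") auto
      show "convergent (\<lambda>n. LBINT x. box_bump l r j x * q n x)" for j
        using test_lim[OF test_function_box_bump] by (auto simp: convergent_def)
    qed (intro test_function_integrable test_function_box_bump box_bump_tendsto_indicator)+
  qed
  obtain h where h[measurable]: "h \<in> borel_measurable borel" and h_le: "AE x in lborel. \<bar>h x\<bar> \<le> L"
    and lim: "\<And>\<psi>. integrable lborel \<psi> \<Longrightarrow> (\<lambda>n. LBINT x. \<psi> x * q n x) \<longlonglongrightarrow> (LBINT x. \<psi> x * h x)"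
    by (rule ex_weak_limit) (rule that; assumption)
  have "weak_derivative [b] g h"
    unfolding weak_derivative_def
  proof (intro conjI allI impI)
    show "locally_integrable g" by (rule gl)
    show "locally_integrable h"
      unfolding locally_integrable_def set_integrable_def
    proof (intro allI impI)
      fix K :: "'a set" assume K: "compact K"
      show "integrable lborel (\<lambda>x. indicator K x *\<^sub>R h x)"
      proof (rule Bochner_Integration.integrable_bound)
        show "integrable lborel (\<lambda>x. indicator K x *\<^sub>R L)"
          by (rule borel_integrable_compact[OF K]) (rule continuous_on_const)
        show "AE x in lborel. norm (indicator K x *\<^sub>R h x) \<le> norm (indicator K x *\<^sub>R L)"
          using h_le by eventually_elim (auto simp: indicator_def)
        have [measurable]: "K \<in> sets borel" using K by (simp add: borel_compact)
        show "(\<lambda>x. indicator K x *\<^sub>R h x) \<in> borel_measurable lborel" by measurable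
      qed
    qed
    fix \<psi> :: "'a \<Rightarrow> real" assume \<psi>: "test_function \<psi>"
    from LIMSEQ_unique[OF lim[OF test_function_integrable[OF \<psi>]] test_lim[OF \<psi>]]
    show "(LBINT x. g x * foldr pderiv_dir [b] \<psi> x) = (- 1) ^ length [b] * (LBINT x. h x * \<psi> x)"
      by (simp add: mult.commute)
  qed
  then show ?thesis using that h h_le by blast
qed


section \<open>Reading off pointwise bounds from the norms\<close>

lemma Lp_norm_infinity_less:
  fixes g :: "'a::euclidean_space \<Rightarrow> 'b::euclidean_space"
  assumes "Lp_norm \<infinity> g < ennreal c" "0 \<le> c"
  shows "g \<in> borel_measurable borel" "AE x in lborel. norm (g x) \<le> c"
proof -
  show "g \<in> borel_measurable borel" using assms by (auto simp: Lp_norm_def split: if_splits)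
  then have "esssup lborel (\<lambda>x. ennreal (norm (g x))) \<le> ennreal c"
    using assms by (simp add: Lp_norm_def)
  moreover have "AE x in lborel. ennreal (norm (g x)) \<le> esssup lborel (\<lambda>x. ennreal (norm (g x)))"
    by (rule esssup_AE)
  ultimately show "AE x in lborel. norm (g x) \<le> c"
    using assms(2) by (auto elim!: eventually_mono simp: ennreal_le_iff dest: order_trans)
qed

lemma Lp_norm_infinity_le:
  fixes g :: "'a::euclidean_space \<Rightarrow> 'b::euclidean_space"
  assumes [measurable]: "g \<in> borel_measurable borel" and "AE x in lborel. norm (g x) \<le> c"
  shows "Lp_norm \<infinity> g \<le> ennreal c"
  unfolding Lp_norm_def using assms(2)
  by (auto intro!: esssup_I elim!: eventually_mono intro: ennreal_leI)

text \<open>The norm is an infimum and need not be attained, so strict bounds are used here and below.\<close>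

lemma weak_derivative_norm_less:
  "weak_derivative_norm N bs g < c \<Longrightarrow> \<exists>h. weak_derivative bs g h \<and> N h < c"
  by (auto simp: weak_derivative_norm_def INF_less_iff)

lemma weak_derivative_norm_le_sobolev_norm:
  assumes "set bs \<subseteq> Basis" "length bs \<le> n"
  shows "weak_derivative_norm (Lp_norm p) bs g \<le> sobolev_norm n p g"
  unfolding sobolev_norm_def
  by (rule member_le_sum[of bs "{bs. set bs \<subseteq> Basis \<and> length bs \<le> n}" "\<lambda>bs. weak_derivative_norm (Lp_norm p) bs g"])
    (use assms in \<open>auto intro: finite_lists_length_le\<close>)

lemma continuous_bounded_if_weak_norm_less:
  fixes g :: "'a::euclidean_space \<Rightarrow> real"
  assumes g: "continuous_on UNIV g" and n: "weak_derivative_norm (Lp_norm \<infinity>) [] g < ennreal c" and c: "0 \<le> c"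
  shows "\<bar>g x\<bar> \<le> c"
proof -
  obtain h where h: "weak_derivative [] g h" "Lp_norm \<infinity> h < ennreal c"
    using weak_derivative_norm_less[OF n] by blast
  have "AE x in lborel. \<bar>g x\<bar> \<le> c"
    using weak_derivative_Nil_AE_eq[OF h(1)] Lp_norm_infinity_less(2)[OF h(2) c] by eventually_elim simp
  then show ?thesis
    by (intro continuous_AE_le_imp_le[of "\<lambda>x. \<bar>g x\<bar>"]) (auto intro!: continuous_intros g)
qed

lemma continuous_Lipschitz_if_weak_norm_less:
  fixes g :: "'a::euclidean_space \<Rightarrow> real"
  assumes g: "continuous_on UNIV g" and b: "b \<in> Basis"
    and n: "weak_derivative_norm (Lp_norm \<infinity>) [b] g < ennreal c" and c: "0 \<le> c"
  shows "\<bar>g (x + \<tau> *\<^sub>R b) - g x\<bar> \<le> c * \<bar>\<tau>\<bar>"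
proof -
  obtain h where h: "weak_derivative [b] g h" "Lp_norm \<infinity> h < ennreal c"
    using weak_derivative_norm_less[OF n] by blast
  have "AE x in lborel. \<bar>h x\<bar> \<le> c" using Lp_norm_infinity_less(2)[OF h(2) c] by simp
  then show ?thesis by (rule weak_derivative_bounded_imp_directional_Lipschitz[OF g h(1) b])
qed

lemma sobolev_norm_1_infinity_finite:
  fixes g :: "'a::euclidean_space \<Rightarrow> real"
  assumes bd: "\<And>x. \<bar>g x\<bar> \<le> B" and Lip: "\<And>x y. \<bar>g x - g y\<bar> \<le> K * norm (x - y)"
  shows "sobolev_norm 1 \<infinity> g < \<infinity>"
proof -
  have K: "0 \<le> K"
  proof -
    have "0 \<le> K * norm ((SOME b. b \<in> Basis) - (0::'a))"
      using Lip[of "SOME b. b \<in> Basis" 0] by linarith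
    then show ?thesis by (simp add: SOME_Basis)
  qed
  have "K-lipschitz_on UNIV g" using Lip K by (intro lipschitz_onI) (auto simp: dist_norm)
  then have g: "continuous_on UNIV g" by (rule lipschitz_on_continuous_on)
  have "weak_derivative_norm (Lp_norm \<infinity>) bs g < \<infinity>" if bs: "set bs \<subseteq> Basis" "length bs \<le> 1" for bs
  proof (cases bs)
    case Nil
    have "weak_derivative_norm (Lp_norm \<infinity>) bs g \<le> Lp_norm \<infinity> g"
      unfolding weak_derivative_norm_def Nil
      by (intro INF_lower) (simp add: weak_derivative_def locally_integrable_continuous[OF g])
    also have "\<dots> \<le> ennreal B"
      by (intro Lp_norm_infinity_le borel_measurable_continuous_onI g) (use bd in simp)
    finally show ?thesis by (simp add: le_less_trans)
  next
    case (Cons b bs')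
    then have b: "b \<in> Basis" "bs = [b]" using bs by auto
    have "\<bar>g (x + \<tau> *\<^sub>R b) - g x\<bar> \<le> K * \<bar>\<tau>\<bar>" for x \<tau>
      using Lip[of "x + \<tau> *\<^sub>R b" x] b(1) by simp
    then obtain h where h: "weak_derivative [b] g h" "h \<in> borel_measurable borel" "AE x in lborel. \<bar>h x\<bar> \<le> K"
      using ex_bounded_weak_derivative[OF g b(1)] by blast
    have "weak_derivative_norm (Lp_norm \<infinity>) bs g \<le> Lp_norm \<infinity> h"
      unfolding weak_derivative_norm_def b(2) by (intro INF_lower) (simp add: h)
    also have "\<dots> \<le> ennreal K" by (intro Lp_norm_infinity_le h(2)) (use h(3) in simp)
    finally show ?thesis by (simp add: le_less_trans)
  qed
  moreover have "finite {bs. set bs \<subseteq> (Basis :: 'a set) \<and> length bs \<le> 1}"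
    by (rule finite_lists_length_le) simp
  ultimately show ?thesis
    unfolding sobolev_norm_def infinity_ennreal_def by (subst ennreal_sum_less_top) auto
qed

lemma nn_integral_le_sobolev_norm:
  fixes g :: "'a::euclidean_space \<Rightarrow> real"
  shows "(\<integral>\<^sup>+x. ennreal \<bar>g x\<bar> \<partial>lborel) \<le> sobolev_norm 1 1 g"
proof -
  have "(\<integral>\<^sup>+x. ennreal \<bar>g x\<bar> \<partial>lborel) \<le> weak_derivative_norm (Lp_norm 1) [] g"
    unfolding weak_derivative_norm_def
  proof (rule INF_greatest)
    fix h assume "h \<in> {h. weak_derivative [] g h}"
    then have h: "AE x in lborel. g x = h x" using weak_derivative_Nil_AE_eq by blast
    have pw: "ennreal_powr a 1 = a" for a
      by (cases a) (auto simp: ennreal_powr_def)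
    have "Lp_norm 1 h = (if h \<in> borel_measurable borel then \<integral>\<^sup>+x. ennreal \<bar>h x\<bar> \<partial>lborel else \<infinity>)"
      by (simp add: Lp_norm_def pw)
    moreover have "(\<integral>\<^sup>+x. ennreal \<bar>h x\<bar> \<partial>lborel) = (\<integral>\<^sup>+x. ennreal \<bar>g x\<bar> \<partial>lborel)"
      using h by (intro nn_integral_cong_AE) (auto elim!: eventually_mono)
    ultimately show "(\<integral>\<^sup>+x. ennreal \<bar>g x\<bar> \<partial>lborel) \<le> Lp_norm 1 h" by simp
  qed
  also have "\<dots> \<le> sobolev_norm 1 1 g" by (rule weak_derivative_norm_le_sobolev_norm) auto
  finally show ?thesis .
qed

lemma integrable_if_sobolev_norm_finite:
  fixes g :: "'a::euclidean_space \<Rightarrow> real"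
  assumes "continuous_on UNIV g" "sobolev_norm 1 1 g < \<infinity>"
  shows "integrable lborel g"
proof (rule integrableI_bounded)
  show "(\<integral>\<^sup>+x. ennreal (norm (g x)) \<partial>lborel) < \<infinity>"
    using le_less_trans[OF nn_integral_le_sobolev_norm assms(2)] by simp
qed (use assms(1) in \<open>simp add: borel_measurable_continuous_onI\<close>)

lemma density_L1_le:
  fixes f1 f2 :: "'a::euclidean_space \<times> 'a \<Rightarrow> real"
  assumes "integrable lborel f1" "integrable lborel f2"
  shows "(LBINT x. \<bar>density f1 x - density f2 x\<bar>) \<le> (LBINT z. \<bar>f1 z - f2 z\<bar>)"
proof -
  have i: "integrable (lborel \<Otimes>\<^sub>M lborel) (\<lambda>(x, v). f1 (x, v))" "integrable (lborel \<Otimes>\<^sub>M lborel) (\<lambda>(x, v). f2 (x, v))"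
    using assms by (simp_all add: lborel_prod)
  have d: "integrable (lborel \<Otimes>\<^sub>M lborel) (\<lambda>(x, v). \<bar>f1 (x, v) - f2 (x, v)\<bar>)"
  proof -
    have "(\<lambda>(x, v). \<bar>f1 (x, v) - f2 (x, v)\<bar>) = (\<lambda>z. \<bar>f1 z - f2 z\<bar>)" by auto
    then show ?thesis using assms by (simp add: lborel_prod)
  qed
  have "(LBINT x. \<bar>density f1 x - density f2 x\<bar>) \<le> (LBINT x. LBINT v. \<bar>f1 (x, v) - f2 (x, v)\<bar>)"
  proof (rule integral_mono_AE)
    show "integrable lborel (\<lambda>x. \<bar>density f1 x - density f2 x\<bar>)"
      unfolding density_def
      by (intro integrable_abs Bochner_Integration.integrable_diff lborel_pair.integrable_fst i)
    show "integrable lborel (\<lambda>x. LBINT v. \<bar>f1 (x, v) - f2 (x, v)\<bar>)"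
      by (rule lborel_pair.integrable_fst[OF d])
    show "AE x in lborel. \<bar>density f1 x - density f2 x\<bar> \<le> (LBINT v. \<bar>f1 (x, v) - f2 (x, v)\<bar>)"
      using lborel_pair.AE_integrable_fst[OF i(1)] lborel_pair.AE_integrable_fst[OF i(2)]
    proof eventually_elim
      case (elim x)
      have "density f1 x - density f2 x = (LBINT v. f1 (x, v) - f2 (x, v))"
        unfolding density_def using elim by simp
      then show ?case by (simp only: integral_abs_bound)
    qed
  qed
  also have "\<dots> = (LBINT z. \<bar>f1 z - f2 z\<bar>)"
    unfolding lborel_pair.integral_fst[OF d] lborel_prod
    by (intro Bochner_Integration.integral_cong) auto
  finally show ?thesis .
qed

lemma steepness_bound_if_weak_gradient_norm_less:
  assumes "weak_gradient_norm (Lp_norm \<infinity>) \<rho> < ennreal A" "0 \<le> A"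
  shows "steepness_bound A \<rho>"
proof -
  obtain G where G: "weak_gradient \<rho> G" "Lp_norm \<infinity> G < ennreal A"
    using assms(1) by (auto simp: weak_gradient_norm_def INF_less_iff)
  have le: "AE x in lborel. norm (G x) \<le> A" by (rule Lp_norm_infinity_less(2)[OF G(2) assms(2)])
  show ?thesis
    unfolding steepness_bound_def
  proof (intro conjI ballI allI)
    fix b :: 'a and \<tau> assume b: "b \<in> Basis"
    have "AE x in lborel. \<bar>G x \<bullet> b\<bar> \<le> A"
      using le by eventually_elim (use Basis_le_norm[OF b] order_trans in blast)
    then show "AE y in lborel. \<bar>\<rho> (y + \<tau> *\<^sub>R b) - \<rho> y\<bar> \<le> A * \<bar>\<tau>\<bar>"
      using G(1) b by (intro weak_derivative_bounded_imp_AE_Lipschitz[of b \<rho> "\<lambda>x. G x \<bullet> b"])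
        (auto simp: weak_gradient_def)
  qed (fact assms)
qed


section \<open>The equilibrium and the initial datum are Lipschitz\<close>

lemma japanese_eq_norm: "japanese y = norm (1 :: real, y)"
  by (simp add: japanese_def norm_Pair)

lemma japanese_ge_1: "1 \<le> japanese y"
  by (simp add: japanese_def)

lemma japanese_Lipschitz: "\<bar>japanese x - japanese y\<bar> \<le> norm (x - y)"
  using norm_triangle_ineq3[of "(1 :: real, x)" "(1 :: real, y)"]
  by (simp add: japanese_eq_norm norm_Pair)

lemma continuous_japanese: "continuous_on UNIV japanese"
  unfolding japanese_def[abs_def] by (intro continuous_intros)

lemma powr_neg_Lipschitz:
  fixes a b k :: real
  assumes "1 \<le> a" "1 \<le> b" "0 \<le> k"
  shows "\<bar>a powr (- k) - b powr (- k)\<bar> \<le> k * \<bar>a - b\<bar>"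
proof -
  have "norm (a powr (- k) - b powr (- k)) \<le> k * norm (a - b)"
  proof (rule field_differentiable_bound[of "{1..}" "\<lambda>x. x powr (- k)" "\<lambda>x. - k * x powr (- k - 1)"])
    show "((\<lambda>x. x powr - k) has_real_derivative - k * x powr (- k - 1)) (at x within {1..})" if "x \<in> {1..}" for x
      by (rule has_field_derivative_at_within[OF has_real_derivative_powr]) (use that in simp)
    show "norm (- k * x powr (- k - 1)) \<le> k" if "x \<in> {1..}" for x
    proof -
      have "x powr (- k - 1) \<le> x powr 0" using that assms(3) by (intro powr_mono) auto
      then have "k * x powr (- k - 1) \<le> k * 1" using that assms(3) by (intro mult_left_mono) auto
      then show ?thesis using assms(3) by (simp add: abs_mult)
    qed
  qed (use assms in auto)
  then show ?thesis by simp
qed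

lemma smooth_has_derivative: "smooth g \<Longrightarrow> (g has_derivative frechet_derivative g (at x)) (at x)"
  using C_n.simps(2)[of 0 g] unfolding smooth_def by (metis frechet_derivative_works)

lemma inner_gradient:
  assumes "(g has_derivative D) (at x)"
  shows "u \<bullet> gradient g x = D u"
proof -
  interpret bounded_linear D using assms by (rule has_derivative_bounded_linear)
  have D: "frechet_derivative g (at x) = D" using frechet_derivative_at[OF assms] by simp
  have "D u = D (\<Sum>b\<in>Basis. (u \<bullet> b) *\<^sub>R b)" by (simp add: euclidean_representation)
  also have "\<dots> = (\<Sum>b\<in>Basis. (u \<bullet> b) * D b)" by (simp add: sum scaleR)
  finally show ?thesis
    by (simp add: gradient_def pderiv_dir_def D inner_sum_right mult.commute)
qed

text \<open>The weighted bound on \<open>\<nabla>\<mu>\<close> holds everywhere by continuity, and the weight is at least 1.\<close>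

lemma regular_equilibrium_Lipschitz:
  fixes \<mu> :: "'a::euclidean_space \<Rightarrow> real"
  assumes "regular_equilibrium \<mu>"
  obtains L where "L \<ge> 0" "\<And>x y. \<bar>\<mu> x - \<mu> y\<bar> \<le> L * norm (x - y)"
proof -
  have sm: "smooth \<mu>" using assms by (simp add: regular_equilibrium_def)
  obtain k0 where k0: "k0 > real DIM('a)"
    and N: "\<And>b. b \<in> Basis \<Longrightarrow> sobolev_norm 2 \<infinity> (\<lambda>v. japanese v powr k0 * pderiv_dir b \<mu> v) < \<infinity>"
    using assms by (auto simp: regular_equilibrium_def)
  have k0': "0 < k0" using k0 by linarith
  have "\<exists>c\<ge>0. \<forall>v. \<bar>pderiv_dir b \<mu> v\<bar> \<le> c" if b: "b \<in> Basis" for b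
  proof -
    let ?g = "\<lambda>v. japanese v powr k0 * pderiv_dir b \<mu> v"
    have "continuous_on UNIV (pderiv_dir b \<mu>)"
      using sm b C_n.simps(2)[of 0 \<mu>] unfolding smooth_def by (metis C_n.simps(1))
    then have cont: "continuous_on UNIV ?g"
    proof -
      have "japanese v \<noteq> 0" for v :: 'a using japanese_ge_1[of v] by linarith
      then show ?thesis using \<open>continuous_on UNIV (pderiv_dir b \<mu>)\<close>
        by (intro continuous_intros continuous_japanese) auto
    qed
    have fin: "weak_derivative_norm (Lp_norm \<infinity>) [] ?g < \<infinity>"
      using le_less_trans[OF weak_derivative_norm_le_sobolev_norm N[OF b]] by simp
    then obtain r where r: "weak_derivative_norm (Lp_norm \<infinity>) [] ?g = ennreal r" "0 \<le> r"
      by (cases "weak_derivative_norm (Lp_norm \<infinity>) [] ?g") auto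
    have "\<bar>?g v\<bar> \<le> r + 1" for v
      by (rule continuous_bounded_if_weak_norm_less[OF cont]) (use r in \<open>auto simp: r(1) ennreal_less_iff\<close>)
    moreover have "\<bar>pderiv_dir b \<mu> v\<bar> \<le> \<bar>?g v\<bar>" for v
    proof -
      have "1 \<le> japanese v powr k0" using japanese_ge_1[of v] k0' by (simp add: ge_one_powr_ge_zero)
      then show ?thesis using mult_right_mono[of 1 "japanese v powr k0" "\<bar>pderiv_dir b \<mu> v\<bar>"] by (simp add: abs_mult)
    qed
    ultimately show ?thesis using r(2) by (intro exI[of _ "r + 1"]) (auto intro: order_trans)
  qed
  then obtain c where c: "\<And>b. b \<in> Basis \<Longrightarrow> c b \<ge> 0" "\<And>b v. b \<in> Basis \<Longrightarrow> \<bar>pderiv_dir b \<mu> v\<bar> \<le> c b"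
    by metis
  define A where "A = (\<Sum>b\<in>(Basis::'a set). c b)"
  have A: "0 \<le> A" "\<And>b. b \<in> Basis \<Longrightarrow> c b \<le> A"
    unfolding A_def using c(1) by (auto intro: sum_nonneg member_le_sum)
  have "\<bar>\<mu> (y + \<tau> *\<^sub>R b) - \<mu> y\<bar> \<le> A * \<bar>\<tau>\<bar>" if b: "b \<in> Basis" for b y \<tau>
  proof -
    have "norm (\<mu> (y + \<tau> *\<^sub>R b) - \<mu> (y + 0 *\<^sub>R b)) \<le> A * norm (\<tau> - 0)"
    proof (rule field_differentiable_bound[of UNIV "\<lambda>\<theta>. \<mu> (y + \<theta> *\<^sub>R b)" "\<lambda>\<theta>. pderiv_dir b \<mu> (y + \<theta> *\<^sub>R b)"])
      show "((\<lambda>\<theta>. \<mu> (y + \<theta> *\<^sub>R b)) has_field_derivative pderiv_dir b \<mu> (y + z *\<^sub>R b)) (at z within UNIV)" for z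
        using has_derivative_along_line[OF smooth_has_derivative[OF sm]] by (simp add: pderiv_dir_def)
      show "norm (pderiv_dir b \<mu> (y + z *\<^sub>R b)) \<le> A" for z
        using c(2)[OF b, of "y + z *\<^sub>R b"] A(2)[OF b] by simp
    qed auto
    then show ?thesis by simp
  qed
  then show ?thesis
    using that[of "real DIM('a) * A"] A(1) Lipschitz_if_directional[of A \<mu>] by auto
qed

text \<open>Write \<open>f\<^sub>0 = \<langle>v\<rangle>\<^sup>-\<^sup>k F\<close>, where \<open>F\<close> is bounded and Lipschitz with constants \<open>2 \<epsilon>\<close> and the weight with
  constants 1 and \<open>k\<close>.\<close>

lemma initial_datum_bounds:
  fixes f0 :: "'a::euclidean_space \<times> 'a \<Rightarrow> real"
  assumes f0: "continuous_on UNIV f0" and \<epsilon>: "\<epsilon> > 0" and k: "k \<ge> 0"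
    and N: "sobolev_norm 1 \<infinity> (v_weight k f0) \<le> ennreal \<epsilon>"
  shows "\<bar>f0 z\<bar> \<le> 2 * \<epsilon>"
    and "\<bar>f0 z - f0 z'\<bar> \<le> real DIM('a \<times> 'a) * (2 * \<epsilon> * (1 + k)) * norm (z - z')"
proof -
  let ?F = "v_weight k f0"
  have j0: "japanese v \<noteq> 0" for v :: 'a using japanese_ge_1[of v] by linarith
  have cont: "continuous_on UNIV ?F"
    unfolding v_weight_def case_prod_beta using j0
    by (intro continuous_intros continuous_on_compose2[OF continuous_japanese]) (use f0 in auto)
  have less: "weak_derivative_norm (Lp_norm \<infinity>) bs ?F < ennreal (2 * \<epsilon>)" if "set bs \<subseteq> Basis" "length bs \<le> 1" for bs
  proof -
    have "weak_derivative_norm (Lp_norm \<infinity>) bs ?F \<le> ennreal \<epsilon>"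
      using weak_derivative_norm_le_sobolev_norm[OF that] N by (rule order_trans)
    also have "\<dots> < ennreal (2 * \<epsilon>)" using \<epsilon> by (simp add: ennreal_less_iff)
    finally show ?thesis .
  qed
  have F_le: "\<bar>?F z\<bar> \<le> 2 * \<epsilon>" for z
    by (rule continuous_bounded_if_weak_norm_less[OF cont]) (use less[of "[]"] \<epsilon> in auto)
  have F_Lip: "\<bar>?F (z + \<tau> *\<^sub>R b) - ?F z\<bar> \<le> 2 * \<epsilon> * \<bar>\<tau>\<bar>" if "b \<in> Basis" for b z \<tau>
    by (rule continuous_Lipschitz_if_weak_norm_less[OF cont that]) (use less[of "[b]"] \<epsilon> that in auto)
  let ?w = "\<lambda>z::'a \<times> 'a. japanese (snd z) powr (- k)"
  have f0_eq: "f0 z = ?w z * ?F z" for z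
    using j0 by (simp add: v_weight_def case_prod_beta powr_minus)
  have w: "0 \<le> ?w z" "?w z \<le> 1" for z
    using powr_mono[of "- k" 0 "japanese (snd z)"] k japanese_ge_1[of "snd z"] by auto
  show "\<bar>f0 z\<bar> \<le> 2 * \<epsilon>" for z
    unfolding f0_eq[of z] abs_mult using mult_mono[OF w(2)[of z] F_le[of z]] w(1)[of z] by simp
  have "\<bar>f0 (z + \<tau> *\<^sub>R b) - f0 z\<bar> \<le> 2 * \<epsilon> * (1 + k) * \<bar>\<tau>\<bar>" if b: "b \<in> Basis" for b z \<tau>
  proof -
    let ?z = "z + \<tau> *\<^sub>R b"
    have "norm (snd ?z - snd z) \<le> \<bar>\<tau>\<bar>"
      using norm_snd_le[of "snd b" "fst b"] b by (simp add: mult_left_le)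
    then have "\<bar>japanese (snd ?z) - japanese (snd z)\<bar> \<le> \<bar>\<tau>\<bar>"
      using japanese_Lipschitz order_trans by blast
    then have "k * \<bar>japanese (snd ?z) - japanese (snd z)\<bar> \<le> k * \<bar>\<tau>\<bar>"
      using k by (rule mult_left_mono)
    then have wd: "\<bar>?w ?z - ?w z\<bar> \<le> k * \<bar>\<tau>\<bar>"
      using powr_neg_Lipschitz[OF japanese_ge_1 japanese_ge_1 k] order_trans by blast
    have "f0 ?z - f0 z = ?w ?z * (?F ?z - ?F z) + (?w ?z - ?w z) * ?F z"
      unfolding f0_eq[of ?z] f0_eq[of z] by (simp add: algebra_simps)
    also have "\<bar>\<dots>\<bar> \<le> 1 * (2 * \<epsilon> * \<bar>\<tau>\<bar>) + k * \<bar>\<tau>\<bar> * (2 * \<epsilon>)"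
      using w[of ?z] k by (intro order_trans[OF abs_triangle_ineq] add_mono;
          unfold abs_mult; intro mult_mono wd F_le F_Lip b) auto
    finally show ?thesis by (simp add: algebra_simps)
  qed
  then show "\<bar>f0 z - f0 z'\<bar> \<le> real DIM('a \<times> 'a) * (2 * \<epsilon> * (1 + k)) * norm (z - z')"
    using \<epsilon> k by (intro Lipschitz_if_directional) auto
qed


section \<open>The weight \<open>log (2 + t) / (2 + t)\<^sup>n\<close>\<close>

text \<open>The derivative of \<open>- (ln (2 + \<sigma>) + 1) / (2 + \<sigma>)\<^sup>m\<close> dominates the integrand.\<close>

lemma log_tail:
  fixes T :: real
  assumes T: "T \<ge> 0" and m: "m \<ge> 1"
  shows "integrable lborel (\<lambda>\<sigma>. indicator {T..} \<sigma> * (ln (2 + \<sigma>) / (2 + \<sigma>) ^ Suc m))"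
    and "(LBINT \<sigma>. indicator {T..} \<sigma> * (ln (2 + \<sigma>) / (2 + \<sigma>) ^ Suc m)) \<le> (ln (2 + T) + 1) / (2 + T) ^ m"
proof -
  let ?G = "\<lambda>\<sigma>::real. (ln (2 + \<sigma>) + 1) / (2 + \<sigma>) ^ m"
  let ?f = "\<lambda>\<sigma>::real. (real m * (ln (2 + \<sigma>) + 1) - 1) / (2 + \<sigma>) ^ Suc m"
  have ln0: "0 \<le> ln (2 + \<sigma>)" if "T \<le> \<sigma>" for \<sigma> :: real using that T by simp
  have le: "ln (2 + \<sigma>) / (2 + \<sigma>) ^ Suc m \<le> ?f \<sigma>" if "T \<le> \<sigma>" for \<sigma>
  proof -
    have "1 * (ln (2 + \<sigma>) + 1) \<le> real m * (ln (2 + \<sigma>) + 1)"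
      using m ln0[OF that] by (intro mult_right_mono) auto
    then show ?thesis using that T by (intro divide_right_mono) auto
  qed
  have "(\<integral>\<^sup>+\<sigma>. ennreal (?f \<sigma>) * indicator {T..} \<sigma> \<partial>lborel) = 0 - (- ?G T)"
  proof (rule nn_integral_FTC_atLeast)
    show "?f \<in> borel_measurable borel" by measurable
    show "((\<lambda>\<sigma>. - ?G \<sigma>) has_real_derivative ?f \<sigma>) (at \<sigma>)" if "T \<le> \<sigma>" for \<sigma>
    proof -
      have p: "2 + \<sigma> > 0" using that T by linarith
      have "((\<lambda>\<sigma>. - ?G \<sigma>) has_real_derivative
          - ((1 / (2 + \<sigma>) * (2 + \<sigma>) ^ m - (ln (2 + \<sigma>) + 1) * (real m * (2 + \<sigma>) ^ (m - 1))) / ((2 + \<sigma>) ^ m * (2 + \<sigma>) ^ m))) (at \<sigma>)"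
        using p by (auto intro!: derivative_eq_intros)
      also have "- ((1 / (2 + \<sigma>) * (2 + \<sigma>) ^ m - (ln (2 + \<sigma>) + 1) * (real m * (2 + \<sigma>) ^ (m - 1))) / ((2 + \<sigma>) ^ m * (2 + \<sigma>) ^ m)) = ?f \<sigma>"
      proof -
        obtain j where j: "m = Suc j" using m by (cases m) auto
        obtain r where r: "2 + \<sigma> = r" "r > 0" using p by blast
        show ?thesis unfolding j r(1) using r(2) by (simp add: field_simps)
      qed
      finally show ?thesis .
    qed
    show "0 \<le> ?f \<sigma>" if "T \<le> \<sigma>" for \<sigma>
      using le[OF that] ln0[OF that] that T by (auto intro: order_trans[rotated])
    have "(?G \<longlongrightarrow> 0) at_top"
    proof (rule tendsto_sandwich[OF _ _ tendsto_const])
      show "((\<lambda>\<sigma>::real. (ln (2 + \<sigma>) + 1) / (2 + \<sigma>)) \<longlongrightarrow> 0) at_top" by real_asymp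
      show "eventually (\<lambda>\<sigma>. 0 \<le> ?G \<sigma>) at_top"
        using eventually_ge_at_top[of T] by eventually_elim (use ln0 T in auto)
      show "eventually (\<lambda>\<sigma>. ?G \<sigma> \<le> (ln (2 + \<sigma>) + 1) / (2 + \<sigma>)) at_top"
        using eventually_ge_at_top[of T]
      proof eventually_elim
        case (elim \<sigma>)
        have "(2 + \<sigma>) ^ 1 \<le> (2 + \<sigma>) ^ m" using m elim T by (intro power_increasing) auto
        then show ?case using ln0[OF elim] elim T by (intro divide_left_mono) auto
      qed
    qed
    from tendsto_minus[OF this] show "((\<lambda>\<sigma>. - ?G \<sigma>) \<longlongrightarrow> 0) at_top" by simp
  qed
  then have nn: "(\<integral>\<^sup>+\<sigma>. ennreal (?f \<sigma>) * indicator {T..} \<sigma> \<partial>lborel) = ennreal (?G T)" by simp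
  let ?h = "\<lambda>\<sigma>. indicator {T..} \<sigma> * (ln (2 + \<sigma>) / (2 + \<sigma>) ^ Suc m)"
  have h0: "0 \<le> ?h \<sigma>" for \<sigma> using ln0 T by (auto simp: indicator_def)
  have le2: "(\<integral>\<^sup>+\<sigma>. ennreal (?h \<sigma>) \<partial>lborel) \<le> ennreal (?G T)"
    unfolding nn[symmetric] using le by (intro nn_integral_mono) (auto simp: indicator_def intro!: ennreal_leI)
  show i: "integrable lborel ?h"
    by (rule integrableI_nonneg) (use h0 le_less_trans[OF le2] in auto)
  have "ennreal (LBINT \<sigma>. ?h \<sigma>) \<le> ennreal (?G T)"
    using nn_integral_eq_integral[OF i] h0 le2 by simp
  moreover have "0 \<le> ?G T" using ln0[of T] T by simp
  ultimately show "(LBINT \<sigma>. ?h \<sigma>) \<le> ?G T" by (simp add: ennreal_le_iff)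
qed


section \<open>The field of a solution\<close>

lemma continuous_if_uniform_in_time:
  fixes E :: "real \<Rightarrow> 'a::euclidean_space \<Rightarrow> 'a"
  assumes Lip: "\<And>t x y. norm (E t x - E t y) \<le> K * norm (x - y)" and K: "K \<ge> 0"
    and time: "\<And>t \<kappa>. \<kappa> > 0 \<Longrightarrow> \<exists>d>0. \<forall>s. \<bar>s - t\<bar> < d \<longrightarrow> (\<forall>x. norm (E s x - E t x) \<le> \<kappa>)"
  shows "continuous_on UNIV (\<lambda>(t, x). E t x)"
  unfolding continuous_on_iff
proof (intro ballI allI impI)
  fix p :: "real \<times> 'a" and e :: real
  assume e: "e > 0"
  obtain t x where p: "p = (t, x)" by force
  obtain d where d: "d > 0" "\<And>s y. \<bar>s - t\<bar> < d \<Longrightarrow> norm (E s y - E t y) \<le> e / 3"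
    using time[of "e / 3" t] e by auto
  define r where "r = min d (e / (3 * (K + 1)))"
  have r: "r > 0" using d(1) e K by (simp add: r_def)
  show "\<exists>d>0. \<forall>q\<in>UNIV. dist q p < d \<longrightarrow> dist (case q of (t, x) \<Rightarrow> E t x) (case p of (t, x) \<Rightarrow> E t x) < e"
  proof (intro exI conjI ballI impI)
    show "r > 0" by (rule r)
    fix q assume q: "dist q p < r"
    obtain s y where sy: "q = (s, y)" by force
    have s: "\<bar>s - t\<bar> < d" using q dist_fst_le[of q p] by (simp add: p sy r_def dist_real_def)
    have y: "norm (y - x) \<le> e / (3 * (K + 1))" using q dist_snd_le[of q p] by (simp add: p sy r_def dist_norm)
    have "K * norm (y - x) \<le> (K + 1) * (e / (3 * (K + 1)))"
      using y K by (intro mult_mono) auto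
    also have "\<dots> = e / 3" using K by (simp add: field_simps)
    finally have "norm (E t y - E t x) \<le> e / 3" using Lip[of t y x] by linarith
    then have "norm (E s y - E t x) \<le> e / 3 + e / 3"
      by (rule norm_diff_triangle_le[OF d(2)[OF s]])
    then show "dist (case q of (t, x) \<Rightarrow> E t x) (case p of (t, x) \<Rightarrow> E t x) < e"
      using e by (simp add: p sy dist_norm)
  qed
qed

lemma two_plus_le_japanese:
  assumes "t \<ge> 0"
  shows "2 + t \<le> 3 * japanese t" "japanese t \<le> 2 + t"
proof -
  have "(2 + t)\<^sup>2 = 4 + 4 * t + t * t" "(3 * japanese t)\<^sup>2 = 9 + 9 * (t * t)" "(2 * t - 1)\<^sup>2 = 4 * (t * t) - 4 * t + 1"
    by (simp_all add: japanese_def power_mult_distrib power2_eq_square algebra_simps)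
  then have "(2 + t)\<^sup>2 \<le> (3 * japanese t)\<^sup>2"
    using zero_le_power2[of "2 * t - 1"] zero_le_square[of t] by linarith
  then show "2 + t \<le> 3 * japanese t"
    by (rule power2_le_imp_le) (simp add: japanese_def)
  show "japanese t \<le> 2 + t"
    unfolding japanese_def using assms by (intro real_le_lsqrt) (auto simp: power2_eq_square algebra_simps)
qed

text \<open>The factor 2 turns the density estimate into a strict bound for the weak gradient norm, and the
  powers of 3 come from \<open>2 + t \<le> 3 \<langle>t\<rangle>\<close>.\<close>

lemma steepness_bound_density:
  fixes f :: "real \<Rightarrow> 'a::euclidean_space \<times> 'a \<Rightarrow> real"
  assumes d: "density_decay M \<epsilon> f" and M: "M > 0" "\<epsilon> > 0" and t: "t \<ge> 0"
  shows "steepness_bound (2 * M * 3 ^ Suc DIM('a) * \<epsilon> * (ln (2 + t) / (2 + t) ^ Suc DIM('a))) (density (f t))"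
proof -
  let ?n = "Suc DIM('a)"
  let ?N = "weak_gradient_norm (Lp_norm \<infinity>) (density (f t))"
  define J where "J = japanese t ^ ?n"
  define b where "b = M * \<epsilon> * ln (2 + t)"
  have ln: "ln (2 + t) > 0" using t by simp
  have b: "b > 0" using M ln by (simp add: b_def)
  have J: "J > 0" using japanese_ge_1[of t] by (auto simp: J_def intro!: zero_less_power less_le_trans[OF zero_less_one])
  have "ennreal J * ?N \<le> ennreal b"
    using d t unfolding density_decay_def Let_def
    by (auto simp: J_def b_def dest!: spec[of _ t] intro: order_trans[rotated])
  have less: "?N < ennreal (2 * b / J)"
  proof (rule ccontr)
    assume "\<not> ?N < ennreal (2 * b / J)"
    then have "ennreal J * ennreal (2 * b / J) \<le> ennreal J * ?N" by (intro mult_left_mono) auto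
    also have "\<dots> \<le> ennreal b" by fact
    finally show False using J b by (simp flip: ennreal_mult' add: ennreal_le_iff)
  qed
  have "steepness_bound (2 * b / J) (density (f t))"
    by (rule steepness_bound_if_weak_gradient_norm_less[OF less]) (use b J in auto)
  moreover have "2 * b / J \<le> 2 * M * 3 ^ ?n * \<epsilon> * (ln (2 + t) / (2 + t) ^ ?n)"
  proof -
    have "(2 + t) ^ ?n \<le> (3 * japanese t) ^ ?n"
      using two_plus_le_japanese(1)[OF t] t by (intro power_mono) auto
    also have "\<dots> = 3 ^ ?n * J" by (simp only: power_mult_distrib J_def)
    finally have le: "(2 + t) ^ ?n \<le> 3 ^ ?n * J" .
    have "2 * b / J = 2 * b * 3 ^ ?n / (3 ^ ?n * J)" using J by simp
    also have "\<dots> \<le> 2 * b * 3 ^ ?n / (2 + t) ^ ?n"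
      using le b t J by (intro divide_left_mono) (auto intro!: mult_pos_pos)
    finally show ?thesis by (simp add: b_def mult_ac)
  qed
  ultimately show ?thesis by (rule steepness_bound_mono)
qed

lemma classical_solution_continuous:
  assumes "classical_solution \<mu> f0 f" "t \<ge> 0"
  shows "continuous_on UNIV (f t)"
proof -
  have "continuous_on ({0..} \<times> UNIV) (\<lambda>(t, z). f t z)"
    unfolding continuous_on_eq_continuous_within
  proof
    fix p :: "real \<times> 'a \<times> 'a" assume "p \<in> {0..} \<times> UNIV"
    then obtain s x v where p: "p = (s, x, v)" "s \<ge> 0" by (cases p) auto
    obtain ft fx fv where "((\<lambda>(t, z). f t z) has_derivative
        (\<lambda>(\<tau>, y, w). \<tau> * ft s (x, v) + y \<bullet> fx s (x, v) + w \<bullet> fv s (x, v))) (at (s, x, v) within {0..} \<times> UNIV)"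
      using assms(1) p(2) unfolding classical_solution_def by blast
    then show "continuous (at p within {0..} \<times> UNIV) (\<lambda>(t, z). f t z)"
      unfolding p(1) by (rule has_derivative_continuous)
  qed
  moreover have "continuous_on UNIV (\<lambda>z :: 'a \<times> 'a. (t, z))" by (intro continuous_intros)
  ultimately have "continuous_on UNIV (\<lambda>z. case (t, z) of (t, z) \<Rightarrow> f t z)"
    by (rule continuous_on_compose2) (use assms(2) in auto)
  then show ?thesis by simp
qed

lemma density_L1_continuous:
  fixes f :: "real \<Rightarrow> 'a::euclidean_space \<times> 'a \<Rightarrow> real"
  assumes sol: "classical_solution \<mu> f0 f" and cont: "continuous_in_time (sobolev_norm 1 1) f"
    and t: "t \<ge> 0" and \<eta>: "\<eta> > 0"
  obtains d where "d > 0" "\<And>s. s \<ge> 0 \<Longrightarrow> \<bar>s - t\<bar> < d \<Longrightarrow> (LBINT x. \<bar>density (f s) x - density (f t) x\<bar>) \<le> \<eta>"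
proof -
  have int: "integrable lborel (f s)" if "s \<ge> 0" for s
    using integrable_if_sobolev_norm_finite[OF classical_solution_continuous[OF sol that]] cont that
    by (simp add: continuous_in_time_def)
  have "((\<lambda>s. sobolev_norm 1 1 (\<lambda>z. f s z - f t z)) \<longlongrightarrow> 0) (at t within {0..})"
    using cont t by (simp add: continuous_in_time_def)
  then have "eventually (\<lambda>s. sobolev_norm 1 1 (\<lambda>z. f s z - f t z) < ennreal \<eta>) (at t within {0..})"
    using \<eta> by (intro order_tendstoD(2)) auto
  then obtain d where d: "d > 0"
    "\<And>s. s \<in> {0..} \<Longrightarrow> s \<noteq> t \<Longrightarrow> dist s t < d \<Longrightarrow> sobolev_norm 1 1 (\<lambda>z. f s z - f t z) < ennreal \<eta>"
    unfolding eventually_at by blast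
  show ?thesis
  proof (rule that[OF d(1)])
    fix s assume s: "s \<ge> 0" "\<bar>s - t\<bar> < d"
    show "(LBINT x. \<bar>density (f s) x - density (f t) x\<bar>) \<le> \<eta>"
    proof (cases "s = t")
      case False
      have "ennreal (LBINT z. \<bar>f s z - f t z\<bar>) = (\<integral>\<^sup>+z. ennreal \<bar>f s z - f t z\<bar> \<partial>lborel)"
        using int[OF s(1)] int[OF t] by (intro nn_integral_eq_integral[symmetric]) auto
      also have "\<dots> \<le> sobolev_norm 1 1 (\<lambda>z. f s z - f t z)" by (rule nn_integral_le_sobolev_norm)
      also have "\<dots> \<le> ennreal \<eta>" using d(2)[of s] s False by (simp add: dist_real_def less_imp_le)
      finally have "(LBINT z. \<bar>f s z - f t z\<bar>) \<le> \<eta>" using \<eta> by (simp add: ennreal_le_iff)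
      then show ?thesis using density_L1_le[OF int[OF s(1)] int[OF t]] by linarith
    qed (use \<eta> in simp)
  qed
qed

text \<open>Continuity of \<open>f\<close> in time with values in \<open>L\<^sup>1\<close> passes to the density, and the difference of two fields is
  the field of the difference of the densities. The force is frozen for negative times.\<close>

lemma field_continuous:
  fixes f :: "real \<Rightarrow> 'a::euclidean_space \<times> 'a \<Rightarrow> real"
  assumes sol: "classical_solution \<mu> f0 f" and cont: "continuous_in_time (sobolev_norm 1 1) f"
    and A: "A \<ge> 0" "\<And>t. t \<ge> 0 \<Longrightarrow> steepness_bound A (density (f t))"
    and field: "\<And>t. t \<ge> 0 \<Longrightarrow> \<exists>\<phi>. field_of (density (f t)) \<phi> (E t)"
  shows "continuous_on UNIV (\<lambda>(t, x). E (max t 0) x)"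
proof (rule continuous_if_uniform_in_time)
  show "norm (E (max t 0) x - E (max t 0) y) \<le> real DIM('a) * (6 * A) * norm (x - y)" for t x y
  proof -
    have "max t 0 \<ge> 0" by simp
    from field[OF this] obtain \<phi> where "field_of (density (f (max t 0))) \<phi> (E (max t 0))" by blast
    from field_Lipschitz[OF this A(2), of x y] show ?thesis by (simp add: mult_ac)
  qed
  show "0 \<le> real DIM('a) * (6 * A)" using A by simp
  fix t \<kappa> :: real assume \<kappa>: "\<kappa> > 0"
  obtain \<eta> where \<eta>: "\<eta> > 0" "\<And>(\<rho> :: 'a \<Rightarrow> real) \<phi> E x. field_of \<rho> \<phi> E \<Longrightarrow> steepness_bound (A + A) \<rho> \<Longrightarrow>
       (LBINT y. \<bar>\<rho> y\<bar>) \<le> \<eta> \<Longrightarrow> norm (E x) \<le> \<kappa>"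
    by (rule field_small_if_density_L1_small[where 'a='a, OF add_nonneg_nonneg[OF A(1) A(1)] \<kappa>])
      (rule that; assumption)
  have t0: "max t 0 \<ge> 0" by simp
  obtain d where d: "d > 0" "\<And>s. s \<ge> 0 \<Longrightarrow> \<bar>s - max t 0\<bar> < d \<Longrightarrow>
      (LBINT x. \<bar>density (f s) x - density (f (max t 0)) x\<bar>) \<le> \<eta>"
    using density_L1_continuous[OF sol cont t0 \<eta>(1)] by metis
  show "\<exists>d>0. \<forall>s. \<bar>s - t\<bar> < d \<longrightarrow> (\<forall>x. norm (E (max s 0) x - E (max t 0) x) \<le> \<kappa>)"
  proof (intro exI[of _ d] conjI d(1) allI impI)
    fix s x assume s: "\<bar>s - t\<bar> < d"
    have s0: "max s 0 \<ge> 0" by simp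
    obtain \<phi>s \<phi>t where "field_of (density (f (max s 0))) \<phi>s (E (max s 0))"
      "field_of (density (f (max t 0))) \<phi>t (E (max t 0))"
      using field[OF s0] field[OF t0] by blast
    note F = field_of_diff[OF this]
    show "norm (E (max s 0) x - E (max t 0) x) \<le> \<kappa>"
    proof (rule \<eta>(2)[OF F])
      show "steepness_bound (A + A) (\<lambda>x. density (f (max s 0)) x - density (f (max t 0)) x)"
        by (intro steepness_bound_diff A s0 t0)
      show "(LBINT y. \<bar>density (f (max s 0)) y - density (f (max t 0)) y\<bar>) \<le> \<eta>"
        using s by (intro d(2) s0) linarith
    qed
  qed
qed


section \<open>Scattering of small solutions\<close>

text \<open>The size of the force is \<open>\<delta> = C1 \<epsilon>\<close>: the factor \<open>2 M 3\<^sup>d\<^sup>+\<^sup>1\<close> is the one in the bound for the density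
  gradient, and \<open>6 d\<close> the one in the Lipschitz bound for the field. The constant \<open>K0\<close> is a Lipschitz constant
  of \<open>f\<^sub>0\<close>, as \<open>\<epsilon> \<le> 1\<close>. Replacing the shifts at time \<open>t\<close> by those at infinity costs \<open>4 \<delta> tail t\<close> in the argument
  of \<open>f\<^sub>0\<close> and \<open>2 \<delta> tail t\<close> in the one of \<open>\<mu>\<close>, where \<open>tail t\<close> is at most three times the claimed rate.\<close>

lemma solution_scatters:
  fixes \<mu> :: "'a::euclidean_space \<Rightarrow> real" and f0 :: "'a \<times> 'a \<Rightarrow> real"
    and f :: "real \<Rightarrow> 'a \<times> 'a \<Rightarrow> real" and M k L \<epsilon> :: real
  defines "C1 \<equiv> 12 * real DIM('a) * M * 3 ^ Suc DIM('a)"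
    and "K0 \<equiv> real DIM('a \<times> 'a) * (2 * (1 + k))"
  assumes dim: "DIM('a) \<ge> 3"
    and \<mu>: "smooth \<mu>" "\<And>x y. \<bar>\<mu> x - \<mu> y\<bar> \<le> L * norm (x - y)" and L: "L \<ge> 0"
    and k: "k \<ge> 0" and M: "M > 0" and \<epsilon>: "\<epsilon> > 0" "\<epsilon> \<le> 1" "C1 * \<epsilon> \<le> 1 / 2"
    and f0: "sobolev_norm 1 \<infinity> (v_weight k f0) \<le> ennreal \<epsilon>"
    and sol: "classical_solution \<mu> f0 f" and cont: "continuous_in_time (sobolev_norm 1 1) f"
    and decay: "density_decay M \<epsilon> f"
  shows "\<exists>Y W. Lp_norm \<infinity> Y + Lp_norm \<infinity> W \<le> ennreal (2 * C1 * \<epsilon>) \<and>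
     (let f_inf = (\<lambda>(x, v). f0 (x + Y (x, v), v + W (x, v)) + \<mu> (v + W (x, v)) - \<mu> v) in
        sobolev_norm 1 \<infinity> f_inf < \<infinity> \<and>
        (\<forall>t\<ge>0. Lp_norm \<infinity> (\<lambda>(x, v). f t (x + t *\<^sub>R v, v) - f_inf (x, v))
           \<le> ennreal ((12 * K0 + 6 * L) * C1 * \<epsilon> * (ln (2 + t) / japanese t ^ (DIM('a) - 1)))))"
proof -
  let ?n = "DIM('a)"
  define w where "w t = ln (2 + t) / (2 + t) ^ Suc ?n" for t :: real
  define \<delta> where "\<delta> = C1 * \<epsilon>"
  have C1: "C1 > 0" using M by (simp add: C1_def)
  obtain ft fx fv E where
    der': "\<forall>t\<ge>0. \<forall>x v. ((\<lambda>(t, z). f t z) has_derivative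
              (\<lambda>(\<tau>, y, w). \<tau> * ft t (x, v) + y \<bullet> fx t (x, v) + w \<bullet> fv t (x, v))) (at (t, x, v) within {0..} \<times> UNIV)"
    and sf: "\<forall>t\<ge>0. screened_field (density (f t)) (E t)"
    and eqn: "\<forall>t\<ge>0. \<forall>x v. ft t (x, v) + v \<bullet> fx t (x, v) + E t x \<bullet> gradient \<mu> v = - (E t x \<bullet> fv t (x, v))"
    using sol unfolding classical_solution_def by (elim exE conjE) (rule that; assumption)
  have der: "((\<lambda>(t, z). f t z) has_derivative
              (\<lambda>(\<tau>, y, w). \<tau> * ft t (x, v) + y \<bullet> fx t (x, v) + w \<bullet> fv t (x, v))) (at (t, x, v) within {0..} \<times> UNIV)"
    if "t \<ge> 0" for t x v
    by (rule der'[rule_format, OF that])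
  have "\<forall>z. f 0 z = f0 z"
    using sol unfolding classical_solution_def by (rule conjunct2)
  then have f_0: "f 0 = f0" by (simp add: fun_eq_iff)
  have field: "\<exists>\<phi>. field_of (density (f t)) \<phi> (E t)" if "t \<ge> 0" for t
    using sf that by (simp add: screened_field_def field_of_def)
  let ?A = "\<lambda>t. 2 * M * 3 ^ Suc ?n * \<epsilon> * w t"
  have steep: "steepness_bound (?A t) (density (f t))" if "t \<ge> 0" for t
    unfolding w_def by (rule steepness_bound_density[OF decay M \<epsilon>(1) that])
  have w0: "0 \<le> w t" if "t \<ge> 0" for t using that by (simp add: w_def)
  have w1: "w t \<le> 1" if "t \<ge> 0" for t
  proof -
    have "ln (2 + t) \<le> 2 + t - 1" using that by (intro ln_le_minus_one) auto
    also have "\<dots> \<le> (2 + t) ^ 1" by simp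
    also have "\<dots> \<le> (2 + t) ^ Suc ?n" using that by (intro power_increasing) auto
    finally show ?thesis using that by (simp add: w_def divide_le_eq_1)
  qed
  have steep1: "steepness_bound (2 * M * 3 ^ Suc ?n * \<epsilon>) (density (f t))" if "t \<ge> 0" for t
    using steep[OF that] by (rule steepness_bound_mono) (use M \<epsilon> w1[OF that] in \<open>simp add: mult_left_le\<close>)
  \<comment> \<open>the locale wants a force that is defined and continuous for all times\<close>
  define E' where "E' t = E (max t 0)" for t
  interpret decaying_force E' \<delta> w
  proof
    show "continuous_on UNIV (\<lambda>(t, x). E' t x)"
      unfolding E'_def using M \<epsilon> by (intro field_continuous[OF sol cont _ steep1 field]) auto
    fix t :: real and x y :: 'a assume t: "t \<ge> 0"
    obtain \<phi> where \<phi>: "field_of (density (f t)) \<phi> (E t)" using field[OF t] by blast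
    have "norm (E t x) \<le> real ?n * ?A t" by (rule field_bound[OF \<phi> steep[OF t]])
    also have "\<dots> \<le> 6 * (real ?n * ?A t)"
      using M \<epsilon> w0[OF t] by simp
    also have "\<dots> = \<delta> * w t" by (simp add: \<delta>_def C1_def mult_ac)
    finally show "norm (E' t x) \<le> \<delta> * w t" using t by (simp add: E'_def)
    have "norm (E t x - E t y) \<le> real ?n * (6 * ?A t * norm (x - y))"
      by (rule field_Lipschitz[OF \<phi> steep[OF t]])
    also have "\<dots> = \<delta> * w t * norm (x - y)" by (simp add: \<delta>_def C1_def mult_ac)
    finally show "norm (E' t x - E' t y) \<le> \<delta> * w t * norm (x - y)" using t by (simp add: E'_def)
  next
    \<comment> \<open>this is where dimension at least 3 enters: with both moments there remains a power \<open>m + 1 \<ge> 2\<close> of \<open>2 + t\<close>\<close>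
    obtain m where m: "?n = Suc (Suc m)" "m \<ge> 1"
      using dim by (metis Suc_le_D Suc_le_mono numeral_3_eq_3 One_nat_def)
    have eq: "indicator {0..} t * ((2 + t)\<^sup>2 * w t) = indicator {0..} t * (ln (2 + t) / (2 + t) ^ Suc m)" for t :: real
    proof (cases "t \<ge> 0")
      case True
      then obtain r where r: "2 + t = r" "r > 0" by simp
      show ?thesis unfolding w_def m(1) r(1) using r(2) by (simp add: power2_eq_square)
    qed simp
    show "integrable lborel (\<lambda>t. indicator {0..} t * ((2 + t)\<^sup>2 * w t))"
      unfolding eq by (rule log_tail(1)[OF _ m(2)]) simp
    have "(LBINT t. indicator {0..} t * ((2 + t)\<^sup>2 * w t)) \<le> (ln (2 + 0) + 1) / (2 + 0) ^ m"
      unfolding eq by (rule log_tail(2)[OF _ m(2)]) simp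
    also have "\<dots> \<le> 2 / 2"
    proof (rule frac_le)
      show "ln (2 + 0) + 1 \<le> (2 :: real)" using ln2_le_25_over_36 by simp
      have "(2::real) ^ 1 \<le> 2 ^ m" by (rule power_increasing) (use m in auto)
      then show "(2::real) \<le> (2 + 0) ^ m" by simp
    qed auto
    finally show "(LBINT t. indicator {0..} t * ((2 + t)\<^sup>2 * w t)) \<le> 1" by simp
    show "0 \<le> \<delta>" using C1 \<epsilon> by (simp add: \<delta>_def)
    show "\<delta> \<le> 1 / 2" using \<epsilon>(3) by (simp add: \<delta>_def)
  qed (rule w0)
  have tail_le: "tail t \<le> 3 * (ln (2 + t) / japanese t ^ (?n - 1))" if t: "t \<ge> 0" for t
  proof -
    obtain m where m: "?n = Suc m" "m \<ge> 1" using dim by (cases ?n) auto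
    have eq: "(2 + \<sigma>) * w \<sigma> = ln (2 + \<sigma>) / (2 + \<sigma>) ^ Suc m" if "\<sigma> \<ge> 0" for \<sigma>
    proof -
      obtain r where r: "2 + \<sigma> = r" "r > 0" using \<open>\<sigma> \<ge> 0\<close> by simp
      show ?thesis unfolding w_def m(1) r(1) using r(2) by simp
    qed
    have "tail t \<le> (LBINT \<sigma>. indicator {t..} \<sigma> * (ln (2 + \<sigma>) / (2 + \<sigma>) ^ Suc m))"
      unfolding tail_def
    proof (rule integral_mono)
      show "integrable lborel (\<lambda>\<sigma>. indicator {t<..} \<sigma> * ((2 + \<sigma>) * w \<sigma>))"
        using t by (intro w_moments) auto
      show "integrable lborel (\<lambda>\<sigma>. indicator {t..} \<sigma> * (ln (2 + \<sigma>) / (2 + \<sigma>) ^ Suc m))"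
        by (rule log_tail(1)[OF t m(2)])
      show "indicator {t<..} \<sigma> * ((2 + \<sigma>) * w \<sigma>) \<le> indicator {t..} \<sigma> * (ln (2 + \<sigma>) / (2 + \<sigma>) ^ Suc m)" for \<sigma>
        using t eq[of \<sigma>] by (auto simp: indicator_def)
    qed
    also have "\<dots> \<le> (ln (2 + t) + 1) / (2 + t) ^ m" by (rule log_tail(2)[OF t m(2)])
    also have "\<dots> \<le> (3 * ln (2 + t)) / japanese t ^ m"
    proof (rule frac_le)
      have "1 / 2 \<le> ln (2::real)" using ln2_ge_two_thirds by simp
      also have "\<dots> \<le> ln (2 + t)" using t by simp
      finally show "ln (2 + t) + 1 \<le> 3 * ln (2 + t)" by simp
      show "0 \<le> 3 * ln (2 + t)" using t by simp
      show "0 < japanese t ^ m" using japanese_ge_1[of t] by (auto intro!: zero_less_power)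
      show "japanese t ^ m \<le> (2 + t) ^ m"
        using two_plus_le_japanese(2)[OF t] japanese_ge_1[of t] by (intro power_mono) auto
    qed
    finally show ?thesis by (simp add: m(1))
  qed
  have S: "{0::real..} \<in> sets borel" "{0..} \<subseteq> {0::real..}" by auto
  define Y where "Y = (\<lambda>(x, v). position_shift {0..} x v)"
  define W where "W = (\<lambda>(x, v). velocity_shift {0..} x v)"
  have Y_le: "norm (Y z) \<le> \<delta>" and W_le: "norm (W z) \<le> \<delta>" for z
    by (auto simp: Y_def W_def case_prod_beta intro: position_shift_le[OF S] velocity_shift_le[OF S])
  have fst_snd: "norm (fst z - fst z') \<le> norm (z - z')" "norm (snd z - snd z') \<le> norm (z - z')" for z z' :: "'a \<times> 'a"
    using dist_fst_le[of z z'] dist_snd_le[of z z'] by (simp_all only: dist_norm)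
  have YW_Lip: "norm (Y z - Y z') \<le> 2 * norm (z - z')" "norm (W z - W z') \<le> 2 * norm (z - z')" for z z'
    using shift_Lipschitz[OF S, of "fst z" "snd z" "fst z'" "snd z'"] fst_snd[of z z']
    by (auto simp: Y_def W_def case_prod_beta)
  have cont_YW: "continuous_on UNIV Y" "continuous_on UNIV W"
    by (rule lipschitz_on_continuous_on[of 2], rule lipschitz_onI; use YW_Lip in \<open>simp add: dist_norm\<close>)+
  have f0_cont: "continuous_on UNIV f0"
    using classical_solution_continuous[OF sol, of 0] f_0 by simp
  note f0_le = initial_datum_bounds(1)[OF f0_cont \<epsilon>(1) k f0]
  have K0: "K0 \<ge> 0" using k by (simp add: K0_def)
  have f0_Lip: "\<bar>f0 z - f0 z'\<bar> \<le> K0 * norm (z - z')" for z z'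
  proof -
    have "\<bar>f0 z - f0 z'\<bar> \<le> real DIM('a \<times> 'a) * (2 * \<epsilon> * (1 + k)) * norm (z - z')"
      by (rule initial_datum_bounds(2)[OF f0_cont \<epsilon>(1) k f0])
    also have "\<dots> \<le> real DIM('a \<times> 'a) * (2 * 1 * (1 + k)) * norm (z - z')"
      using \<epsilon>(2) k by (intro mult_right_mono mult_left_mono) auto
    finally show ?thesis by (simp add: K0_def)
  qed
  define f_inf where "f_inf = (\<lambda>(x, v). f0 (x + Y (x, v), v + W (x, v)) + \<mu> (v + W (x, v)) - \<mu> v)"
  have f_inf_le: "\<bar>f_inf z\<bar> \<le> 2 * \<epsilon> + L * \<delta>" for z
  proof -
    have "\<bar>\<mu> (snd z + W z) - \<mu> (snd z)\<bar> \<le> L * norm (snd z + W z - snd z)" by (rule \<mu>(2))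
    also have "\<dots> \<le> L * \<delta>" using W_le[of z] L by (intro mult_left_mono) auto
    finally show ?thesis
      using f0_le[of "(fst z + Y z, snd z + W z)"] by (simp add: f_inf_def case_prod_beta)
  qed
  have f_inf_Lip: "\<bar>f_inf z - f_inf z'\<bar> \<le> (6 * K0 + 4 * L) * norm (z - z')" for z z'
  proof -
    let ?d = "norm (z - z')"
    have sh: "norm ((fst z + Y z) - (fst z' + Y z')) \<le> 3 * ?d" "norm ((snd z + W z) - (snd z' + W z')) \<le> 3 * ?d"
      using norm_triangle_ineq[of "fst z - fst z'" "Y z - Y z'"] norm_triangle_ineq[of "snd z - snd z'" "W z - W z'"]
        YW_Lip[of z z'] fst_snd[of z z'] by (auto simp: algebra_simps)
    have "norm ((fst z + Y z, snd z + W z) - (fst z' + Y z', snd z' + W z')) \<le> 6 * ?d"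
      using norm_Pair_le[of "(fst z + Y z) - (fst z' + Y z')" "(snd z + W z) - (snd z' + W z')"] sh by simp
    then have 1: "\<bar>f0 (fst z + Y z, snd z + W z) - f0 (fst z' + Y z', snd z' + W z')\<bar> \<le> K0 * (6 * ?d)"
      using f0_Lip K0 by (meson mult_left_mono order_trans)
    have 2: "\<bar>\<mu> (snd z + W z) - \<mu> (snd z' + W z')\<bar> \<le> L * (3 * ?d)"
      using \<mu>(2) sh(2) L by (meson mult_left_mono order_trans)
    have 3: "\<bar>\<mu> (snd z) - \<mu> (snd z')\<bar> \<le> L * ?d"
      using \<mu>(2) fst_snd(2)[of z z'] L by (meson mult_left_mono order_trans)
    have "\<bar>f_inf z - f_inf z'\<bar> \<le> K0 * (6 * ?d) + L * (3 * ?d) + L * ?d"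
      using 1 2 3 by (simp add: f_inf_def case_prod_beta)
    then show ?thesis by (simp add: algebra_simps)
  qed
  have transported: "f t (x + t *\<^sub>R v, v) + \<mu> v =
      f0 (x + position_shift {0..t} x v, v + velocity_shift {0..t} x v) + \<mu> (v + velocity_shift {0..t} x v)"
    if t: "t \<ge> 0" for t x v
  proof -
    have "((\<lambda>(t, z). f t z + \<mu> (snd z)) has_derivative
        (\<lambda>(\<tau>, y, u). \<tau> * ft s (x, v) + y \<bullet> fx s (x, v) + u \<bullet> (fv s (x, v) + gradient \<mu> v)))
        (at (s, x, v) within {0..} \<times> UNIV)" if s: "s \<ge> 0" for s x v
    proof -
      have \<mu>d: "(\<mu> has_derivative frechet_derivative \<mu> (at v)) (at v)" by (rule smooth_has_derivative[OF \<mu>(1)])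
      have p: "((\<lambda>p. snd (snd p)) has_derivative (\<lambda>h. snd (snd h))) (at (s, x, v) within {0..} \<times> UNIV)"
        by (intro derivative_intros)
      have \<mu>d': "(\<mu> has_derivative frechet_derivative \<mu> (at v)) (at (snd (snd (s, x, v))))"
        using \<mu>d by simp
      have "((\<lambda>p. \<mu> (snd (snd p))) has_derivative (\<lambda>h. frechet_derivative \<mu> (at v) (snd (snd h))))
          (at (s, x, v) within {0..} \<times> UNIV)"
        by (rule has_derivative_compose[OF p \<mu>d'])
      have "((\<lambda>p. (case p of (t, z) \<Rightarrow> f t z) + \<mu> (snd (snd p))) has_derivative
          (\<lambda>h. (case h of (\<tau>, y, u) \<Rightarrow> \<tau> * ft s (x, v) + y \<bullet> fx s (x, v) + u \<bullet> fv s (x, v)) +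
            frechet_derivative \<mu> (at v) (snd (snd h)))) (at (s, x, v) within {0..} \<times> UNIV)"
        by (rule has_derivative_add[OF der[OF s] \<open>((\<lambda>p. \<mu> (snd (snd p))) has_derivative _) _\<close>])
      moreover have "(\<lambda>p. (case p of (t, z) \<Rightarrow> f t z) + \<mu> (snd (snd p))) = (\<lambda>(t, z). f t z + \<mu> (snd z))"
        by auto
      moreover have "(\<lambda>h. (case h of (\<tau>, y, u) \<Rightarrow> \<tau> * ft s (x, v) + y \<bullet> fx s (x, v) + u \<bullet> fv s (x, v)) +
            frechet_derivative \<mu> (at v) (snd (snd h))) =
          (\<lambda>(\<tau>, y, u). \<tau> * ft s (x, v) + y \<bullet> fx s (x, v) + u \<bullet> (fv s (x, v) + gradient \<mu> v))"
        by (auto simp: fun_eq_iff inner_add_right inner_gradient[OF \<mu>d])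
      ultimately show ?thesis by simp
    qed
    moreover have "ft s (x, v) + v \<bullet> fx s (x, v) + E' s x \<bullet> (fv s (x, v) + gradient \<mu> v) = 0" if "s \<ge> 0" for s x v
      using eqn[rule_format, OF that, of x v] that by (simp add: E'_def inner_add_right)
    ultimately have "f t (x + t *\<^sub>R v, v) + \<mu> (snd (x + t *\<^sub>R v, v)) =
        f 0 (x + position_shift {0..t} x v, v + velocity_shift {0..t} x v) +
        \<mu> (snd (x + position_shift {0..t} x v, v + velocity_shift {0..t} x v))"
      by (intro transported_along_characteristics[OF t, where G = "\<lambda>t z. f t z + \<mu> (snd z)" and Gt = ft and Gx = fx
            and Gv = "\<lambda>t z. fv t z + gradient \<mu> (snd z)"]) simp_all
    then show ?thesis by (simp add: f_0)
  qed
  \<comment> \<open>the shifts at time \<open>t\<close> give \<open>f\<close>, those at infinity give \<open>f_inf\<close>\<close>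
  have diff_le: "\<bar>f t (x + t *\<^sub>R v, v) - f_inf (x, v)\<bar> \<le> (12 * K0 + 6 * L) * C1 * \<epsilon> * (ln (2 + t) / japanese t ^ (?n - 1))"
    if t: "t \<ge> 0" for t x v
  proof -
    let ?Yt = "position_shift {0..t} x v" and ?Wt = "velocity_shift {0..t} x v"
    have sh: "norm (?Yt - Y (x, v)) \<le> 2 * \<delta> * tail t" "norm (?Wt - W (x, v)) \<le> 2 * \<delta> * tail t"
      using shift_cutoff_le[OF t, of x v] by (simp_all add: Y_def W_def)
    have "norm ((x + ?Yt, v + ?Wt) - (x + Y (x, v), v + W (x, v))) \<le> 4 * \<delta> * tail t"
      using norm_Pair_le[of "?Yt - Y (x, v)" "?Wt - W (x, v)"] sh by simp
    then have 1: "\<bar>f0 (x + ?Yt, v + ?Wt) - f0 (x + Y (x, v), v + W (x, v))\<bar> \<le> K0 * (4 * \<delta> * tail t)"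
      using f0_Lip K0 by (meson mult_left_mono order_trans)
    have "norm ((v + ?Wt) - (v + W (x, v))) \<le> 2 * \<delta> * tail t" using sh(2) by simp
    then have 2: "\<bar>\<mu> (v + ?Wt) - \<mu> (v + W (x, v))\<bar> \<le> L * (2 * \<delta> * tail t)"
      using \<mu>(2) L by (meson mult_left_mono order_trans)
    have "f t (x + t *\<^sub>R v, v) - f_inf (x, v) = (f0 (x + ?Yt, v + ?Wt) - f0 (x + Y (x, v), v + W (x, v))) +
        (\<mu> (v + ?Wt) - \<mu> (v + W (x, v)))"
      using transported[OF t, of x v] by (simp add: f_inf_def)
    then have "\<bar>f t (x + t *\<^sub>R v, v) - f_inf (x, v)\<bar> \<le> K0 * (4 * \<delta> * tail t) + L * (2 * \<delta> * tail t)"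
      using 1 2 by linarith
    also have "\<dots> = (4 * K0 + 2 * L) * \<delta> * tail t" by (simp add: algebra_simps)
    also have "\<dots> \<le> (4 * K0 + 2 * L) * \<delta> * (3 * (ln (2 + t) / japanese t ^ (?n - 1)))"
      using K0 L C1 \<epsilon> by (intro mult_left_mono tail_le t) (auto simp: \<delta>_def)
    finally show ?thesis by (simp add: \<delta>_def algebra_simps)
  qed
  have f_inf_cont: "continuous_on UNIV f_inf"
    by (rule lipschitz_on_continuous_on[of "6 * K0 + 4 * L"], rule lipschitz_onI)
      (use f_inf_Lip K0 L in \<open>auto simp: dist_norm\<close>)
  have "Lp_norm \<infinity> Y \<le> ennreal \<delta>" "Lp_norm \<infinity> W \<le> ennreal \<delta>"
    by (intro Lp_norm_infinity_le borel_measurable_continuous_onI cont_YW AE_I2 Y_le W_le)+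
  then have "Lp_norm \<infinity> Y + Lp_norm \<infinity> W \<le> ennreal \<delta> + ennreal \<delta>" by (rule add_mono)
  also have "\<dots> = ennreal (2 * C1 * \<epsilon>)"
    using C1 \<epsilon> by (simp add: \<delta>_def flip: ennreal_plus)
  finally have YW: "Lp_norm \<infinity> Y + Lp_norm \<infinity> W \<le> ennreal (2 * C1 * \<epsilon>)" .
  have "Lp_norm \<infinity> (\<lambda>(x, v). f t (x + t *\<^sub>R v, v) - f_inf (x, v))
      \<le> ennreal ((12 * K0 + 6 * L) * C1 * \<epsilon> * (ln (2 + t) / japanese t ^ (?n - 1)))" if t: "t \<ge> 0" for t
  proof (rule Lp_norm_infinity_le)
    have "continuous_on UNIV (\<lambda>z. f t (fst z + t *\<^sub>R snd z, snd z) - f_inf z)"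
      by (intro continuous_on_diff f_inf_cont continuous_on_compose2[OF classical_solution_continuous[OF sol t]]
          continuous_intros) auto
    then show "(\<lambda>(x, v). f t (x + t *\<^sub>R v, v) - f_inf (x, v)) \<in> borel_measurable borel"
      by (intro borel_measurable_continuous_onI) (simp add: case_prod_beta')
  qed (use diff_le[OF t] in auto)
  moreover have "sobolev_norm 1 \<infinity> f_inf < \<infinity>"
    by (rule sobolev_norm_1_infinity_finite[OF f_inf_le f_inf_Lip])
  ultimately show ?thesis
    using YW by (intro exI[of _ Y] exI[of _ W]) (simp add: Let_def flip: f_inf_def)
qed

theorem corollary1p1:
  fixes \<mu> :: "real ^ 'd \<Rightarrow> real" and k \<sigma> p p' M :: real
  assumes "CARD('d) \<ge> 3"
    and "regular_equilibrium \<mu>" and "penrose_stable \<mu>"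
    and "k > real CARD('d)" and "\<sigma> > 1" and "p > 1"
    and "p * (\<sigma> - 1) > 2 * real CARD('d)"
    and "1 / p + 1 / p' = 1"
    and "M > 0"
  shows "\<exists>\<epsilon>bar>0. \<exists>C>0. \<forall>\<epsilon>0. 0 < \<epsilon>0 \<and> \<epsilon>0 \<le> \<epsilon>bar \<longrightarrow>
    (\<forall>(f0 :: (real ^ 'd) \<times> (real ^ 'd) \<Rightarrow> real) f.
       sobolev_norm 1 \<infinity> f0 < \<infinity> \<and> sobolev_norm 1 1 f0 < \<infinity> \<and>
       slobodeckij_norm \<sigma> p (v_weight (k / p') f0) < \<infinity> \<and>
       sobolev_norm 1 \<infinity> (v_weight k f0) + sobolev_norm 1 1 f0
         + L1x_Linfv_norm f0 + weak_gradient_norm L1x_Linfv_norm f0 \<le> ennreal \<epsilon>0 \<and>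
       global_solution \<mu> k \<sigma> p p' M \<epsilon>0 f0 f \<longrightarrow>
       (\<exists>(Y :: (real ^ 'd) \<times> (real ^ 'd) \<Rightarrow> real ^ 'd) (W :: (real ^ 'd) \<times> (real ^ 'd) \<Rightarrow> real ^ 'd).
          Lp_norm \<infinity> Y + Lp_norm \<infinity> W \<le> ennreal (C * \<epsilon>0) \<and>
          (let f_inf = (\<lambda>(x, v). f0 (x + Y (x, v), v + W (x, v)) + \<mu> (v + W (x, v)) - \<mu> v) in
             sobolev_norm 1 \<infinity> f_inf < \<infinity> \<and>
             (\<forall>t\<ge>0. Lp_norm \<infinity> (\<lambda>(x, v). f t (x + t *\<^sub>R v, v) - f_inf (x, v))
                \<le> ennreal (C * \<epsilon>0 * (ln (2 + t) / japanese t ^ (CARD('d) - 1)))))))"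
proof -
  obtain L where L: "L \<ge> 0" "\<And>x y. \<bar>\<mu> x - \<mu> y\<bar> \<le> L * norm (x - y)"
    using regular_equilibrium_Lipschitz[OF assms(2)] by metis
  define C1 where "C1 = 12 * real DIM(real ^ 'd) * M * 3 ^ Suc DIM(real ^ 'd)"
  define K0 where "K0 = real DIM((real ^ 'd) \<times> (real ^ 'd)) * (2 * (1 + k))"
  define C where "C = (2 + 12 * K0 + 6 * L) * C1"
  have k: "k \<ge> 0" using assms(4) by linarith
  have C1: "C1 > 0" using assms(1,9) by (simp add: C1_def)
  have K0: "K0 \<ge> 0" using k by (simp add: K0_def)
  have C: "C > 0" unfolding C_def using C1 K0 L(1) by (intro mult_pos_pos) auto
  have sm: "smooth \<mu>" using assms(2) by (simp add: regular_equilibrium_def)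
  have pos: "0 < min 1 (1 / (2 * C1))" using C1 by simp
  show ?thesis
  proof (rule exI[of _ "min 1 (1 / (2 * C1))"], rule conjI[OF pos], rule exI[of _ C], rule conjI[OF C],
      intro allI impI)
    fix \<epsilon> f0 f
    assume "0 < \<epsilon> \<and> \<epsilon> \<le> min 1 (1 / (2 * C1))"
    then have \<epsilon>: "\<epsilon> > 0" "\<epsilon> \<le> 1" "C1 * \<epsilon> \<le> 1 / 2"
      using C1 by (auto simp: field_simps)
    assume hyp: "sobolev_norm 1 \<infinity> f0 < \<infinity> \<and> sobolev_norm 1 1 f0 < \<infinity> \<and>
       slobodeckij_norm \<sigma> p (v_weight (k / p') f0) < \<infinity> \<and>
       sobolev_norm 1 \<infinity> (v_weight k f0) + sobolev_norm 1 1 f0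
         + L1x_Linfv_norm f0 + weak_gradient_norm L1x_Linfv_norm f0 \<le> ennreal \<epsilon> \<and>
       global_solution \<mu> k \<sigma> p p' M \<epsilon> f0 f"
    have f0: "sobolev_norm 1 \<infinity> (v_weight k f0) \<le> ennreal \<epsilon>"
      by (rule order_trans[of _ "sobolev_norm 1 \<infinity> (v_weight k f0) + sobolev_norm 1 1 f0
         + L1x_Linfv_norm f0 + weak_gradient_norm L1x_Linfv_norm f0"]) (use hyp in \<open>auto simp: add.assoc\<close>)
    obtain Y W where YW: "Lp_norm \<infinity> Y + Lp_norm \<infinity> W \<le> ennreal (2 * C1 * \<epsilon>)"
      and f_inf: "let f_inf = (\<lambda>(x, v). f0 (x + Y (x, v), v + W (x, v)) + \<mu> (v + W (x, v)) - \<mu> v) in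
        sobolev_norm 1 \<infinity> f_inf < \<infinity> \<and>
        (\<forall>t\<ge>0. Lp_norm \<infinity> (\<lambda>(x, v). f t (x + t *\<^sub>R v, v) - f_inf (x, v))
           \<le> ennreal ((12 * K0 + 6 * L) * C1 * \<epsilon> * (ln (2 + t) / japanese t ^ (DIM(real ^ 'd) - 1))))"
      using solution_scatters[of \<mu> L k M \<epsilon> f0 f] assms(1,9) sm L k \<epsilon> f0 hyp
      unfolding C1_def K0_def global_solution_def by auto
    have "2 * C1 \<le> C" "(12 * K0 + 6 * L) * C1 \<le> C"
      unfolding C_def using C1 K0 L(1) by (auto intro!: mult_right_mono)
    then have le: "2 * C1 * \<epsilon> \<le> C * \<epsilon>" "(12 * K0 + 6 * L) * C1 * \<epsilon> \<le> C * \<epsilon>"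
      using \<epsilon>(1) by (auto intro!: mult_right_mono)
    have "(12 * K0 + 6 * L) * C1 * \<epsilon> * (ln (2 + t) / japanese t ^ (CARD('d) - 1)) \<le>
        C * \<epsilon> * (ln (2 + t) / japanese t ^ (CARD('d) - 1))" if "t \<ge> 0" for t
      using that japanese_ge_1[of t] by (intro mult_right_mono[OF le(2)]) auto
    then show "\<exists>Y W. Lp_norm \<infinity> Y + Lp_norm \<infinity> W \<le> ennreal (C * \<epsilon>) \<and>
          (let f_inf = (\<lambda>(x, v). f0 (x + Y (x, v), v + W (x, v)) + \<mu> (v + W (x, v)) - \<mu> v) in
             sobolev_norm 1 \<infinity> f_inf < \<infinity> \<and>
             (\<forall>t\<ge>0. Lp_norm \<infinity> (\<lambda>(x, v). f t (x + t *\<^sub>R v, v) - f_inf (x, v))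
                \<le> ennreal (C * \<epsilon> * (ln (2 + t) / japanese t ^ (CARD('d) - 1)))))"
      using f_inf order_trans[OF YW ennreal_leI[OF le(1)]]
      by (intro exI[of _ Y] exI[of _ W]) (auto simp: Let_def intro: order_trans[OF _ ennreal_leI])
  qed
qed

end
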